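(* Let $\Sigma^n$ be a complete noncompact properly immersed self-shrinker in Euclidean space $\mathbb{R}^{n+1}$, with mean curvature $H$, and let $\beta$ be a nonnegative constant with $\beta\le\inf_\Sigma H^2$. Then there is a positive constant $C$ such that for all $r\ge 1$ $$\operatorname{Vol}(B_r(0)\cap\Sigma)\le C r^{n-2\beta}.$$
   Context: A self-shrinker in $\mathbb{R}^{n+1}$ is an $n$-dimensional immersed hypersurface $\Sigma$ satisfying $H=\frac{\langle x,\mathbf{n}\rangle}{2}$, where $x$ is the position vector, $\mathbf{n}$ is the (outward) unit normal and $H=-\sum_{i=1}^n\langle\overline{\nabla}_{e_i}e_i,\mathbf{n}\rangle$ is the mean curvature, with $\{e_i\}$ a local orthonormal tangent frame of $\Sigma$ and $\overline\nabla$ the flat connection of $\mathbb{R}^{n+1}$. Complete means that the induced Riemannian metric on $\Sigma$ is complete; properly immersed means that the immersion $\Sigma\to\mathbb{R}^{n+1}$ is a proper map. $B_r(0)=\{x\in\mathbb{R}^{n+1}:|x|<r\}$, and $\operatorname{Vol}(B_r(0)\cap\Sigma)$ is the $n$-dimensional volume, in the induced metric, of the set of points of $\Sigma$ whose position vector $x$ satisfies $|x|<r$. *)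

theory Defs
  imports "HOL-Analysis.Analysis"
begin

section \<open>Smooth maps between open subsets of normed spaces\<close>

text \<open>Only meaningful for an open set \<open>U\<close>: derivatives are taken at points, not within \<open>U\<close>.\<close>

primrec Ck_on :: "nat \<Rightarrow> ('a::real_normed_vector \<Rightarrow> 'b::real_normed_vector) \<Rightarrow> 'a set \<Rightarrow> bool"
  where
    "Ck_on 0 f U \<longleftrightarrow> continuous_on U f"
  | "Ck_on (Suc k) f U \<longleftrightarrow> (\<forall>x\<in>U. f differentiable (at x)) \<and>
       (\<forall>v. Ck_on k (\<lambda>x. frechet_derivative f (at x) v) U)"

definition smooth_on ::
    "'a::real_normed_vector set \<Rightarrow> ('a \<Rightarrow> 'b::real_normed_vector) \<Rightarrow> bool"
  where "smooth_on U f \<longleftrightarrow> (\<forall>k. Ck_on k f U)"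

section \<open>Smooth manifolds and immersed hypersurfaces\<close>

text \<open>
  The underlying space of the \<open>n\<close>-manifold is a whole type \<open>'s\<close>, Hausdorff and second countable
  by its type classes, with \<open>n = CARD('n)\<close>. Connectedness is not required.
  A chart is recorded by its inverse, a local parametrization \<open>\<phi>\<close> defined on an open set
  \<open>U\<close> of \<open>\<real>\<^sup>n\<close>; the values of \<open>\<phi>\<close> outside \<open>U\<close> are irrelevant.
\<close>

type_synonym ('n, 's) param = "(real^'n) set \<times> (real^'n \<Rightarrow> 's)"

definition smooth_atlas :: "('n::finite, 's::{t2_space,second_countable_topology}) param set \<Rightarrow> bool"
  where "smooth_atlas A \<longleftrightarrow>
    (\<forall>(U, \<phi>)\<in>A. open U \<and> open (\<phi> ` U) \<and> (\<exists>\<psi>. homeomorphism U (\<phi> ` U) \<phi> \<psi>)) \<and>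
    (\<Union>(U, \<phi>)\<in>A. \<phi> ` U) = UNIV \<and>
    (\<forall>(U, \<phi>)\<in>A. \<forall>(V, \<eta>)\<in>A. smooth_on (U \<inter> \<phi> -` (\<eta> ` V)) (inv_into V \<eta> \<circ> \<phi>))"

definition immersed_hypersurface ::
    "('n::finite, 's::{t2_space,second_countable_topology}) param set \<Rightarrow> ('s \<Rightarrow> real^'k::finite) \<Rightarrow> bool"
  where "immersed_hypersurface A F \<longleftrightarrow>
    CARD('k) = CARD('n) + 1 \<and> smooth_atlas A \<and>
    (\<forall>(U, \<phi>)\<in>A. smooth_on U (F \<circ> \<phi>) \<and>
       (\<forall>u\<in>U. inj (frechet_derivative (F \<circ> \<phi>) (at u))))"

section \<open>Unit normals and mean curvature\<close>

definition tangent_space ::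
    "('n::finite, 's) param set \<Rightarrow> ('s \<Rightarrow> real^'k::finite) \<Rightarrow> 's \<Rightarrow> (real^'k) set"
  where "tangent_space A F p =
    {frechet_derivative (F \<circ> \<phi>) (at u) v | U \<phi> u v. (U, \<phi>) \<in> A \<and> u \<in> U \<and> \<phi> u = p}"

text \<open>
  The unit normal is chosen point by point, and neither continuity nor orientability is required:
  both sides of the self-shrinker equation are linear in the normal, so the equation and \<open>H\<^sup>2\<close>
  do not depend on the choice. In particular the outward normal is allowed.
\<close>

definition unit_normal ::
    "('n::finite, 's) param set \<Rightarrow> ('s \<Rightarrow> real^'k::finite) \<Rightarrow> ('s \<Rightarrow> real^'k) \<Rightarrow> bool"
  where "unit_normal A F \<nu> \<longleftrightarrow>
    (\<forall>p. norm (\<nu> p) = 1 \<and> (\<forall>w\<in>tangent_space A F p. \<nu> p \<bullet> w = 0))"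

text \<open>
  The map \<open>v i\<close> gives the frame field \<open>e\<^sub>i\<close> in the coordinates of the parametrization \<open>\<phi>\<close>, and
  \<open>frame_field F \<phi> v i\<close> is \<open>e\<^sub>i\<close> itself as a vector field along \<open>X = F \<circ> \<phi>\<close>.
  The ambient derivative of \<open>e\<^sub>i\<close> in the direction \<open>e\<^sub>i = dX (v i)\<close> is therefore
  the derivative of \<open>e\<^sub>i\<close>, read as a function of the parameter, in the direction \<open>v i\<close>.
\<close>

definition frame_field ::
    "('s \<Rightarrow> real^'k::finite) \<Rightarrow> (real^'n::finite \<Rightarrow> 's) \<Rightarrow> ('n \<Rightarrow> real^'n \<Rightarrow> real^'n) \<Rightarrow>
     'n \<Rightarrow> real^'n \<Rightarrow> real^'k"
  where "frame_field F \<phi> v i u = frechet_derivative (F \<circ> \<phi>) (at u) (v i u)"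

definition orthonormal_frame_on ::
    "(real^'n::finite) set \<Rightarrow> ('s \<Rightarrow> real^'k::finite) \<Rightarrow> (real^'n \<Rightarrow> 's) \<Rightarrow>
     ('n \<Rightarrow> real^'n \<Rightarrow> real^'n) \<Rightarrow> bool"
  where "orthonormal_frame_on W F \<phi> v \<longleftrightarrow>
    (\<forall>i. smooth_on W (v i)) \<and>
    (\<forall>u\<in>W. \<forall>i j. frame_field F \<phi> v i u \<bullet> frame_field F \<phi> v j u = (if i = j then 1 else 0))"

text \<open>
  The value is independent of the parametrization and of the frame, and a frame exists near each
  point, so the description is definite for an immersion.
\<close>

definition mean_curvature ::
    "('n::finite, 's) param set \<Rightarrow> ('s \<Rightarrow> real^'k::finite) \<Rightarrow> ('s \<Rightarrow> real^'k) \<Rightarrow> 's \<Rightarrow> real"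
  where "mean_curvature A F \<nu> p =
    (THE h. \<exists>U \<phi> W v u. (U, \<phi>) \<in> A \<and> open W \<and> W \<subseteq> U \<and> u \<in> W \<and> \<phi> u = p \<and>
       orthonormal_frame_on W F \<phi> v \<and>
       h = - (\<Sum>i\<in>UNIV. frechet_derivative (frame_field F \<phi> v i) (at u) (v i u) \<bullet> \<nu> p))"

definition self_shrinker ::
    "('n::finite, 's::{t2_space,second_countable_topology}) param set \<Rightarrow> ('s \<Rightarrow> real^'k::finite) \<Rightarrow>
     ('s \<Rightarrow> real^'k) \<Rightarrow> bool"
  where "self_shrinker A F \<nu> \<longleftrightarrow>
    immersed_hypersurface A F \<and> unit_normal A F \<nu> \<and>
    (\<forall>p. mean_curvature A F \<nu> p = (F p \<bullet> \<nu> p) / 2)"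

section \<open>Completeness of the induced metric\<close>

definition piecewise_C1_curve ::
    "('n::finite, 's::topological_space) param set \<Rightarrow> (real \<Rightarrow> 's) \<Rightarrow> bool"
  where "piecewise_C1_curve A \<gamma> \<longleftrightarrow>
    continuous_on {0..1} \<gamma> \<and>
    (\<exists>T. finite T \<and> (\<forall>(U, \<phi>)\<in>A.
       (inv_into U \<phi> \<circ> \<gamma>) C1_differentiable_on ({0..1} \<inter> \<gamma> -` (\<phi> ` U) - T)))"

text \<open>
  In the induced metric the speed of \<open>\<gamma>\<close> is the Euclidean norm of the velocity of \<open>F \<circ> \<gamma>\<close>.
  A curve whose speed is not integrable has infinite length, and points not joined by a curve
  have infinite distance.
\<close>

definition curve_length :: "('s \<Rightarrow> real^'k::finite) \<Rightarrow> (real \<Rightarrow> 's) \<Rightarrow> ennreal"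
  where "curve_length F \<gamma> =
    (\<integral>\<^sup>+t\<in>{0..1}. ennreal (norm (vector_derivative (F \<circ> \<gamma>) (at t))) \<partial>lborel)"

definition riemannian_dist ::
    "('n::finite, 's::topological_space) param set \<Rightarrow> ('s \<Rightarrow> real^'k::finite) \<Rightarrow> 's \<Rightarrow> 's \<Rightarrow> ennreal"
  where "riemannian_dist A F p q =
    (INF \<gamma>\<in>{\<gamma>. piecewise_C1_curve A \<gamma> \<and> \<gamma> 0 = p \<and> \<gamma> 1 = q}. curve_length F \<gamma>)"

definition riemannian_complete ::
    "('n::finite, 's::topological_space) param set \<Rightarrow> ('s \<Rightarrow> real^'k::finite) \<Rightarrow> bool"
  where "riemannian_complete A F \<longleftrightarrow>
    (\<forall>s :: nat \<Rightarrow> 's.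
       (\<forall>\<epsilon>>0. \<exists>N. \<forall>m\<ge>N. \<forall>k\<ge>N. riemannian_dist A F (s m) (s k) < \<epsilon>) \<longrightarrow>
       (\<exists>p. (\<lambda>k. riemannian_dist A F (s k) p) \<longlonglongrightarrow> 0))"

section \<open>Volume in the induced metric\<close>

definition metric_matrix ::
    "('s \<Rightarrow> real^'k::finite) \<Rightarrow> (real^'n::finite \<Rightarrow> 's) \<Rightarrow> real^'n \<Rightarrow> real^'n^'n"
  where "metric_matrix F \<phi> u =
    (\<chi> i j. frechet_derivative (F \<circ> \<phi>) (at u) (axis i 1) \<bullet>
            frechet_derivative (F \<circ> \<phi>) (at u) (axis j 1))"

text \<open>
  The unique Borel measure that in every parametrization has density \<open>sqrt (det g)\<close> with respect
  to Lebesgue measure. Sets are counted in the manifold, hence with multiplicity in the image.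
\<close>

definition riemannian_volume ::
    "('n::finite, 's::topological_space) param set \<Rightarrow> ('s \<Rightarrow> real^'k::finite) \<Rightarrow> 's measure"
  where "riemannian_volume A F =
    (THE \<mu>. sets \<mu> = sets borel \<and>
       (\<forall>(U, \<phi>)\<in>A. \<forall>S\<in>sets borel. S \<subseteq> \<phi> ` U \<longrightarrow>
          emeasure \<mu> S =
            (\<integral>\<^sup>+u\<in>U \<inter> \<phi> -` S. ennreal (sqrt (det (metric_matrix F \<phi> u))) \<partial>lborel)))"

end

theory Submission
  imports Defs "HOL-Real_Asymp.Real_Asymp"
begin

text \<open>
  Put \<open>f = |x|\<^sup>2 / 4\<close>. On a self-shrinker \<open>\<Delta> f = n/2 - H\<^sup>2\<close> and \<open>|\<nabla> f|\<^sup>2 = f - H\<^sup>2\<close>, so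
  \<open>\<beta> \<le> H\<^sup>2 \<le> f\<close>, and integrating the divergence of \<open>\<theta>(f) \<nabla> f\<close> gives
  \<open>\<integral> \<theta>(f) (n/2 - H\<^sup>2) + \<theta>'(f) (f - H\<^sup>2) = 0\<close> whenever \<open>\<theta>\<close> vanishes near infinity.
  Let \<open>k = n/2 - \<beta>\<close>. If \<open>k \<le> 0\<close>, then both terms have a sign for a decreasing \<open>\<theta>\<close>, which forces
  \<open>f = n/2\<close> and contradicts noncompactness. If \<open>k > 0\<close>, take for \<open>\<theta>\<close> a truncation of
  \<open>((R / (f - \<beta>))\<^sup>k\<^sup>/\<^sup>2 - 1)\<^sup>2\<close>: the integrand is at most \<open>k (R/k)\<^sup>k\<close> on a fixed compact set, nonpositive
  elsewhere and at most \<open>-k\<close> on the rest of \<open>{f \<le> c R}\<close>, so the volume of the latter set is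
  \<open>O(R\<^sup>k)\<close>. With \<open>R\<close> proportional to \<open>r\<^sup>2\<close> this is the claim.
\<close>

section \<open>Calculus of \<open>C\<^sup>k\<close> maps\<close>

text \<open>For fixed \<open>f\<close> the integrand is affine in \<open>H\<^sup>2\<close>, so only
  the endpoints \<open>H\<^sup>2 = \<beta>\<close> and \<open>H\<^sup>2 = f\<close> count. With
  \<open>z = f - \<beta>\<close> they give \<open>k \<theta> + z \<theta>'\<close> and
  \<open>(k - z) \<theta>\<close>. The first expression vanishes for multiples of
  \<open>z powr (- k)\<close>, which never reach 0. Subtracting 1 from the square root of such a
  solution and squaring again produces a C^1 zero at \<open>z = R\<close> and makes the expression
  negative, of size at least \<open>k\<close> where the root minus 1 is at least 1. The second
  expression is controlled by \<open>z \<ge> 2 * k\<close>.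

  The definitions shape the rest. Mean curvature and Riemannian measure are definite descriptions:
  the first requires independence of chart and frame, the second existence and uniqueness, hence a
  change of variables. The normal is chosen pointwise, so the continuity of \<open>H\<^sup>2\<close>
  has to come from the potential. The divergence theorem is reduced to a single chart by C^1 bump
  functions, and there to the translation invariance of Lebesgue measure.\<close>

lemma frechet_derivative_eqI:
  "(f has_derivative f') (at x) \<Longrightarrow> frechet_derivative f (at x) = f'"
  using frechet_derivative_at by metis

lemma differentiable_has_frechet_derivative:
  "f differentiable (at x) \<Longrightarrow> (f has_derivative frechet_derivative f (at x)) (at x)"
  using frechet_derivative_works by blast

lemma frechet_derivative_cong_open:
  assumes "open U" "x \<in> U" "\<And>y. y \<in> U \<Longrightarrow> f y = g y"
  shows "frechet_derivative f (at x) = frechet_derivative g (at x)"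
proof -
  have "(f has_derivative f') (at x) \<longleftrightarrow> (g has_derivative f') (at x)" for f'
    using assms has_derivative_transform_within_open[of f f' x UNIV U g]
      has_derivative_transform_within_open[of g f' x UNIV U f] by metis
  then show ?thesis
    by (simp add: frechet_derivative_def)
qed

lemma differentiable_cong_open:
  assumes "open U" "x \<in> U" "\<And>y. y \<in> U \<Longrightarrow> f y = g y"
  shows "f differentiable (at x) \<longleftrightarrow> g differentiable (at x)"
  using assms has_derivative_transform_within_open[of f _ x UNIV U g]
      has_derivative_transform_within_open[of g _ x UNIV U f] unfolding differentiable_def by metis

lemma Ck_on_cong:
  assumes "open U" "\<And>x. x \<in> U \<Longrightarrow> f x = g x"
  shows "Ck_on k f U \<longleftrightarrow> Ck_on k g U"
  using assms(2)
proof (induction k arbitrary: f g)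
  case 0
  then show ?case by (simp cong: continuous_on_cong)
next
  case (Suc k)
  have "Ck_on k (\<lambda>x. frechet_derivative f (at x) v) U \<longleftrightarrow> Ck_on k (\<lambda>x. frechet_derivative g (at x) v) U" for v
    using frechet_derivative_cong_open[OF assms(1) _ Suc.prems] by (intro Suc.IH) auto
  moreover have "(\<forall>x\<in>U. f differentiable (at x)) \<longleftrightarrow> (\<forall>x\<in>U. g differentiable (at x))"
    by (intro ball_cong refl differentiable_cong_open[OF assms(1)]) (use Suc.prems in auto)
  ultimately show ?case by simp
qed

lemma Ck_on_Suc_imp: "Ck_on (Suc k) f U \<Longrightarrow> Ck_on k f U"
proof (induction k arbitrary: f)
  case 0
  then show ?case
    by (auto intro!: continuous_at_imp_continuous_on differentiable_imp_continuous_within)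
next
  case (Suc k)
  then show ?case by simp
qed

lemma Ck_on_mono: "Ck_on k f U \<Longrightarrow> j \<le> k \<Longrightarrow> Ck_on j f U"
proof (induction "k - j" arbitrary: k)
  case (Suc m)
  obtain i where k: "k = Suc i"
    using Suc.hyps(2) by (cases k) auto
  have "Ck_on i f U"
    using Suc.prems(1) unfolding k by (rule Ck_on_Suc_imp)
  then show ?case
    using Suc.hyps k by (intro Suc.hyps(1)) auto
qed auto

lemma Ck_on_imp_continuous_on: "Ck_on k f U \<Longrightarrow> continuous_on U f"
  using Ck_on_mono[of k f U 0] by simp

lemma Ck_on_subset: "Ck_on k f U \<Longrightarrow> V \<subseteq> U \<Longrightarrow> Ck_on k f V"
  by (induction k arbitrary: f) (auto intro: continuous_on_subset)

text \<open>Regularity is local. This serves for functions given by different formulas on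
  overlapping open sets, typically a cut-off extended by zero.\<close>

lemma Ck_on_Union:
  assumes "\<And>x. x \<in> U \<Longrightarrow> \<exists>V. open V \<and> x \<in> V \<and> Ck_on k f V"
  shows "Ck_on k f U"
  using assms
proof (induction k arbitrary: f)
  case 0
  have "isCont f x" if "x \<in> U" for x
    using 0[OF that] by (auto simp: continuous_on_eq_continuous_at)
  then show ?case
    by (simp add: continuous_at_imp_continuous_on)
next
  case (Suc k)
  then show ?case by (simp; meson)
qed

lemma Ck_on_const [simp]: "Ck_on k (\<lambda>x. c) U"
  by (induction k arbitrary: c) auto

lemma Ck_on_add:
  "Ck_on k f U \<Longrightarrow> Ck_on k g U \<Longrightarrow> open U \<Longrightarrow> Ck_on k (\<lambda>x. f x + g x) U"
proof (induction k arbitrary: f g)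
  case 0
  then show ?case by (auto intro: continuous_intros)
next
  case (Suc k)
  have "frechet_derivative (\<lambda>x. f x + g x) (at x) v
      = frechet_derivative f (at x) v + frechet_derivative g (at x) v" if "x \<in> U" for x v
    using that Suc.prems
    by (subst frechet_derivative_eqI[OF has_derivative_add[OF differentiable_has_frechet_derivative
          differentiable_has_frechet_derivative]]) auto
  then have "Ck_on k (\<lambda>x. frechet_derivative (\<lambda>x. f x + g x) (at x) v) U" for v
    using Suc.prems Suc.IH
    by (subst Ck_on_cong[of U _ "\<lambda>x. frechet_derivative f (at x) v + frechet_derivative g (at x) v"]) auto
  then show ?case
    using Suc.prems by (auto intro: differentiable_add)
qed

lemma Ck_on_sum:
  "finite I \<Longrightarrow> open U \<Longrightarrow> (\<And>i. i \<in> I \<Longrightarrow> Ck_on k (f i) U) \<Longrightarrow> Ck_on k (\<lambda>x. \<Sum>i\<in>I. f i x) U"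
  by (induction I rule: finite_induct) (auto intro: Ck_on_add)

lemma (in bounded_bilinear) frechet_derivative_prod:
  assumes "f differentiable (at x)" "g differentiable (at x)"
  shows "frechet_derivative (\<lambda>x. prod (f x) (g x)) (at x) v
      = prod (f x) (frechet_derivative g (at x) v) + prod (frechet_derivative f (at x) v) (g x)"
  using assms
  by (subst frechet_derivative_eqI[OF FDERIV[OF differentiable_has_frechet_derivative
          differentiable_has_frechet_derivative]]) auto

lemma (in bounded_bilinear) Ck_on_prod:
  "Ck_on k f U \<Longrightarrow> Ck_on k g U \<Longrightarrow> open U \<Longrightarrow> Ck_on k (\<lambda>x. prod (f x) (g x)) U"
proof (induction k arbitrary: f g)
  case 0
  then show ?case by (auto intro: continuous_on)
next
  case (Suc k)
  have f: "Ck_on k f U" and g: "Ck_on k g U"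
    using Suc.prems Ck_on_Suc_imp by blast+
  have "frechet_derivative (\<lambda>x. prod (f x) (g x)) (at x) v
      = prod (f x) (frechet_derivative g (at x) v) + prod (frechet_derivative f (at x) v) (g x)" if "x \<in> U" for x v
    using that Suc.prems by (intro frechet_derivative_prod) auto
  then have "Ck_on k (\<lambda>x. frechet_derivative (\<lambda>x. prod (f x) (g x)) (at x) v) U" for v
    using Suc.prems Suc.IH f g
    by (subst Ck_on_cong[of U _ "\<lambda>x. prod (f x) (frechet_derivative g (at x) v) + prod (frechet_derivative f (at x) v) (g x)"])
       (auto intro: Ck_on_add)
  then show ?case
    using Suc.prems FDERIV unfolding differentiable_def Ck_on.simps by blast
qed

lemmas Ck_on_scaleR = bounded_bilinear.Ck_on_prod[OF bounded_bilinear_scaleR]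
lemmas Ck_on_mult = bounded_bilinear.Ck_on_prod[OF bounded_bilinear_mult]
lemmas Ck_on_inner = bounded_bilinear.Ck_on_prod[OF bounded_bilinear_inner]

lemma frechet_derivative_chain:
  assumes "g differentiable (at x)" "f differentiable (at (g x))"
  shows "frechet_derivative (\<lambda>x. f (g x)) (at x) v
      = frechet_derivative f (at (g x)) (frechet_derivative g (at x) v)"
  using frechet_derivative_compose[OF assms] by (simp add: o_def)

lemma linear_euclidean_expansion:
  fixes L :: "'b::euclidean_space \<Rightarrow> 'c::real_vector"
  assumes "linear L"
  shows "L v = (\<Sum>b\<in>Basis. (v \<bullet> b) *\<^sub>R L b)"
proof -
  have "(\<Sum>b\<in>Basis. (v \<bullet> b) *\<^sub>R L b) = L (\<Sum>b\<in>Basis. (v \<bullet> b) *\<^sub>R b)"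
    by (simp add: linear_sum[OF assms] linear_scale[OF assms])
  then show ?thesis
    by (simp only: euclidean_representation)
qed

text \<open>In the chain rule the direction in which \<open>f\<close> is differentiated varies with
  \<open>x\<close>, whereas \<open>Ck_on\<close> speaks of fixed directions. Expanding it in the
  basis of the intermediate Euclidean space restores fixed directions and lets the induction go
  through.\<close>

lemma Ck_on_compose:
  fixes g :: "'a::real_normed_vector \<Rightarrow> 'b::euclidean_space"
  assumes "Ck_on k f V" "Ck_on k g U" "open U" "g ` U \<subseteq> V"
  shows "Ck_on k (\<lambda>x. f (g x)) U"
  using assms(1,2)
proof (induction k arbitrary: f)
  case 0
  then show ?case
    using assms(4) continuous_on_compose2[of V f U g] by auto
next
  case (Suc k)
  have g: "Ck_on k g U"
    using Suc.prems Ck_on_Suc_imp by blast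
  have df: "f differentiable (at (g x))" if "x \<in> U" for x
    using that Suc.prems assms by auto
  have dg: "g differentiable (at x)" if "x \<in> U" for x
    using that Suc.prems assms by auto
  have "frechet_derivative (\<lambda>x. f (g x)) (at x) v
      = (\<Sum>b\<in>Basis. (frechet_derivative g (at x) v \<bullet> b) *\<^sub>R frechet_derivative f (at (g x)) b)" if "x \<in> U" for x v
    by (rule trans[OF frechet_derivative_chain[OF dg[OF that] df[OF that]]
      linear_euclidean_expansion[OF linear_frechet_derivative[OF df[OF that]]]])
  moreover have "Ck_on k (\<lambda>x. \<Sum>b\<in>Basis. (frechet_derivative g (at x) v \<bullet> b) *\<^sub>R frechet_derivative f (at (g x)) b) U" for v
    using Suc.prems assms g
    by (intro Ck_on_sum Ck_on_scaleR Ck_on_inner Suc.IH) auto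
  ultimately have "Ck_on k (\<lambda>x. frechet_derivative (\<lambda>x. f (g x)) (at x) v) U" for v
    using assms(3) by (subst Ck_on_cong) auto
  moreover have "(\<lambda>x. f (g x)) differentiable (at x)" if "x \<in> U" for x
    using differentiable_chain_at[OF dg[OF that] df[OF that]] by (simp add: o_def)
  ultimately show ?case by simp
qed

text \<open>Powers are closed under differentiation up to a constant factor, so one induction over
  all exponents provides square roots, inverses and inverse square roots of positive
  functions.\<close>

lemma Ck_on_powr: "Ck_on k (\<lambda>t::real. t powr a) {0<..}"
proof (induction k arbitrary: a)
  case 0
  then show ?case by (auto intro!: continuous_intros)
next
  case (Suc k)
  have d: "((\<lambda>t. t powr a) has_derivative (\<lambda>v. a * t powr (a - 1) * v)) (at t)" if "0 < t" for t :: real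
    using has_real_derivative_powr[OF that, of a] by (simp add: has_field_derivative_def)
  have "Ck_on k (\<lambda>t. frechet_derivative (\<lambda>t. t powr a) (at t) v) {0<..}" for v :: real
  proof -
    have "frechet_derivative (\<lambda>t. t powr a) (at t) v = a * t powr (a - 1) * v" if "t \<in> {0<..}" for t :: real
      using frechet_derivative_eqI[OF d] that by simp
    moreover have "Ck_on k (\<lambda>t. a * t powr (a - 1) * v) {0<..}"
      by (intro Ck_on_mult Suc.IH Ck_on_const) auto
    ultimately show ?thesis
      by (subst Ck_on_cong) auto
  qed
  then show ?case
    using d by (auto simp: differentiable_def)
qed

section \<open>Symmetry of second derivatives\<close>

lemma mixed_difference_mean_value:
  fixes f :: "'a::real_normed_vector \<Rightarrow> real"
  assumes f: "Ck_on 2 f U" and h: "h > 0"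
    and U: "\<And>s t. 0 \<le> s \<Longrightarrow> s \<le> h \<Longrightarrow> 0 \<le> t \<Longrightarrow> t \<le> h \<Longrightarrow> u + s *\<^sub>R v + t *\<^sub>R w \<in> U"
  obtains s t where "0 \<le> s" "s \<le> h" "0 \<le> t" "t \<le> h"
    "f (u + h *\<^sub>R v + h *\<^sub>R w) - f (u + h *\<^sub>R v) - f (u + h *\<^sub>R w) + f u =
     h * h * frechet_derivative (\<lambda>x. frechet_derivative f (at x) v) (at (u + s *\<^sub>R v + t *\<^sub>R w)) w"
proof -
  let ?D = "\<lambda>x. frechet_derivative f (at x) v"
  have df: "f differentiable (at x)" "?D differentiable (at x)" if "x \<in> U" for x
    using f that by (auto simp: numeral_2_eq_2)
  have d1: "((\<lambda>s. f (u + s *\<^sub>R v + c *\<^sub>R w)) has_real_derivative ?D (u + s *\<^sub>R v + c *\<^sub>R w)) (at s)"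
    if "0 \<le> s" "s \<le> h" "0 \<le> c" "c \<le> h" for s c
  proof -
    have "((\<lambda>s. f (u + s *\<^sub>R v + c *\<^sub>R w)) has_derivative
        (\<lambda>d. frechet_derivative f (at (u + s *\<^sub>R v + c *\<^sub>R w)) (d *\<^sub>R v))) (at s)"
      by (rule has_derivative_compose[where g = f and f = "\<lambda>s. u + s *\<^sub>R v + c *\<^sub>R w"])
         (auto intro!: derivative_eq_intros differentiable_has_frechet_derivative df U that)
    then show ?thesis
      using linear_scale[OF linear_frechet_derivative[OF df(1)[OF U[OF that]]]]
      by (simp add: has_field_derivative_def mult.commute[of _ "?D _"])
  qed
  have d2: "((\<lambda>t. ?D (u + s *\<^sub>R v + t *\<^sub>R w)) has_real_derivative
       frechet_derivative ?D (at (u + s *\<^sub>R v + t *\<^sub>R w)) w) (at t)"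
    if "0 \<le> s" "s \<le> h" "0 \<le> t" "t \<le> h" for s t
  proof -
    have "((\<lambda>t. ?D (u + s *\<^sub>R v + t *\<^sub>R w)) has_derivative
        (\<lambda>d. frechet_derivative ?D (at (u + s *\<^sub>R v + t *\<^sub>R w)) (d *\<^sub>R w))) (at t)"
      by (rule has_derivative_compose[where g = ?D and f = "\<lambda>t. u + s *\<^sub>R v + t *\<^sub>R w"])
         (auto intro!: derivative_eq_intros differentiable_has_frechet_derivative df U that)
    then show ?thesis
      using linear_scale[OF linear_frechet_derivative[OF df(2)[OF U[OF that]]]]
      by (simp add: has_field_derivative_def mult.commute[of _ "frechet_derivative ?D _ _"])
  qed
  \<comment> \<open>The summand \<open>0 *\<^sub>R w\<close> is kept so that both terms are
    instances of \<open>d1\<close>.\<close>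
  let ?g = "\<lambda>s. f (u + s *\<^sub>R v + h *\<^sub>R w) - f (u + s *\<^sub>R v + 0 *\<^sub>R w)"
  obtain s where s: "0 < s" "s < h"
    "?g h - ?g 0 = (h - 0) * (?D (u + s *\<^sub>R v + h *\<^sub>R w) - ?D (u + s *\<^sub>R v + 0 *\<^sub>R w))"
    using MVT2[OF h, of ?g "\<lambda>s. ?D (u + s *\<^sub>R v + h *\<^sub>R w) - ?D (u + s *\<^sub>R v + 0 *\<^sub>R w)"]
      DERIV_diff[OF d1[of _ h] d1[of _ 0]] h by auto
  obtain t where t: "0 < t" "t < h"
    "?D (u + s *\<^sub>R v + h *\<^sub>R w) - ?D (u + s *\<^sub>R v + 0 *\<^sub>R w) =
      (h - 0) * frechet_derivative ?D (at (u + s *\<^sub>R v + t *\<^sub>R w)) w"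
    using MVT2[OF h, of "\<lambda>t. ?D (u + s *\<^sub>R v + t *\<^sub>R w)"
        "\<lambda>t. frechet_derivative ?D (at (u + s *\<^sub>R v + t *\<^sub>R w)) w"] d2 s by auto
  show ?thesis
    using s t by (intro that[of s t]) (auto simp: algebra_simps)
qed

text \<open>The mixed second difference is symmetric in \<open>v\<close> and \<open>w\<close>. By
  the mean value theorem it is the squared step size times either mixed derivative, each at some
  point of a shrinking parallelogram, and continuity of both at \<open>u\<close> makes them agree in
  the limit.\<close>

lemma second_derivative_symmetric_real:
  fixes f :: "'a::real_normed_vector \<Rightarrow> real"
  assumes f: "Ck_on 2 f U" and U: "open U" "u \<in> U"
  shows "frechet_derivative (\<lambda>x. frechet_derivative f (at x) v) (at u) w =
         frechet_derivative (\<lambda>x. frechet_derivative f (at x) w) (at u) v"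
proof -
  let ?D = "\<lambda>v w x. frechet_derivative (\<lambda>x. frechet_derivative f (at x) v) (at x) w"
  have cont: "continuous_on U (?D v w)" for v w
    using f by (auto simp: numeral_2_eq_2)
  obtain r where r: "r > 0" "ball u r \<subseteq> U"
    using U open_contains_ball by blast
  \<comment> \<open>The step keeps the whole parallelogram within distance
    \<open>r / (real n + 2)\<close> of \<open>u\<close>. The summand 1 in the denominator covers
    \<open>v = w = 0\<close>, and the 2 makes the distance smaller than \<open>r\<close> already for
    \<open>n = 0\<close>.\<close>
  define h where "h n = r / (norm v + norm w + 1) / (real n + 2)" for n
  have h0: "h n > 0" for n
    using r by (simp add: h_def add_nonneg_pos)
  have near: "norm (s *\<^sub>R v + t *\<^sub>R w) \<le> r / (real n + 2)"
    if "0 \<le> s" "s \<le> h n" "0 \<le> t" "t \<le> h n" for s t n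
  proof -
    have "norm (s *\<^sub>R v + t *\<^sub>R w) \<le> s * norm v + t * norm w"
      using norm_triangle_ineq[of "s *\<^sub>R v" "t *\<^sub>R w"] that by simp
    also have "\<dots> \<le> h n * norm v + h n * norm w"
      using that by (intro add_mono mult_right_mono) auto
    also have "\<dots> \<le> h n * (norm v + norm w + 1)"
      using h0[of n] by (simp add: algebra_simps)
    also have "\<dots> = r / (real n + 2)"
    proof -
      have "norm v + norm w + 1 > 0"
        by (simp add: add_nonneg_pos)
      then show ?thesis
        unfolding h_def by simp
    qed
    finally show ?thesis .
  qed
  have inU: "u + s *\<^sub>R v + t *\<^sub>R w \<in> U" 
    if "0 \<le> s" "s \<le> h n" "0 \<le> t" "t \<le> h n" for s t n
  proof -
    have "r / (real n + 2) < r"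
      using r by (simp add: field_simps add_pos_nonneg)
    then have "norm (s *\<^sub>R v + t *\<^sub>R w) < r"
      using near[OF that] by simp
    then show ?thesis
      using r(2) by (auto simp: dist_norm subset_iff add.assoc norm_minus_commute[of u])
  qed
  have "\<exists>p q. norm (p - u) \<le> r / (real n + 2) \<and> norm (q - u) \<le> r / (real n + 2) \<and> ?D v w p = ?D w v q" for n
  proof -
    obtain s t where 1: "0 \<le> s" "s \<le> h n" "0 \<le> t" "t \<le> h n"
      "f (u + h n *\<^sub>R v + h n *\<^sub>R w) - f (u + h n *\<^sub>R v) - f (u + h n *\<^sub>R w) + f u =
       h n * h n * ?D v w (u + s *\<^sub>R v + t *\<^sub>R w)"
      using mixed_difference_mean_value[OF f h0[of n], of u v w] inU by metis
    have "u + t *\<^sub>R w + s *\<^sub>R v \<in> U" if "0 \<le> s" "s \<le> h n" "0 \<le> t" "t \<le> h n" for s t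
      using inU[OF that] by (simp add: algebra_simps)
    then obtain s' t' where 2: "0 \<le> s'" "s' \<le> h n" "0 \<le> t'" "t' \<le> h n"
      "f (u + h n *\<^sub>R w + h n *\<^sub>R v) - f (u + h n *\<^sub>R w) - f (u + h n *\<^sub>R v) + f u =
       h n * h n * ?D w v (u + s' *\<^sub>R w + t' *\<^sub>R v)"
      using mixed_difference_mean_value[OF f h0[of n], of u w v] by metis
    have "f (u + h n *\<^sub>R w + h n *\<^sub>R v) = f (u + h n *\<^sub>R v + h n *\<^sub>R w)"
      by (simp add: algebra_simps)
    then have "h n * h n * ?D w v (u + s' *\<^sub>R w + t' *\<^sub>R v) = h n * h n * ?D v w (u + s *\<^sub>R v + t *\<^sub>R w)"
      using 1(5) 2(5) by linarith
    then have "?D w v (u + s' *\<^sub>R w + t' *\<^sub>R v) = ?D v w (u + s *\<^sub>R v + t *\<^sub>R w)"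
      using h0[of n] by simp
    then show ?thesis
      using near[OF 1(1-4)] near[OF 2(3,4,1,2)]
      by (intro exI[of _ "u + s *\<^sub>R v + t *\<^sub>R w"] exI[of _ "u + s' *\<^sub>R w + t' *\<^sub>R v"])
         (auto simp: algebra_simps)
  qed
  then obtain p q where pq: "\<And>n. norm (p n - u) \<le> r / (real n + 2)"
      "\<And>n. norm (q n - u) \<le> r / (real n + 2)" "\<And>n. ?D v w (p n) = ?D w v (q n)"
    by metis
  have lim: "(\<lambda>n. r / (real n + 2)) \<longlonglongrightarrow> 0"
    by real_asymp
  have "p \<longlonglongrightarrow> u" "q \<longlonglongrightarrow> u"
    using pq(1,2) by (auto intro!: LIM_zero_cancel[of _ u] Lim_null_comparison[OF _ lim])
  moreover have "isCont (?D v w) u" "isCont (?D w v) u"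
    using cont U by (auto simp: continuous_on_eq_continuous_at)
  ultimately have "(\<lambda>n. ?D v w (p n)) \<longlonglongrightarrow> ?D v w u" "(\<lambda>n. ?D w v (q n)) \<longlonglongrightarrow> ?D w v u"
    by (auto intro: isCont_tendsto_compose)
  then show ?thesis
    using pq(3) LIMSEQ_unique by simp
qed

lemma inner_frechet_derivative:
  assumes "f differentiable (at x)"
  shows "frechet_derivative (\<lambda>y. f y \<bullet> b) (at x) v = frechet_derivative f (at x) v \<bullet> b"
  using bounded_bilinear.frechet_derivative_prod[OF bounded_bilinear_inner assms, of "\<lambda>_. b" v]
  by simp

lemma second_derivative_symmetric:
  fixes f :: "'a::real_normed_vector \<Rightarrow> 'b::real_inner"
  assumes f: "Ck_on 2 f U" and U: "open U" "u \<in> U"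
  shows "frechet_derivative (\<lambda>x. frechet_derivative f (at x) v) (at u) w =
         frechet_derivative (\<lambda>x. frechet_derivative f (at x) w) (at u) v"
proof -
  have d: "f differentiable (at x)" "(\<lambda>x. frechet_derivative f (at x) v) differentiable (at x)" if "x \<in> U" for x v
    using f that by (auto simp: numeral_2_eq_2)
  have "frechet_derivative (\<lambda>x. frechet_derivative (\<lambda>y. f y \<bullet> b) (at x) v) (at u) w
      = frechet_derivative (\<lambda>x. frechet_derivative f (at x) v) (at u) w \<bullet> b" for v w b
  proof -
    have "frechet_derivative (\<lambda>x. frechet_derivative (\<lambda>y. f y \<bullet> b) (at x) v) (at u)
        = frechet_derivative (\<lambda>x. frechet_derivative f (at x) v \<bullet> b) (at u)"
      by (rule frechet_derivative_cong_open[OF U]) (simp add: inner_frechet_derivative d)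
    then show ?thesis
      by (simp add: inner_frechet_derivative[OF d(2)[OF U(2)]])
  qed
  moreover have "Ck_on 2 (\<lambda>y. f y \<bullet> b) U" for b
    using f U by (intro Ck_on_inner Ck_on_const)
  ultimately have "frechet_derivative (\<lambda>x. frechet_derivative f (at x) v) (at u) w \<bullet> b =
         frechet_derivative (\<lambda>x. frechet_derivative f (at x) w) (at u) v \<bullet> b" for b
    using second_derivative_symmetric_real[OF _ U] by metis
  then show ?thesis
    by (metis inner_commute vector_eq_rdot)
qed

section \<open>Change of variables\<close>

text \<open>The change of variables theorem of the library is restricted to well-ordered index types. It is
  transferred to arbitrary finite ones through a well-ordered copy.\<close>

typedef (overloaded) ('n::finite) ordered_copy = "UNIV :: 'n set"
  morphisms of_copy to_copy by simp

lemma of_to_copy [simp]: "of_copy (to_copy i) = i"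
  by (simp add: to_copy_inverse)

lemma inj_of_copy: "inj of_copy"
  by (simp add: inj_on_def of_copy_inject)

instance ordered_copy :: (finite) finite
proof
  show "finite (UNIV :: 'a ordered_copy set)"
    using finite_imageD[OF _ inj_of_copy] finite_subset[OF subset_UNIV] by auto
qed

definition index_rank :: "'n::finite \<Rightarrow> nat"
  where "index_rank = (SOME f. inj f)"

lemma inj_index_rank: "inj (index_rank :: 'n::finite \<Rightarrow> nat)"
proof -
  obtain f :: "'n \<Rightarrow> nat" and m where "inj_on f UNIV"
    using finite_imp_inj_to_nat_seg[OF finite[of "UNIV :: 'n set"]] by blast
  then show ?thesis
    unfolding index_rank_def by (rule someI[of inj])
qed

instantiation ordered_copy :: (finite) wellorder
begin

definition less_eq_ordered_copy :: "'a ordered_copy \<Rightarrow> 'a ordered_copy \<Rightarrow> bool"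
  where "i \<le> j \<longleftrightarrow> index_rank (of_copy i) \<le> index_rank (of_copy j)"

definition less_ordered_copy :: "'a ordered_copy \<Rightarrow> 'a ordered_copy \<Rightarrow> bool"
  where "i < j \<longleftrightarrow> index_rank (of_copy i) < index_rank (of_copy j)"

instance
proof
  fix P :: "'a ordered_copy \<Rightarrow> bool" and i
  assume "\<And>i. (\<And>j. j < i \<Longrightarrow> P j) \<Longrightarrow> P i"
  then show "P i"
    by (rule measure_induct[of "\<lambda>i. index_rank (of_copy i)"]) (simp add: less_ordered_copy_def)
qed (auto simp: less_eq_ordered_copy_def less_ordered_copy_def of_copy_inject
      dest!: injD[OF inj_index_rank] order_antisym)

end

lemma bij_axis_Basis: "bij_betw (\<lambda>i. axis i (1::real)) (UNIV :: 'n::finite set) Basis"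
  by (auto simp: bij_betw_def inj_on_def axis_eq_axis Basis_vec_def)

definition copy_vec :: "real^'n::finite \<Rightarrow> real^'n ordered_copy"
  where "copy_vec y = (\<chi> i. y $ of_copy i)"

definition uncopy_vec :: "real^'n::finite ordered_copy \<Rightarrow> real^'n"
  where "uncopy_vec x = (\<chi> i. x $ to_copy i)"

lemma uncopy_copy [simp]: "uncopy_vec (copy_vec y) = y"
  by (simp add: copy_vec_def uncopy_vec_def)

lemma copy_uncopy [simp]: "copy_vec (uncopy_vec x) = x"
  by (simp add: copy_vec_def uncopy_vec_def of_copy_inverse vec_eq_iff)

lemma bounded_linear_copy_vec: "bounded_linear (copy_vec :: real^'n::finite \<Rightarrow> _)"
  by (intro linear_conv_bounded_linear[THEN iffD1] linearI) (auto simp: copy_vec_def vec_eq_iff)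

lemma bounded_linear_uncopy_vec: "bounded_linear (uncopy_vec :: _ \<Rightarrow> real^'n::finite)"
  by (intro linear_conv_bounded_linear[THEN iffD1] linearI) (auto simp: uncopy_vec_def vec_eq_iff)

lemma measurable_uncopy_vec [measurable]: "(uncopy_vec :: _ \<Rightarrow> real^'n::finite) \<in> borel_measurable borel"
  by (intro borel_measurable_continuous_onI bounded_linear.continuous_on[OF bounded_linear_uncopy_vec] continuous_on_id)

lemma bij_of_copy: "bij of_copy"
  by (metis bij_def inj_of_copy of_to_copy surj_def)

text \<open>Lebesgue measure is determined by its values on boxes, and relabelling the coordinates
  maps boxes to boxes with the same side lengths.\<close>

lemma distr_uncopy_vec: "distr lborel borel (uncopy_vec :: _ \<Rightarrow> real^'n::finite) = lborel"
proof (rule lborel_eqI[symmetric])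
  fix l u :: "real^'n"
  assume "\<And>b. b \<in> Basis \<Longrightarrow> l \<bullet> b \<le> u \<bullet> b"
  then have le: "l $ i \<le> u $ i" for i
    by (metis axis_in_Basis_iff cart_eq_inner_axis insertI1 Basis_real_def)
  have "x \<in> uncopy_vec -` box l u \<longleftrightarrow> x \<in> box (copy_vec l) (copy_vec u)" for x
  proof -
    have "(\<forall>i. l $ i < x $ to_copy i \<and> x $ to_copy i < u $ i) \<longleftrightarrow>
          (\<forall>j. l $ of_copy j < x $ j \<and> x $ j < u $ of_copy j)"
      by (metis of_copy_inverse of_to_copy)
    then show ?thesis
      by (simp add: mem_box_cart copy_vec_def uncopy_vec_def)
  qed
  then have "uncopy_vec -` box l u = box (copy_vec l) (copy_vec u)"
    by blast
  then have "emeasure (distr lborel borel uncopy_vec) (box l u) = emeasure lborel (box (copy_vec l) (copy_vec u))"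
    by (simp add: emeasure_distr)
  also have "\<dots> = (\<Prod>b\<in>Basis. (copy_vec u - copy_vec l) \<bullet> b)"
    using le by (intro emeasure_lborel_box)
      (auto simp: Basis_vec_def copy_vec_def cart_eq_inner_axis[symmetric])
  also have "\<dots> = (\<Prod>j\<in>UNIV. u $ of_copy j - l $ of_copy j)"
    by (subst prod.reindex_bij_betw[OF bij_axis_Basis, symmetric])
       (simp add: cart_eq_inner_axis[symmetric] copy_vec_def)
  also have "\<dots> = (\<Prod>i\<in>UNIV. u $ i - l $ i)"
    using prod.reindex_bij_betw[OF bij_of_copy, of "\<lambda>i. u $ i - l $ i"] by (simp add: bij_of_copy)
  also have "\<dots> = (\<Prod>b\<in>Basis. (u - l) \<bullet> b)"
    by (subst prod.reindex_bij_betw[OF bij_axis_Basis, symmetric])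
       (simp add: cart_eq_inner_axis[symmetric])
  finally show "emeasure (distr lborel borel uncopy_vec) (box l u) = (\<Prod>b\<in>Basis. (u - l) \<bullet> b)" .
qed simp

lemma nn_integral_uncopy_vec:
  fixes h :: "real^'n::finite \<Rightarrow> ennreal"
  assumes "h \<in> borel_measurable borel"
  shows "(\<integral>\<^sup>+x. h x \<partial>lborel) = (\<integral>\<^sup>+x. h (uncopy_vec x) \<partial>lborel)"
  by (subst distr_uncopy_vec[symmetric]) (use assms in \<open>auto simp: nn_integral_distr\<close>)

lemma map_permutation_to_copy:
  assumes "p permutes (UNIV :: 'n::finite set)"
  shows "map_permutation UNIV to_copy p = (\<lambda>j. to_copy (p (of_copy j)))"
proof
  fix j :: "'n ordered_copy"
  have "inj (to_copy :: 'n \<Rightarrow> _)"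
    by (metis inj_on_inverseI of_to_copy)
  then have "map_permutation UNIV to_copy p (to_copy (of_copy j)) = to_copy (p (of_copy j))"
    by (intro map_permutation_apply) auto
  then show "map_permutation UNIV to_copy p j = to_copy (p (of_copy j))"
    by (simp add: of_copy_inverse)
qed

text \<open>Conjugation with \<open>to_copy\<close> is a sign-preserving bijection between the two
  permutation groups, so the Leibniz sums agree term by term.\<close>

lemma det_copy:
  fixes M :: "real^'n::finite^'n"
  shows "det (\<chi> i j. M $ of_copy i $ of_copy j) = det M"
proof -
  have inj: "inj (to_copy :: 'n \<Rightarrow> _)"
    by (metis inj_on_inverseI of_to_copy)
  have bij: "bij (to_copy :: 'n \<Rightarrow> _)"
    by (metis bij_betw_def inj of_copy_inverse surj_def)
  let ?c = "map_permutation UNIV (to_copy :: 'n \<Rightarrow> _)"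
  let ?d = "\<lambda>q i. of_copy (q (to_copy i :: 'n ordered_copy)) :: 'n"
  have perm: "p permutes UNIV \<longleftrightarrow> bij p" for p :: "'a \<Rightarrow> 'a"
    by (simp add: bij_iff permutes_univ)
  have "bij_betw ?c {p. p permutes UNIV} {q. q permutes UNIV}"
  proof (rule bij_betw_byWitness[where f' = ?d])
    show "\<forall>p\<in>{p. p permutes UNIV}. ?d (?c p) = p"
      by (auto simp: map_permutation_to_copy)
    show "\<forall>q\<in>{q. q permutes UNIV}. ?c (?d q) = q"
    proof safe
      fix q :: "'n ordered_copy \<Rightarrow> 'n ordered_copy"
      assume "q permutes UNIV"
      then have "bij (of_copy \<circ> q \<circ> to_copy)"
        using bij bij_of_copy perm by (metis bij_comp)
      then have "?d q permutes UNIV"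
        by (simp add: perm o_def)
      then show "?c (?d q) = q"
        by (auto simp: map_permutation_to_copy of_copy_inverse)
    qed
    show "?c ` {p. p permutes UNIV} \<subseteq> {q. q permutes UNIV}"
    proof safe
      fix p :: "'n \<Rightarrow> 'n" assume p: "p permutes UNIV"
      then have "bij (to_copy \<circ> p \<circ> of_copy)"
        using bij bij_of_copy perm by (metis bij_comp)
      then show "?c p permutes UNIV"
        using map_permutation_to_copy[OF p] by (simp add: perm o_def)
    qed
    show "?d ` {q. q permutes UNIV} \<subseteq> {p. p permutes UNIV}"
    proof safe
      fix q :: "'n ordered_copy \<Rightarrow> 'n ordered_copy"
      assume "q permutes UNIV"
      then have "bij (of_copy \<circ> q \<circ> to_copy)"
        using bij bij_of_copy perm by (metis bij_comp)
      then show "?d q permutes UNIV"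
        by (simp add: perm o_def)
    qed
  qed
  then have "det (\<chi> i j. M $ of_copy i $ of_copy j) =
      (\<Sum>p | p permutes UNIV. of_int (sign (?c p)) * (\<Prod>i\<in>UNIV. M $ of_copy i $ of_copy (?c p i)))"
    unfolding det_def by (subst sum.reindex_bij_betw[symmetric]) auto
  also have "\<dots> = (\<Sum>p | p permutes UNIV. of_int (sign p) * (\<Prod>i\<in>UNIV. M $ i $ p i))"
  proof (rule sum.cong[OF refl])
    fix p :: "'n \<Rightarrow> 'n" assume "p \<in> {p. p permutes UNIV}"
    then have p: "p permutes UNIV" by simp
    have "(\<Prod>i\<in>UNIV. M $ of_copy i $ of_copy (?c p i)) = (\<Prod>i\<in>UNIV. M $ of_copy i $ p (of_copy i))"
      by (simp add: map_permutation_to_copy[OF p])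
    also have "\<dots> = (\<Prod>i\<in>UNIV. M $ i $ p i)"
      using prod.reindex_bij_betw[OF bij_of_copy, of "\<lambda>i. M $ i $ p i"] by simp
    finally show "of_int (sign (?c p)) * (\<Prod>i\<in>UNIV. M $ of_copy i $ of_copy (?c p i)) =
       of_int (sign p) * (\<Prod>i\<in>UNIV. M $ i $ p i)"
      using sign_map_permutation[OF inj p] by simp
  qed
  finally show ?thesis
    by (simp add: det_def)
qed

text \<open>A bridge from \<open>integral\<close>, in which the change of variables theorem is
  stated, to the nonnegative integral over \<open>lborel\<close>, in which volumes are measured.
  Borel measurability of the integrand makes the passage between \<open>lborel\<close> and its
  completion harmless.\<close>

lemma set_nn_integral_eq_integral:
  fixes h :: "'a::euclidean_space \<Rightarrow> real"
  assumes "h absolutely_integrable_on S" and "\<And>x. x \<in> S \<Longrightarrow> 0 \<le> h x" and "integral S h = b"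
    and "(\<lambda>x. indicator S x * ennreal (h x)) \<in> borel_measurable borel"
  shows "(\<integral>\<^sup>+x. indicator S x * ennreal (h x) \<partial>lborel) = ennreal b"
proof -
  have int: "integrable lebesgue (\<lambda>x. indicator S x *\<^sub>R h x)"
    using assms(1) by (simp add: set_integrable_def)
  have "(\<integral>\<^sup>+x. indicator S x * ennreal (h x) \<partial>lborel) = (\<integral>\<^sup>+x. indicator S x * ennreal (h x) \<partial>lebesgue)"
    using assms(4) by (subst nn_integral_completion) auto
  also have "\<dots> = (\<integral>\<^sup>+x. ennreal (indicator S x *\<^sub>R h x) \<partial>lebesgue)"
    by (intro nn_integral_cong) (auto simp: indicator_def)
  also have "\<dots> = ennreal (\<integral>x. indicator S x *\<^sub>R h x \<partial>lebesgue)"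
    using assms(2) by (intro nn_integral_eq_integral[OF int]) (auto simp: indicator_def)
  also have "(\<integral>x. indicator S x *\<^sub>R h x \<partial>lebesgue) = integral S h"
    using set_lebesgue_integral_eq_integral(2)[OF assms(1)] by (simp add: set_lebesgue_integral_def)
  finally show ?thesis
    using assms(3) by simp
qed

text \<open>The change of variables theorem is applied to vector-valued integrands, so a real
  integrand is passed to it as an element of \<open>real^1\<close>.\<close>

lemma absolutely_integrable_on_vec1:
  fixes h :: "'a::euclidean_space \<Rightarrow> real"
  shows "(\<lambda>x. vec (h x) :: real^1) absolutely_integrable_on S \<longleftrightarrow> h absolutely_integrable_on S"
  by (subst absolutely_integrable_componentwise_iff)
     (auto simp: Basis_vec_def cart_eq_inner_axis[symmetric])

lemma integral_vec1:
  fixes h :: "'a::euclidean_space \<Rightarrow> real"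
  assumes "h integrable_on S"
  shows "integral S (\<lambda>x. vec (h x) :: real^1) = vec (integral S h)"
proof -
  have "bounded_linear (vec :: real \<Rightarrow> real^1)"
    by (intro linear_conv_bounded_linear[THEN iffD1] linearI) (auto simp: vec_eq_iff)
  then show ?thesis
    using integral_linear[OF assms, of "vec :: real \<Rightarrow> real^1"] by (simp add: o_def)
qed

text \<open>The bounds make \<open>f\<close> absolutely integrable on the image, so that the theorem
  on absolute integrals applies. They are removed by exhaustion in
  \<open>nn_integral_change_of_variables_wellorder\<close>.\<close>

lemma nn_integral_change_of_variables_bounded:
  fixes g :: "real^'m::{finite,wellorder} \<Rightarrow> real^'m::_"
  assumes P: "P \<in> sets borel" and der: "\<And>x. x \<in> P \<Longrightarrow> (g has_derivative g' x) (at x)"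
    and inj: "inj_on g P" and gP: "g ` P \<in> sets borel" "bounded (g ` P)"
    and f: "f \<in> borel_measurable borel" "\<And>y. 0 \<le> f y" "\<And>y. y \<in> g ` P \<Longrightarrow> f y \<le> B"
    and D: "(\<lambda>x. indicator P x * ennreal (\<bar>det (matrix (g' x))\<bar> * f (g x))) \<in> borel_measurable borel"
  shows "(\<integral>\<^sup>+x. indicator P x * ennreal (\<bar>det (matrix (g' x))\<bar> * f (g x)) \<partial>lborel) =
         (\<integral>\<^sup>+y. indicator (g ` P) y * ennreal (f y) \<partial>lborel)"
proof -
  have fin: "emeasure lborel (g ` P) < \<infinity>"
    using gP emeasure_bounded_finite by blast
  have "set_integrable lborel (g ` P) f"
    unfolding set_integrable_def
  proof (rule Bochner_Integration.integrable_bound)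
    show "integrable lborel (\<lambda>y. indicator (g ` P) y *\<^sub>R B)"
      using gP fin by (intro integrable_scaleR_left) (auto intro!: integrable_real_indicator)
    show "AE y in lborel. norm (indicator (g ` P) y *\<^sub>R f y) \<le> norm (indicator (g ` P) y *\<^sub>R B)"
      using f(2,3) by (intro AE_I2) (auto simp: indicator_def intro!: order_trans[OF f(3) abs_ge_self])
    show "(\<lambda>x. indicator (g ` P) x *\<^sub>R f x) \<in> borel_measurable lborel"
      using gP f by measurable
  qed
  then have abs: "f absolutely_integrable_on (g ` P)"
    unfolding set_integrable_def by (rule integrable_completion[THEN iffD2, rotated]) (use gP f in measurable)
  let ?h = "\<lambda>x. \<bar>det (matrix (g' x))\<bar> * f (g x)"
  have "(\<lambda>x. \<bar>det (matrix (g' x))\<bar> *\<^sub>R (vec (f (g x)) :: real^1)) absolutely_integrable_on P \<and>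
        integral P (\<lambda>x. \<bar>det (matrix (g' x))\<bar> *\<^sub>R (vec (f (g x)) :: real^1)) = vec (integral (g ` P) f)"
    using abs set_lebesgue_integral_eq_integral(1)[OF abs] der inj P
    by (intro has_absolute_integral_change_of_variables[THEN iffD2])
       (auto simp: absolutely_integrable_on_vec1 integral_vec1 intro: has_derivative_at_withinI)
  moreover have "(\<lambda>x. \<bar>det (matrix (g' x))\<bar> *\<^sub>R (vec (f (g x)) :: real^1)) = (\<lambda>x. vec (?h x))"
    by (auto simp: vec_eq_iff)
  ultimately have h: "?h absolutely_integrable_on P" and
    "integral P (\<lambda>x. vec (?h x) :: real^1) = vec (integral (g ` P) f)"
    by (auto simp: absolutely_integrable_on_vec1)
  then have "integral P ?h = integral (g ` P) f"
    using integral_vec1[OF set_lebesgue_integral_eq_integral(1)[OF h]] by (simp add: vec_eq_iff)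
  then show ?thesis
    using set_nn_integral_eq_integral[OF h _ _ D] set_nn_integral_eq_integral[OF abs _ refl] f gP by auto
qed

lemma nn_integral_change_of_variables_wellorder:
  fixes g :: "real^'m::{finite,wellorder} \<Rightarrow> real^'m::_"
  assumes P: "P \<in> sets borel" and der: "\<And>x. x \<in> P \<Longrightarrow> (g has_derivative g' x) (at x)"
    and inj: "inj_on g P" and gP: "g ` P \<in> sets borel"
    and f: "f \<in> borel_measurable borel" "\<And>y. 0 \<le> f y"
    and D: "(\<lambda>x. indicator P x * ennreal (\<bar>det (matrix (g' x))\<bar> * f (g x))) \<in> borel_measurable borel"
  shows "(\<integral>\<^sup>+x. indicator P x * ennreal (\<bar>det (matrix (g' x))\<bar> * f (g x)) \<partial>lborel) =
         (\<integral>\<^sup>+y. indicator (g ` P) y * ennreal (f y) \<partial>lborel)"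
proof -
  \<comment> \<open>The exhaustion takes place in the target, where both the points and the values
    of \<open>f\<close> have to be bounded; \<open>R m\<close> is the corresponding part of the
    source.\<close>
  define Q where "Q m = g ` P \<inter> {y. norm y \<le> real m \<and> f y \<le> real m}" for m
  define R where "R m = P \<inter> g -` Q m" for m
  have Q: "Q m \<in> sets borel" for m
    unfolding Q_def using gP f by measurable
  have "continuous_on P g"
    using der by (meson continuous_at_imp_continuous_on has_derivative_continuous)
  then have "g \<in> borel_measurable (restrict_space borel P)"
    by (rule borel_measurable_continuous_on_restrict)
  from measurable_sets[OF this Q] have R: "R m \<in> sets borel" for m
    unfolding R_def using P by (simp add: sets_restrict_space_iff Int_commute space_restrict_space)
  have gR: "g ` R m = Q m" for m
    by (auto simp: R_def Q_def)
  have "incseq Q" "incseq R"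
    by (auto simp: incseq_def Q_def R_def)
  have UQ: "(\<Union>m. Q m) = g ` P"
  proof -
    have "\<exists>m. norm y \<le> real m \<and> f y \<le> real m" for y
      using real_arch_simple[of "max (norm y) (f y)"] by auto
    then show ?thesis
      unfolding Q_def by fast
  qed
  have UR: "(\<Union>m. R m) = P"
  proof -
    have "\<exists>m. g x \<in> Q m" if "x \<in> P" for x
      using that UQ by blast
    then show ?thesis
      unfolding R_def by auto
  qed
  let ?h = "\<lambda>x. ennreal (\<bar>det (matrix (g' x))\<bar> * f (g x))"
  have eq: "(\<integral>\<^sup>+x. indicator (R m) x * ?h x \<partial>lborel) = (\<integral>\<^sup>+y. indicator (Q m) y * ennreal (f y) \<partial>lborel)" for m
  proof -
    have "(\<lambda>x. indicator (R m) x * (indicator P x * ?h x)) \<in> borel_measurable borel"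
      using R D by measurable
    moreover have "indicator (R m) x * (indicator P x * ?h x) = indicator (R m) x * ?h x" for x
      by (auto simp: indicator_def R_def)
    ultimately have D': "(\<lambda>x. indicator (R m) x * ?h x) \<in> borel_measurable borel"
      by simp
    have "g ` R m \<in> sets borel" "bounded (g ` R m)"
      unfolding gR using Q by (auto simp: Q_def bounded_iff)
    moreover have "inj_on g (R m)" "R m \<subseteq> P"
      using inj by (auto simp: R_def inj_on_def)
    moreover have "f y \<le> real m" if "y \<in> g ` R m" for y
      using that unfolding gR Q_def by blast
    ultimately show ?thesis
      unfolding gR[symmetric]
      by (intro nn_integral_change_of_variables_bounded[where B = "real m"] R D' f der) auto
  qed
  have "(\<integral>\<^sup>+x. indicator P x * ?h x \<partial>lborel) = (\<integral>\<^sup>+x. (indicator P x * ?h x) * indicator (\<Union>m. R m) x \<partial>lborel)"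
    unfolding UR by (intro nn_integral_cong) (auto simp: indicator_def)
  also have "\<dots> = emeasure (density lborel (\<lambda>x. indicator P x * ?h x)) (\<Union>m. R m)"
    using D P by (subst emeasure_density) (auto simp: UR)
  also have "\<dots> = (SUP m. emeasure (density lborel (\<lambda>x. indicator P x * ?h x)) (R m))"
    using R \<open>incseq R\<close> by (intro SUP_emeasure_incseq[symmetric]) auto
  also have "\<dots> = (SUP m. \<integral>\<^sup>+x. indicator (R m) x * ?h x \<partial>lborel)"
    using D R by (intro SUP_cong refl, subst emeasure_density)
      (auto simp: R_def indicator_def intro!: nn_integral_cong)
  also have "\<dots> = (SUP m. \<integral>\<^sup>+y. indicator (Q m) y * ennreal (f y) \<partial>lborel)"
    by (simp only: eq)
  also have "\<dots> = (SUP m. emeasure (density lborel (\<lambda>y. ennreal (f y))) (Q m))"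
    using f Q by (intro SUP_cong refl, subst emeasure_density)
      (auto simp: mult.commute)
  also have "\<dots> = emeasure (density lborel (\<lambda>y. ennreal (f y))) (\<Union>m. Q m)"
    using Q \<open>incseq Q\<close> by (intro SUP_emeasure_incseq) auto
  also have "\<dots> = (\<integral>\<^sup>+y. indicator (g ` P) y * ennreal (f y) \<partial>lborel)"
    unfolding UQ using f gP by (subst emeasure_density) (auto simp: mult.commute)
  finally show ?thesis .
qed

lemma nn_integral_change_of_variables:
  fixes g :: "real^'n::finite \<Rightarrow> real^'n::_"
  assumes P: "P \<in> sets borel" and der: "\<And>x. x \<in> P \<Longrightarrow> (g has_derivative g' x) (at x)"
    and inj: "inj_on g P" and gP: "g ` P \<in> sets borel"
    and f: "f \<in> borel_measurable borel" "\<And>y. 0 \<le> f y"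
    and D: "(\<lambda>x. indicator P x * ennreal (\<bar>det (matrix (g' x))\<bar> * f (g x))) \<in> borel_measurable borel"
  shows "(\<integral>\<^sup>+x. indicator P x * ennreal (\<bar>det (matrix (g' x))\<bar> * f (g x)) \<partial>lborel) =
         (\<integral>\<^sup>+y. indicator (g ` P) y * ennreal (f y) \<partial>lborel)"
proof -
  define P1 where "P1 = uncopy_vec -` P"
  define g1 where "g1 x = copy_vec (g (uncopy_vec x))" for x
  define g1' where "g1' x v = copy_vec (g' (uncopy_vec x) (uncopy_vec v))" for x v
  define f1 where "f1 y = f (uncopy_vec y)" for y
  have P1: "P1 \<in> sets borel"
    unfolding P1_def using P by (simp add: measurable_sets_borel[OF measurable_uncopy_vec])
  have der1: "(g1 has_derivative g1' x) (at x)" if "x \<in> P1" for x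
    unfolding g1_def g1'_def
    using that by (intro bounded_linear.has_derivative[OF bounded_linear_copy_vec]
        has_derivative_compose[OF bounded_linear_imp_has_derivative[OF bounded_linear_uncopy_vec] der]) (simp add: P1_def)
  have inj1: "inj_on g1 P1"
    using inj unfolding inj_on_def g1_def P1_def by (metis copy_uncopy uncopy_copy vimageE)
  have im: "g1 ` P1 = uncopy_vec -` (g ` P)"
  proof safe
    fix x assume "x \<in> P1" then show "g1 x \<in> uncopy_vec -` g ` P"
      by (auto simp: g1_def P1_def)
  next
    fix y z assume y: "uncopy_vec y = g z" and z: "z \<in> P"
    have "y = g1 (copy_vec z)"
      unfolding g1_def uncopy_copy y[symmetric] by simp
    moreover have "copy_vec z \<in> P1"
      using z by (simp add: P1_def)
    ultimately show "y \<in> g1 ` P1" by blast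
  qed
  then have gP1: "g1 ` P1 \<in> sets borel"
    using gP by (simp add: measurable_sets_borel[OF measurable_uncopy_vec])
  have det: "det (matrix (g1' x)) = det (matrix (g' (uncopy_vec x)))" for x
  proof -
    have "uncopy_vec (axis j 1) = axis (of_copy j) (1::real)" for j :: "'n ordered_copy"
      by (auto simp: uncopy_vec_def axis_def vec_eq_iff of_copy_inverse)
    then have "matrix (g1' x) = (\<chi> i j. matrix (g' (uncopy_vec x)) $ of_copy i $ of_copy j)"
      by (simp add: matrix_def g1'_def copy_vec_def)
    then show ?thesis
      by (simp add: det_copy)
  qed
  let ?h = "\<lambda>x. indicator P x * ennreal (\<bar>det (matrix (g' x))\<bar> * f (g x))"
  have h1: "?h (uncopy_vec x) = indicator P1 x * ennreal (\<bar>det (matrix (g1' x))\<bar> * f1 (g1 x))" for x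
    by (simp add: det f1_def g1_def P1_def indicator_def)
  have "(\<integral>\<^sup>+x. ?h x \<partial>lborel) = (\<integral>\<^sup>+x. ?h (uncopy_vec x) \<partial>lborel)"
    by (rule nn_integral_uncopy_vec[OF D])
  also have "\<dots> = (\<integral>\<^sup>+x. indicator P1 x * ennreal (\<bar>det (matrix (g1' x))\<bar> * f1 (g1 x)) \<partial>lborel)"
    by (simp only: h1)
  also have "\<dots> = (\<integral>\<^sup>+y. indicator (g1 ` P1) y * ennreal (f1 y) \<partial>lborel)"
  proof (rule nn_integral_change_of_variables_wellorder[OF P1 der1 inj1 gP1])
    show "f1 \<in> borel_measurable borel"
      unfolding f1_def using f by measurable
    have "(\<lambda>x. ?h (uncopy_vec x)) \<in> borel_measurable borel"
      using measurable_compose[OF measurable_uncopy_vec D] .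
    then show "(\<lambda>x. indicator P1 x * ennreal (\<bar>det (matrix (g1' x))\<bar> * f1 (g1 x))) \<in> borel_measurable borel"
      by (simp only: h1)
  qed (auto simp: f1_def f)
  also have "\<dots> = (\<integral>\<^sup>+y. indicator (g ` P) (uncopy_vec y) * ennreal (f (uncopy_vec y)) \<partial>lborel)"
    by (simp add: im f1_def indicator_vimage)
  also have "\<dots> = (\<integral>\<^sup>+y. indicator (g ` P) y * ennreal (f y) \<partial>lborel)"
  proof (rule nn_integral_uncopy_vec[symmetric])
    show "(\<lambda>y. indicator (g ` P) y * ennreal (f y)) \<in> borel_measurable borel"
      using gP f by simp
  qed
  finally show ?thesis .
qed

section \<open>Gram matrices\<close>

text \<open>The matrix of the inner product pulled back by a linear map; for the differential of the
  immersion in a chart it is \<open>metric_matrix\<close>.\<close>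

definition gram :: "(real^'n::finite \<Rightarrow> 'b::real_inner) \<Rightarrow> real^'n^'n"
  where "gram L = (\<chi> i j. L (axis i 1) \<bullet> L (axis j 1))"

lemma linear_axis_expansion:
  fixes L :: "real^'n::finite \<Rightarrow> 'b::real_vector"
  assumes "linear L"
  shows "L v = (\<Sum>j\<in>UNIV. (v $ j) *\<^sub>R L (axis j 1))"
proof -
  have "(\<Sum>j\<in>UNIV. (v $ j) *\<^sub>R L (axis j 1)) = L (\<Sum>j\<in>UNIV. (v $ j) *\<^sub>R axis j 1)"
    by (simp add: linear_sum[OF assms] linear_scale[OF assms])
  then show ?thesis
    using basis_expansion[of v] by (simp add: scalar_mult_eq_scaleR)
qed

lemma gram_compose:
  fixes L :: "real^'n::finite \<Rightarrow> 'b::real_inner" and T :: "real^'n \<Rightarrow> real^'n"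
  assumes L: "linear L"
  shows "gram (\<lambda>v. L (T v)) = transpose (matrix T) ** gram L ** matrix T"
proof -
  have "L (T (axis i 1)) \<bullet> L (T (axis j 1)) =
      (\<Sum>l\<in>UNIV. (\<Sum>k\<in>UNIV. T (axis i 1) $ k * (L (axis k 1) \<bullet> L (axis l 1))) * T (axis j 1) $ l)" for i j
  proof -
    have "L (T (axis i 1)) \<bullet> L (T (axis j 1)) =
      (\<Sum>k\<in>UNIV. T (axis i 1) $ k *\<^sub>R L (axis k 1)) \<bullet> (\<Sum>l\<in>UNIV. T (axis j 1) $ l *\<^sub>R L (axis l 1))"
      using linear_axis_expansion[OF L] by metis
    then show ?thesis
      by (simp add: inner_sum_left inner_sum_right sum_distrib_right sum_distrib_left mult_ac)
  qed
  then show ?thesis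
    by (simp add: gram_def vec_eq_iff matrix_matrix_mult_def transpose_def matrix_def)
qed

lemma det_gram_compose:
  fixes L :: "real^'n::finite \<Rightarrow> 'b::real_inner" and T :: "real^'n \<Rightarrow> real^'n"
  assumes "linear L"
  shows "det (gram (\<lambda>v. L (T v))) = (det (matrix T))\<^sup>2 * det (gram L)"
  unfolding gram_compose[OF assms, of T] by (simp add: det_mul power2_eq_square)

lemma gram_orthonormal:
  fixes L :: "real^'n::finite \<Rightarrow> 'b::real_inner"
  assumes "\<And>i j. L (axis i 1) \<bullet> L (axis j 1) = (if i = j then 1 else 0)"
  shows "gram L = mat 1"
  by (simp add: gram_def mat_def assms vec_eq_iff)

definition frame_map :: "('n::finite \<Rightarrow> real^'n) \<Rightarrow> real^'n \<Rightarrow> real^'n"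
  where "frame_map v x = (\<Sum>j\<in>UNIV. (x $ j) *\<^sub>R v j)"

lemma frame_map_axis [simp]: "frame_map v (axis i 1) = v i"
proof -
  have "frame_map v (axis i 1) = (\<Sum>j\<in>UNIV. if j = i then v j else 0)"
    unfolding frame_map_def by (intro sum.cong) (auto simp: axis_def)
  then show ?thesis by simp
qed

lemma Ck_on_linear_family:
  fixes L :: "'a::real_normed_vector \<Rightarrow> real^'n::finite \<Rightarrow> 'b::real_normed_vector"
  assumes U: "open U" and lin: "\<And>u. u \<in> U \<Longrightarrow> linear (L u)"
    and L: "\<And>v. Ck_on k (\<lambda>u. L u v) U" and v: "Ck_on k v U"
  shows "Ck_on k (\<lambda>u. L u (v u)) U"
proof -
  have "Ck_on k (\<lambda>u. \<Sum>j\<in>UNIV. (v u \<bullet> axis j 1) *\<^sub>R L u (axis j 1)) U"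
    by (intro Ck_on_sum Ck_on_scaleR Ck_on_inner L v U) auto
  moreover have "L u (v u) = (\<Sum>j\<in>UNIV. (v u \<bullet> axis j 1) *\<^sub>R L u (axis j 1))" if "u \<in> U" for u
    using linear_axis_expansion[OF lin[OF that], of "v u"] by (simp add: cart_eq_inner_axis[symmetric])
  ultimately have "Ck_on k (\<lambda>u. \<Sum>j\<in>UNIV. (v u \<bullet> axis j 1) *\<^sub>R L u (axis j 1)) U"
    and "Ck_on k (\<lambda>u. L u (v u)) U \<longleftrightarrow> Ck_on k (\<lambda>u. \<Sum>j\<in>UNIV. (v u \<bullet> axis j 1) *\<^sub>R L u (axis j 1)) U"
    by - (assumption, rule Ck_on_cong[OF U])
  then show ?thesis
    by blast
qed

text \<open>Gram-Schmidt for the standard basis in the inner product pulled back by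
  \<open>L u\<close>, one axis at a time. Only sums, products and a power of a positive function
  occur, so the frame is as regular as \<open>L\<close>.\<close>

lemma smooth_orthonormal_frame:
  fixes L :: "'a::real_normed_vector \<Rightarrow> real^'n::finite \<Rightarrow> 'b::real_inner"
  assumes U: "open U" and lin: "\<And>u. u \<in> U \<Longrightarrow> linear (L u)" and inj: "\<And>u. u \<in> U \<Longrightarrow> inj (L u)"
    and L: "\<And>k v. Ck_on k (\<lambda>u. L u v) U"
  obtains v :: "'n \<Rightarrow> 'a \<Rightarrow> real^'n" where "\<And>i k. Ck_on k (v i) U"
    "\<And>u i j. u \<in> U \<Longrightarrow> L u (v i u) \<bullet> L u (v j u) = (if i = j then 1 else 0)"
proof -
  \<comment> \<open>The third conjunct strengthens the induction: the vectors built so far have no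
    component along a new axis \<open>a\<close>, so the next one has \<open>a\<close>-component 1
    before normalisation and cannot vanish.\<close>
  have "\<exists>v :: 'n \<Rightarrow> 'a \<Rightarrow> real^'n. (\<forall>i\<in>S. \<forall>k. Ck_on k (v i) U) \<and>
      (\<forall>u\<in>U. \<forall>i\<in>S. \<forall>j\<in>S. L u (v i u) \<bullet> L u (v j u) = (if i = j then 1 else 0)) \<and>
      (\<forall>u\<in>U. \<forall>i\<in>S. \<forall>a. a \<notin> S \<longrightarrow> v i u $ a = 0)" for S :: "'n set"
    using finite[of S]
  proof (induction S rule: finite_induct)
    case empty
    then show ?case by simp
  next
    case (insert a S)
    obtain v :: "'n \<Rightarrow> 'a \<Rightarrow> real^'n" where v: "\<And>i k. i \<in> S \<Longrightarrow> Ck_on k (v i) U"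
      "\<And>u i j. u \<in> U \<Longrightarrow> i \<in> S \<Longrightarrow> j \<in> S \<Longrightarrow> L u (v i u) \<bullet> L u (v j u) = (if i = j then 1 else 0)"
      "\<And>u i a. u \<in> U \<Longrightarrow> i \<in> S \<Longrightarrow> a \<notin> S \<Longrightarrow> v i u $ a = 0"
      using insert.IH by metis
    define w where "w u = axis a 1 - (\<Sum>i\<in>S. (L u (axis a 1) \<bullet> L u (v i u)) *\<^sub>R v i u)" for u
    define N where "N u = L u (w u) \<bullet> L u (w u)" for u
    \<comment> \<open>The power stands for the reciprocal square root, so that
      \<open>Ck_on_powr\<close> yields regularity.\<close>
    define e where "e u = N u powr (-1/2) *\<^sub>R w u" for u
    have wa: "w u $ b = (if b = a then 1 else 0)" if "u \<in> U" "b \<notin> S" for u b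
      using that v(3) by (simp add: w_def axis_def)
    have N0: "N u > 0" if "u \<in> U" for u
    proof -
      have "w u \<noteq> 0"
        using wa[OF that, of a] insert.hyps by auto
      then have "L u (w u) \<noteq> 0"
        using inj[OF that] lin[OF that] by (metis injD linear_0)
      then show ?thesis
        by (simp add: N_def)
    qed
    have Lw: "L u (w u) = L u (axis a 1) - (\<Sum>i\<in>S. (L u (axis a 1) \<bullet> L u (v i u)) *\<^sub>R L u (v i u))"
      if "u \<in> U" for u
      using lin[OF that] by (simp add: w_def linear_diff linear_sum linear_scale)
    have orth: "L u (w u) \<bullet> L u (v j u) = 0" if "u \<in> U" "j \<in> S" for u j
    proof -
      have "(\<Sum>i\<in>S. (L u (axis a 1) \<bullet> L u (v i u)) * (L u (v i u) \<bullet> L u (v j u))) =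
         (\<Sum>i\<in>S. if i = j then L u (axis a 1) \<bullet> L u (v i u) else 0)"
        using that v(2) by (intro sum.cong) auto
      then show ?thesis
        using that insert.hyps by (simp add: Lw inner_diff_left inner_sum_left)
    qed
    have w: "Ck_on k w U" for k
    proof -
      have 1: "Ck_on k (\<lambda>u. (L u (axis a 1) \<bullet> L u (v i u)) *\<^sub>R v i u) U" if "i \<in> S" for i
        using that by (intro Ck_on_scaleR Ck_on_inner Ck_on_linear_family[OF U lin L v(1)] L U v(1))
      have "Ck_on k (\<lambda>u. (axis a 1 :: real^'n) + (\<Sum>i\<in>S. (-1::real) *\<^sub>R (L u (axis a 1) \<bullet> L u (v i u)) *\<^sub>R v i u)) U"
        using insert.hyps by (intro Ck_on_add Ck_on_sum Ck_on_scaleR[OF _ 1] Ck_on_const U)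
      then show ?thesis
        unfolding w_def by (simp add: sum_negf)
    qed
    have N: "Ck_on k N U" for k
      unfolding N_def by (intro Ck_on_inner Ck_on_linear_family[OF U lin L w] U)
    have e: "Ck_on k e U" for k
      unfolding e_def by (intro Ck_on_scaleR w U Ck_on_compose[OF Ck_on_powr N]) (use N0 in auto)
    have Le: "L u (e u) = N u powr (-1/2) *\<^sub>R L u (w u)" if "u \<in> U" for u
      using lin[OF that] by (simp add: e_def linear_scale)
    have ee: "L u (e u) \<bullet> L u (e u) = 1" if "u \<in> U" for u
    proof -
      have "L u (e u) \<bullet> L u (e u) = N u powr (-1/2) * N u powr (-1/2) * N u powr 1"
        using N0[OF that] by (simp add: Le[OF that] N_def)
      also have "\<dots> = 1"
        using N0[OF that] by (simp only: powr_add[symmetric]) simp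
      finally show ?thesis .
    qed
    have ev: "L u (e u) \<bullet> L u (v j u) = 0" if "u \<in> U" "j \<in> S" for u j
      using that by (simp add: Le orth)
    have "e u $ b = 0" if "u \<in> U" "b \<notin> insert a S" for u b
      using that wa by (simp add: e_def)
    then show ?case
      using e v ee ev insert.hyps
      by (intro exI[of _ "v(a := e)"]) (auto simp: inner_commute[of "L _ (v _ _)" "L _ (e _)"])
  qed
  from this[of UNIV] obtain v :: "'n \<Rightarrow> 'a \<Rightarrow> real^'n" where "\<forall>i k. Ck_on k (v i) U"
    "\<forall>u\<in>U. \<forall>i j. L u (v i u) \<bullet> L u (v j u) = (if i = j then 1 else 0)"
    by auto
  then show ?thesis
    using that[of v] by blast
qed

lemma linear_orthonormal_frame:
  fixes L :: "real^'n::finite \<Rightarrow> 'b::real_inner"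
  assumes "linear L" "inj L"
  obtains v :: "'n \<Rightarrow> real^'n" where "\<And>i j. L (v i) \<bullet> L (v j) = (if i = j then 1 else 0)"
proof -
  \<comment> \<open>A single linear map is treated as a constant family over the real line.\<close>
  obtain w :: "'n \<Rightarrow> real \<Rightarrow> real^'n" where "\<And>u i j. u \<in> UNIV \<Longrightarrow> L (w i u) \<bullet> L (w j u) = (if i = j then 1 else 0)"
    by (rule smooth_orthonormal_frame[of "UNIV :: real set" "\<lambda>_. L"]) (use assms in auto)
  then show ?thesis
    using that[of "\<lambda>i. w i 0"] by simp
qed

text \<open>In the coordinates of an orthonormal frame the Gram matrix is the identity. The equation
  shows both that \<open>det (gram L)\<close> is positive and that the frame is a basis.\<close>

lemma det_gram_frame:
  fixes L :: "real^'n::finite \<Rightarrow> 'b::real_inner" and v :: "'n \<Rightarrow> real^'n"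
  assumes "linear L" "\<And>i j. L (v i) \<bullet> L (v j) = (if i = j then 1 else 0)"
  shows "(det (matrix (frame_map v)))\<^sup>2 * det (gram L) = 1"
proof -
  have "gram (\<lambda>x. L (frame_map v x)) = mat 1"
    by (rule gram_orthonormal) (simp add: assms(2))
  then show ?thesis
    using det_gram_compose[OF assms(1), of "frame_map v"] by simp
qed

lemma det_gram_pos:
  fixes L :: "real^'n::finite \<Rightarrow> 'b::real_inner"
  assumes "linear L" "inj L"
  shows "det (gram L) > 0"
proof -
  obtain v :: "'n \<Rightarrow> real^'n" where "\<And>i j. L (v i) \<bullet> L (v j) = (if i = j then 1 else 0)"
    using linear_orthonormal_frame[OF assms] by blast
  then have "(det (matrix (frame_map v)))\<^sup>2 * det (gram L) = 1"
    by (rule det_gram_frame[OF assms(1)])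
  then show ?thesis
    by (metis mult_nonneg_nonpos not_le zero_le_power2 zero_less_one)
qed

lemma frame_expansion:
  fixes L :: "real^'n::finite \<Rightarrow> 'b::real_inner" and v :: "'n \<Rightarrow> real^'n"
  assumes L: "linear L" and v: "\<And>i j. L (v i) \<bullet> L (v j) = (if i = j then 1 else 0)"
  shows "x = (\<Sum>i\<in>UNIV. (L x \<bullet> L (v i)) *\<^sub>R v i)"
proof -
  have lin: "linear (frame_map v)"
    by (rule linearI) (auto simp: frame_map_def algebra_simps sum.distrib scaleR_sum_right)
  have "(det (matrix (frame_map v)))\<^sup>2 * det (gram L) = 1"
    by (rule det_gram_frame[OF L v])
  then have "det (matrix (frame_map v)) \<noteq> 0"
    by (metis mult_zero_left power_zero_numeral zero_neq_one)
  then have "bij ((*v) (matrix (frame_map v)))"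
    by (simp add: invertible_det_nz invertible_eq_bij[symmetric])
  moreover have "(*v) (matrix (frame_map v)) = frame_map v"
    using matrix_works[OF lin[folded linear_matrix_vector_mul_eq]] by auto
  ultimately have "bij (frame_map v)"
    by simp
  then obtain y where y: "x = frame_map v y"
    by (meson bij_pointE)
  have "L x \<bullet> L (v i) = y $ i" for i
  proof -
    have "L x \<bullet> L (v i) = (\<Sum>j\<in>UNIV. if j = i then y $ j else 0)"
      unfolding y frame_map_def
      by (simp add: linear_sum[OF L] linear_scale[OF L] inner_sum_left v if_distrib cong: if_cong)
    then show ?thesis by simp
  qed
  then show ?thesis
    using y by (simp add: frame_map_def)
qed

section \<open>Derivative of the volume density\<close>

lemma permutes_UNIV_not_id:
  assumes "p permutes (UNIV :: 'n set)" "p \<noteq> id"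
  obtains j where "j \<noteq> i" "p j \<noteq> j"
proof -
  obtain j where j: "p j \<noteq> j"
    using assms(2) by (metis eq_id_iff)
  then have "p (p j) \<noteq> p j"
    using permutes_inj[OF assms(1)] by (metis injD)
  then show ?thesis
    using j that by metis
qed

text \<open>Jacobi's formula at the identity matrix. A permutation other than \<open>id\<close>
  moves at least two indices, so after one factor of its Leibniz term has been differentiated an
  off-diagonal zero still remains; only the diagonal term contributes.\<close>

lemma has_derivative_det_at_mat_1:
  fixes G :: "'a::real_normed_vector \<Rightarrow> real^'n::finite^'n"
  assumes G: "\<And>i j. ((\<lambda>x. G x $ i $ j) has_derivative G' i j) (at x)" and x: "G x = mat 1"
  shows "((\<lambda>x. det (G x)) has_derivative (\<lambda>v. \<Sum>i\<in>UNIV. G' i i v)) (at x)"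
proof -
  let ?P = "{p. p permutes (UNIV :: 'n set)}"
  let ?t = "\<lambda>p i v. G' i (p i) v * (\<Prod>j\<in>UNIV - {i}. G x $ j $ p j)"
  have "((\<lambda>x. det (G x)) has_derivative
     (\<lambda>v. \<Sum>p\<in>?P. of_int (sign p) * (\<Sum>i\<in>UNIV. ?t p i v))) (at x)"
    unfolding det_def by (intro has_derivative_sum has_derivative_mult_right has_derivative_prod G)
  moreover have "(\<Sum>p\<in>?P. of_int (sign p) * (\<Sum>i\<in>UNIV. ?t p i v)) = (\<Sum>i\<in>UNIV. G' i i v)" for v
  proof -
    have "?t p i v = 0" if "p \<in> ?P" "p \<noteq> id" for p i
    proof -
      have p: "p permutes UNIV" "p \<noteq> id" using that by auto
      obtain j where j: "j \<noteq> i" "p j \<noteq> j"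
        using permutes_UNIV_not_id[OF p] by metis
      then have "G x $ j $ p j = 0" "j \<in> UNIV - {i}"
        by (auto simp: x mat_def)
      then have "(\<Prod>j\<in>UNIV - {i}. G x $ j $ p j) = 0"
        by (metis finite prod_zero)
      then show ?thesis by simp
    qed
    then have "(\<Sum>i\<in>UNIV. ?t p i v) = 0" if "p \<in> ?P - {id}" for p
      using that by (intro sum.neutral) blast
    then have "(\<Sum>p\<in>?P. of_int (sign p) * (\<Sum>i\<in>UNIV. ?t p i v)) =
        (\<Sum>p\<in>{id}. of_int (sign p) * (\<Sum>i\<in>UNIV. ?t p i v))"
      by (intro sum.mono_neutral_right) (auto simp: permutes_id finite_permutations)
    also have "\<dots> = (\<Sum>i\<in>UNIV. G' i i v)"
      by (simp add: x mat_def)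
    finally show ?thesis .
  qed
  ultimately show ?thesis by simp
qed

text \<open>Composition with \<open>frame_map v\<close>, which is held fixed while \<open>u\<close>
  varies, multiplies the determinant by the constant \<open>c\<close> and turns the Gram matrix at
  \<open>u\<close> into the identity, where Jacobi's formula is just a trace.\<close>

lemma has_derivative_sqrt_det_gram:
  fixes L :: "'a::real_normed_vector \<Rightarrow> real^'n::finite \<Rightarrow> 'b::real_inner" and v :: "'n \<Rightarrow> real^'n"
  assumes U: "open U" "u \<in> U" and lin: "\<And>u. u \<in> U \<Longrightarrow> linear (L u)"
    and D: "\<And>v. ((\<lambda>u. L u v) has_derivative D v) (at u)"
    and v: "\<And>i j. L u (v i) \<bullet> L u (v j) = (if i = j then 1 else 0)"
  shows "((\<lambda>u. sqrt (det (gram (L u)))) has_derivative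
     (\<lambda>d. sqrt (det (gram (L u))) * (\<Sum>i\<in>UNIV. D (v i) d \<bullet> L u (v i)))) (at u)"
proof -
  define c where "c = (det (matrix (frame_map v)))\<^sup>2"
  have c: "c * det (gram (L u)) = 1"
    unfolding c_def by (rule det_gram_frame[OF lin[OF U(2)] v])
  then have c0: "c > 0"
    by (metis c_def mult_zero_left power2_eq_square zero_less_power2 zero_neq_one power_zero_numeral)
  have "((\<lambda>u. det (gram (\<lambda>x. L u (frame_map v x)))) has_derivative
     (\<lambda>d. \<Sum>i\<in>UNIV. 2 * (D (v i) d \<bullet> L u (v i)))) (at u)"
  proof -
    have "((\<lambda>u. gram (\<lambda>x. L u (frame_map v x)) $ i $ j) has_derivative
       (\<lambda>d. L u (v i) \<bullet> D (v j) d + D (v i) d \<bullet> L u (v j))) (at u)" for i j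
      by (simp add: gram_def) (intro has_derivative_inner D)
    moreover have "gram (\<lambda>x. L u (frame_map v x)) = mat 1"
      by (rule gram_orthonormal) (simp add: v)
    ultimately have "((\<lambda>u. det (gram (\<lambda>x. L u (frame_map v x)))) has_derivative
       (\<lambda>d. \<Sum>i\<in>UNIV. L u (v i) \<bullet> D (v i) d + D (v i) d \<bullet> L u (v i))) (at u)"
      by (rule has_derivative_det_at_mat_1)
    then show ?thesis
      by (simp add: inner_commute[of "L u _"])
  qed
  then have "((\<lambda>u. inverse c * det (gram (\<lambda>x. L u (frame_map v x)))) has_derivative
     (\<lambda>d. inverse c * (\<Sum>i\<in>UNIV. 2 * (D (v i) d \<bullet> L u (v i))))) (at u)"
    by (rule has_derivative_mult_right)
  moreover have "inverse c * det (gram (\<lambda>x. L u (frame_map v x))) = det (gram (L u))" if "u \<in> U" for u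
    unfolding det_gram_compose[OF lin[OF that], of "frame_map v"] using c0 by (simp add: c_def)
  ultimately have "((\<lambda>u. det (gram (L u))) has_derivative
     (\<lambda>d. inverse c * (\<Sum>i\<in>UNIV. 2 * (D (v i) d \<bullet> L u (v i))))) (at u)"
    by (rule has_derivative_transform_within_open[OF _ U])
  moreover
  have g: "det (gram (L u)) = inverse c"
    using c c0 by (simp add: field_simps)
  ultimately have "((\<lambda>u. sqrt (det (gram (L u)))) has_derivative
     (\<lambda>d. (inverse c * (\<Sum>i\<in>UNIV. 2 * (D (v i) d \<bullet> L u (v i)))) * (inverse (sqrt (det (gram (L u)))) / 2))) (at u)"
    using c0 by - (rule has_derivative_real_sqrt, auto)
  moreover
  have "(inverse c * (\<Sum>i\<in>UNIV. 2 * (D (v i) d \<bullet> L u (v i)))) * (inverse (sqrt (det (gram (L u)))) / 2)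
      = sqrt (det (gram (L u))) * (\<Sum>i\<in>UNIV. D (v i) d \<bullet> L u (v i))" for d
  proof -
    have "inverse c / sqrt (inverse c) = sqrt (inverse c)"
      using c0 by (simp add: real_div_sqrt)
    then show ?thesis
      unfolding g sum_distrib_left[symmetric] using c0 by (simp add: field_simps)
  qed
  ultimately show ?thesis by simp
qed

section \<open>Integrals of compactly supported derivatives\<close>

text \<open>By translation invariance every difference quotient of \<open>h\<close> has integral 0.
  The quotients converge to the derivative and are dominated by a constant on a fixed ball, so both
  claims follow by dominated convergence.\<close>

lemma integral_derivative_eq_0:
  fixes h :: "'a::euclidean_space \<Rightarrow> real"
  assumes h: "Ck_on 1 h UNIV" and K: "compact K" "\<And>x. x \<notin> K \<Longrightarrow> h x = 0"
  shows "integrable lborel (\<lambda>x. frechet_derivative h (at x) v)"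
    and "(\<integral>x. frechet_derivative h (at x) v \<partial>lborel) = 0"
proof -
  let ?D = "\<lambda>x. frechet_derivative h (at x) v"
  have dh: "(h has_derivative frechet_derivative h (at x)) (at x)" for x
    using h by (auto intro: differentiable_has_frechet_derivative)
  have contD: "continuous_on UNIV ?D" and conth: "continuous_on UNIV h"
    using h Ck_on_imp_continuous_on[OF h] by auto
  obtain r where r: "r > 0" "K \<subseteq> cball 0 r"
    using bounded_subset_ballD[OF compact_imp_bounded[OF K(1)], of 0] ball_subset_cball by blast
  have D0: "?D x = 0" if "x \<notin> K" for x
  proof -
    have "frechet_derivative h (at x) = frechet_derivative (\<lambda>_. 0) (at x)"
      by (rule frechet_derivative_cong_open[of "- K"]) (use K that compact_imp_closed in auto)
    then show ?thesis by simp
  qed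
  obtain M where M: "\<And>x. x \<in> K \<Longrightarrow> norm (?D x) \<le> M"
    using compact_imp_bounded[OF compact_continuous_image[OF continuous_on_subset[OF contD] K(1)]]
    by (auto simp: bounded_iff)
  define B where "B = max M 0"
  have B: "norm (?D x) \<le> B" for x
    using M[of x] D0[of x] by (cases "x \<in> K") (auto simp: B_def)
  \<comment> \<open>The increments are at most 1, so enlarging the ball around the support by
    \<open>norm v\<close> accommodates all translates.\<close>
  let ?C = "cball (0::'a) (r + norm v)"
  let ?q = "\<lambda>n x. (h (x + inverse (real (Suc n)) *\<^sub>R v) - h x) / inverse (real (Suc n))"
  have int_h: "integrable lborel h"
  proof -
    have "integrable lborel (\<lambda>x. indicator K x *\<^sub>R h x)"
      using borel_integrable_compact[OF K(1) continuous_on_subset[OF conth subset_UNIV]]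
      by (simp add: set_integrable_def[symmetric] scaleR_conv_of_real)
    moreover have "(\<lambda>x. indicator K x *\<^sub>R h x) = h"
      using K(2) by (auto simp: indicator_def fun_eq_iff)
    ultimately show ?thesis by simp
  qed
  have trans: "integrable lborel (\<lambda>x. h (x + c))" "(\<integral>x. h (x + c) \<partial>lborel) = (\<integral>x. h x \<partial>lborel)" for c
  proof -
    have hm: "h \<in> borel_measurable borel"
      using conth by (rule borel_measurable_continuous_onI)
    have "integrable (distr lborel borel ((+) c)) h"
      using int_h by (simp add: lborel_distr_plus)
    then show "integrable lborel (\<lambda>x. h (x + c))"
      by (subst (asm) integrable_distr_eq) (auto simp: add.commute hm)
    have "(\<integral>x. h x \<partial>lborel) = (\<integral>x. h x \<partial>(distr lborel borel ((+) c)))"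
      by (simp add: lborel_distr_plus)
    also have "\<dots> = (\<integral>x. h (x + c) \<partial>lborel)"
      by (subst integral_distr) (auto simp: add.commute hm)
    finally show "(\<integral>x. h (x + c) \<partial>lborel) = (\<integral>x. h x \<partial>lborel)" ..
  qed
  have bound: "norm (?q n x) \<le> indicator ?C x *\<^sub>R B" for n x
  proof -
    let ?s = "inverse (real (Suc n))"
    have s: "?s > 0" "?s \<le> 1"
      by (auto simp: inverse_le_1_iff)
    have d: "((\<lambda>t. h (x + t *\<^sub>R v)) has_real_derivative ?D (x + t *\<^sub>R v)) (at t)" for t
    proof -
      have "((\<lambda>t. h (x + t *\<^sub>R v)) has_derivative
          (\<lambda>e. frechet_derivative h (at (x + t *\<^sub>R v)) (e *\<^sub>R v))) (at t)"
        by (rule has_derivative_compose[where g = h and f = "\<lambda>t. x + t *\<^sub>R v", OF _ dh])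
           (auto intro!: derivative_eq_intros)
      then show ?thesis
        using linear_scale[OF has_derivative_linear[OF dh]]
        by (simp add: has_field_derivative_def mult.commute[of _ "?D _"])
    qed
    obtain t where t: "0 < t" "t < ?s" "h (x + ?s *\<^sub>R v) - h (x + 0 *\<^sub>R v) = (?s - 0) * ?D (x + t *\<^sub>R v)"
      using MVT2[OF s(1), of "\<lambda>t. h (x + t *\<^sub>R v)" "\<lambda>t. ?D (x + t *\<^sub>R v)"] d by auto
    then have q: "?q n x = ?D (x + t *\<^sub>R v)"
      using s(1) by (simp add: field_simps)
    show ?thesis
    proof (cases "x \<in> ?C")
      case True
      then show ?thesis
        unfolding q using B by simp
    next
      case False
      have "norm (t *\<^sub>R v) \<le> norm v"
        using t s mult_right_mono[of t 1 "norm v"] by simp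
      then have "norm (x + t *\<^sub>R v) > r"
        using False norm_diff_ineq[of x "t *\<^sub>R v"] by simp
      then have "x + t *\<^sub>R v \<notin> K"
        using r(2) by auto
      then show ?thesis
        unfolding q using D0 False by simp
    qed
  qed
  have lim: "(\<lambda>n. ?q n x) \<longlonglongrightarrow> ?D x" for x
  proof -
    have "((\<lambda>t. h (x + t *\<^sub>R v)) has_derivative (\<lambda>e. frechet_derivative h (at (x + 0 *\<^sub>R v)) (e *\<^sub>R v))) (at 0)"
      by (rule has_derivative_compose[where g = h and f = "\<lambda>t. x + t *\<^sub>R v", OF _ dh])
         (auto intro!: derivative_eq_intros)
    then have "((\<lambda>t. h (x + t *\<^sub>R v)) has_real_derivative ?D x) (at 0)"
      using linear_scale[OF has_derivative_linear[OF dh]]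
      by (simp add: has_field_derivative_def mult.commute[of _ "?D _"])
    then have "((\<lambda>s. (h (x + s *\<^sub>R v) - h x) / s) \<longlongrightarrow> ?D x) (at 0)"
      by (simp add: DERIV_def)
    moreover have "filterlim (\<lambda>n. inverse (real (Suc n))) (at 0) sequentially"
      using LIMSEQ_inverse_real_of_nat by (auto simp: filterlim_at simp del: of_nat_Suc)
    ultimately show ?thesis
      using filterlim_compose by blast
  qed
  have bint: "integrable lborel (\<lambda>x. indicator ?C x *\<^sub>R B)"
    by (intro integrable_scaleR_left integrable_real_indicator)
       (use emeasure_bounded_finite[OF bounded_cball] in \<open>auto simp: top.not_eq_extremum\<close>)
  have qm: "(\<lambda>x. ?q n x) \<in> borel_measurable lborel" for n
    using int_h trans(1) by (intro borel_measurable_divide borel_measurable_diff) auto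
  have Dm: "?D \<in> borel_measurable lborel"
    using borel_measurable_continuous_onI[OF contD] by simp
  show "integrable lborel ?D"
    by (rule integrable_dominated_convergence[OF Dm qm bint AE_I2[OF lim] AE_I2[OF bound]])
  have "(\<lambda>n. \<integral>x. ?q n x \<partial>lborel) \<longlonglongrightarrow> (\<integral>x. ?D x \<partial>lborel)"
    by (rule integral_dominated_convergence[OF Dm qm bint AE_I2[OF lim] AE_I2[OF bound]])
  moreover have "(\<integral>x. ?q n x \<partial>lborel) = 0" for n
    using trans int_h by simp
  ultimately show "(\<integral>x. ?D x \<partial>lborel) = 0"
    by (simp add: LIMSEQ_const_iff)
qed

section \<open>Geometry of an immersed hypersurface in a chart\<close>

lemma linear_family_derivative_expansion:
  fixes L :: "'a::real_normed_vector \<Rightarrow> real^'n::finite \<Rightarrow> 'b::real_normed_vector"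
  assumes U: "open U" "u \<in> U" and lin: "\<And>u. u \<in> U \<Longrightarrow> linear (L u)"
    and D: "\<And>v. ((\<lambda>u. L u v) has_derivative D v) (at u)"
  shows "D v d = (\<Sum>j\<in>UNIV. (v $ j) *\<^sub>R D (axis j 1) d)"
proof -
  have "((\<lambda>x. \<Sum>j\<in>UNIV. (v $ j) *\<^sub>R L x (axis j 1)) has_derivative
      (\<lambda>d. \<Sum>j\<in>UNIV. (v $ j) *\<^sub>R D (axis j 1) d)) (at u)"
    by (intro has_derivative_sum has_derivative_scaleR_right D)
  then have "((\<lambda>x. L x v) has_derivative (\<lambda>d. \<Sum>j\<in>UNIV. (v $ j) *\<^sub>R D (axis j 1) d)) (at u)"
    by (rule has_derivative_transform_within_open[OF _ U])
       (rule linear_axis_expansion[OF lin, symmetric])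
  then show ?thesis
    using has_derivative_unique[OF D[of v]] by metis
qed

text \<open>The product rule for applying \<open>L x\<close> to a moving vector. Differentiability
  of \<open>L\<close> is only given for each fixed vector; a finite expansion in the standard basis
  makes this sufficient.\<close>

lemma has_derivative_linear_family:
  fixes L :: "'a::real_normed_vector \<Rightarrow> real^'n::finite \<Rightarrow> 'b::real_normed_vector"
  assumes U: "open U" "u \<in> U" and lin: "\<And>u. u \<in> U \<Longrightarrow> linear (L u)"
    and D: "\<And>v. ((\<lambda>u. L u v) has_derivative D v) (at u)"
    and v: "(v has_derivative v') (at u)"
  shows "((\<lambda>x. L x (v x)) has_derivative (\<lambda>d. L u (v' d) + D (v u) d)) (at u)"
proof -
  have vj: "((\<lambda>x. v x $ j) has_derivative (\<lambda>d. v' d $ j)) (at u)" for j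
    by (rule bounded_linear.has_derivative[OF bounded_linear_vec_nth v])
  have "((\<lambda>x. \<Sum>j\<in>UNIV. (v x $ j) *\<^sub>R L x (axis j 1)) has_derivative
      (\<lambda>d. \<Sum>j\<in>UNIV. (v u $ j) *\<^sub>R D (axis j 1) d + (v' d $ j) *\<^sub>R L u (axis j 1))) (at u)"
    by (intro has_derivative_sum has_derivative_scaleR vj D)
  then have "((\<lambda>x. L x (v x)) has_derivative
      (\<lambda>d. \<Sum>j\<in>UNIV. (v u $ j) *\<^sub>R D (axis j 1) d + (v' d $ j) *\<^sub>R L u (axis j 1))) (at u)"
    by (rule has_derivative_transform_within_open[OF _ U])
       (rule linear_axis_expansion[OF lin, symmetric])
  moreover have "(\<Sum>j\<in>UNIV. (v u $ j) *\<^sub>R D (axis j 1) d + (v' d $ j) *\<^sub>R L u (axis j 1)) =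
      L u (v' d) + D (v u) d" for d
    using linear_axis_expansion[OF lin[OF U(2)], of "v' d"]
      linear_family_derivative_expansion[OF U lin D, of "v u" d]
    by (simp add: sum.distrib)
  ultimately show ?thesis by simp
qed

text \<open>The matrix \<open>a\<close> of the change between two orthonormal frames is orthogonal,
  so the trace of a bilinear form does not see it.\<close>

lemma frame_trace_independent:
  fixes L :: "real^'n::finite \<Rightarrow> 'b::real_inner" and v w :: "'n \<Rightarrow> real^'n"
    and B :: "real^'n \<Rightarrow> real^'n \<Rightarrow> real"
  assumes L: "linear L" and v: "\<And>i j. L (v i) \<bullet> L (v j) = (if i = j then 1 else 0)"
    and w: "\<And>i j. L (w i) \<bullet> L (w j) = (if i = j then 1 else 0)"
    and B: "\<And>x. linear (B x)" "\<And>y. linear (\<lambda>x. B x y)"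
  shows "(\<Sum>i\<in>UNIV. B (v i) (v i)) = (\<Sum>i\<in>UNIV. B (w i) (w i))"
proof -
  define a where "a i j = L (v i) \<bullet> L (w j)" for i j
  have ve: "v i = (\<Sum>j\<in>UNIV. a i j *\<^sub>R w j)" for i
    unfolding a_def by (rule frame_expansion[OF L w])
  have we: "w j = (\<Sum>i\<in>UNIV. a i j *\<^sub>R v i)" for j
    unfolding a_def using frame_expansion[OF L v, of "w j"] by (simp add: inner_commute)
  have delta: "(\<Sum>i\<in>UNIV. a i j * a i k) = (if j = k then 1 else 0)" for j k
  proof -
    have "(if j = k then 1 else 0) = L (w j) \<bullet> L (w k)"
      by (simp add: w)
    also have "L (w j) = (\<Sum>i\<in>UNIV. a i j *\<^sub>R L (v i))"
      by (subst we) (simp add: linear_sum[OF L] linear_scale[OF L])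
    finally show ?thesis
      by (simp add: inner_sum_left a_def)
  qed
  have "B (v i) (v i) = (\<Sum>j\<in>UNIV. \<Sum>k\<in>UNIV. a i j * a i k * B (w j) (w k))" for i
  proof -
    have "B (v i) (v i) = B (\<Sum>j\<in>UNIV. a i j *\<^sub>R w j) (\<Sum>k\<in>UNIV. a i k *\<^sub>R w k)"
      using ve by simp
    also have "\<dots> = (\<Sum>j\<in>UNIV. a i j * B (w j) (\<Sum>k\<in>UNIV. a i k *\<^sub>R w k))"
      by (simp add: linear_sum[OF B(2)] linear_scale[OF B(2)])
    also have "\<dots> = (\<Sum>j\<in>UNIV. a i j * (\<Sum>k\<in>UNIV. a i k * B (w j) (w k)))"
      by (simp add: linear_sum[OF B(1)] linear_scale[OF B(1)])
    finally show ?thesis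
      by (simp add: sum_distrib_left mult.assoc)
  qed
  then have "(\<Sum>i\<in>UNIV. B (v i) (v i)) = (\<Sum>i\<in>UNIV. \<Sum>j\<in>UNIV. \<Sum>k\<in>UNIV. a i j * a i k * B (w j) (w k))"
    by simp
  also have "\<dots> = (\<Sum>j\<in>UNIV. \<Sum>i\<in>UNIV. \<Sum>k\<in>UNIV. a i j * a i k * B (w j) (w k))"
    by (rule sum.swap)
  also have "\<dots> = (\<Sum>j\<in>UNIV. \<Sum>k\<in>UNIV. \<Sum>i\<in>UNIV. a i j * a i k * B (w j) (w k))"
    by (intro sum.cong refl sum.swap)
  also have "\<dots> = (\<Sum>j\<in>UNIV. \<Sum>k\<in>UNIV. (if j = k then B (w j) (w k) else 0))"
    by (intro sum.cong refl) (simp add: sum_distrib_right[symmetric] delta)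
  finally show ?thesis
    by simp
qed

text \<open>Both sides are the trace of \<open>T\<close>. This converts the coordinate expression
  for a divergence into a sum over an orthonormal frame.\<close>

lemma trace_in_frame:
  fixes L :: "real^'n::finite \<Rightarrow> 'b::real_inner" and v :: "'n \<Rightarrow> real^'n" and T :: "real^'n \<Rightarrow> real^'n"
  assumes L: "linear L" and v: "\<And>i j. L (v i) \<bullet> L (v j) = (if i = j then 1 else 0)" and T: "linear T"
  shows "(\<Sum>j\<in>UNIV. T (axis j 1) $ j) = (\<Sum>i\<in>UNIV. L (T (v i)) \<bullet> L (v i))"
proof -
  have "T (axis j 1) $ j = (\<Sum>i\<in>UNIV. (L (axis j 1) \<bullet> L (v i)) * T (v i) $ j)" for j
  proof -
    have "T (axis j 1) = T (\<Sum>i\<in>UNIV. (L (axis j 1) \<bullet> L (v i)) *\<^sub>R v i)"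
      using frame_expansion[OF L v] by metis
    then show ?thesis
      by (simp add: linear_sum[OF T] linear_scale[OF T])
  qed
  then have "(\<Sum>j\<in>UNIV. T (axis j 1) $ j) = (\<Sum>i\<in>UNIV. \<Sum>j\<in>UNIV. (L (axis j 1) \<bullet> L (v i)) * T (v i) $ j)"
    by (simp only:) (rule sum.swap)
  moreover have "(\<Sum>j\<in>UNIV. (L (axis j 1) \<bullet> L (v i)) * T (v i) $ j) = L (T (v i)) \<bullet> L (v i)" for i
    by (subst linear_axis_expansion[OF L, of "T (v i)"]) (simp add: inner_sum_left mult.commute)
  ultimately show ?thesis
    by simp
qed

text \<open>Codimension one enters here: \<open>\<nu>\<close> and the image of an orthonormal frame
  are as many orthogonal vectors as the ambient dimension, hence span, and the difference of the two
  sides is orthogonal to all of them.\<close>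

lemma normal_component:
  fixes L :: "real^'n::finite \<Rightarrow> real^'k::finite"
  assumes card: "CARD('k) = CARD('n) + 1" and L: "linear L" "inj L"
    and \<nu>: "norm \<nu> = 1" "\<And>w. \<nu> \<bullet> L w = 0" and y: "\<And>w. y \<bullet> L w = 0"
  shows "y = (y \<bullet> \<nu>) *\<^sub>R \<nu>"
proof -
  obtain v :: "'n \<Rightarrow> real^'n" where v: "\<And>i j. L (v i) \<bullet> L (v j) = (if i = j then 1 else 0)"
    using linear_orthonormal_frame[OF L] by blast
  let ?b = "\<lambda>i. L (v i)"
  let ?B = "insert \<nu> (range ?b)"
  have ne: "?b i \<noteq> 0" for i
    using v[of i i] by auto
  have inj: "inj ?b"
  proof (rule injI)
    fix i j assume "L (v i) = L (v j)"
    then show "i = j"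
      using v[of i j] v[of i i] by (auto split: if_splits)
  qed
  have "\<nu> \<notin> range ?b"
    using \<nu>(2) v by (metis (full_types) rangeE zero_neq_one)
  then have "card ?B = CARD('k)"
    using card card_image[OF inj] by simp
  moreover have "independent ?B"
  proof (rule pairwise_orthogonal_independent)
    show "pairwise orthogonal ?B"
      using v \<nu>(2) by (auto simp: pairwise_def orthogonal_def inner_commute)
    show "0 \<notin> ?B"
      using \<nu>(1) ne by (auto simp: image_iff)
  qed
  ultimately have "UNIV \<subseteq> span ?B"
    by (intro card_ge_dim_independent) auto
  moreover have "orthogonal (y - (y \<bullet> \<nu>) *\<^sub>R \<nu>) b" if "b \<in> ?B" for b
    using that \<nu> y by (auto simp: orthogonal_def inner_diff_left dot_square_norm)
  ultimately have "orthogonal (y - (y \<bullet> \<nu>) *\<^sub>R \<nu>) (y - (y \<bullet> \<nu>) *\<^sub>R \<nu>)"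
    using orthogonal_to_span by blast
  then show ?thesis
    by (simp add: orthogonal_def)
qed

locale immersion =
  fixes A :: "('n::finite, 's::{t2_space,second_countable_topology}) param set"
    and F :: "'s \<Rightarrow> real^'k::finite"
  assumes immersed: "immersed_hypersurface A F"
begin

definition dX :: "(real^'n \<Rightarrow> 's) \<Rightarrow> real^'n \<Rightarrow> real^'n \<Rightarrow> real^'k"
  where "dX \<phi> u = frechet_derivative (F \<circ> \<phi>) (at u)"

text \<open>The plain second derivative in coordinates. It is not a tensor, but its normal part is
  the second fundamental form.\<close>

definition ddX :: "(real^'n \<Rightarrow> 's) \<Rightarrow> real^'n \<Rightarrow> real^'n \<Rightarrow> real^'n \<Rightarrow> real^'k"
  where "ddX \<phi> u v = frechet_derivative (\<lambda>x. dX \<phi> x v) (at u)"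

context
  fixes U \<phi>
  assumes chart: "(U, \<phi>) \<in> A"
begin

lemma chart_open: "open U" and chart_image_open: "open (\<phi> ` U)"
  using immersed chart by (auto simp: immersed_hypersurface_def smooth_atlas_def)

text \<open>The atlas only provides some continuous inverse. On the image it must coincide with
  \<open>inv_into\<close>, in terms of which the transition maps are defined.\<close>

lemma chart_homeomorphism: "homeomorphism U (\<phi> ` U) \<phi> (inv_into U \<phi>)"
proof -
  obtain \<psi> where \<psi>: "homeomorphism U (\<phi> ` U) \<phi> \<psi>"
    using immersed chart unfolding immersed_hypersurface_def smooth_atlas_def by fast
  have "inj_on \<phi> U"
    using homeomorphism_apply1[OF \<psi>] by (rule inj_on_inverseI)
  then have "inv_into U \<phi> y = \<psi> y" if "y \<in> \<phi> ` U" for y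
    using that homeomorphism_apply1[OF \<psi>] by (auto simp: inv_into_f_f)
  then show ?thesis
    using homeomorphism_cong[OF \<psi> refl refl] by auto
qed

lemma chart_inj: "inj_on \<phi> U"
  using homeomorphism_apply1[OF chart_homeomorphism] by (rule inj_on_inverseI)

lemma chart_continuous: "continuous_on U \<phi>"
  using chart_homeomorphism by (simp add: homeomorphism_def)

lemma chart_inv_continuous: "continuous_on (\<phi> ` U) (inv_into U \<phi>)"
  using chart_homeomorphism by (simp add: homeomorphism_def)

lemma chart_open_image: "open W \<Longrightarrow> W \<subseteq> U \<Longrightarrow> open (\<phi> ` W)"
proof -
  assume W: "open W" "W \<subseteq> U"
  have "openin (top_of_set U) W"
    using W by (simp add: openin_open_eq chart_open)
  then have "openin (top_of_set (\<phi> ` U)) (\<phi> ` W)"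
    using homeomorphism_imp_open_map[OF chart_homeomorphism] by blast
  then show ?thesis
    using chart_image_open openin_open_trans by blast
qed

lemma X_smooth: "Ck_on k (F \<circ> \<phi>) U"
  using immersed chart unfolding immersed_hypersurface_def smooth_on_def by blast

lemma X_differentiable: "u \<in> U \<Longrightarrow> (F \<circ> \<phi>) differentiable (at u)"
  using X_smooth[of 1] by auto

lemma X_has_derivative: "u \<in> U \<Longrightarrow> ((F \<circ> \<phi>) has_derivative dX \<phi> u) (at u)"
  unfolding dX_def by (rule differentiable_has_frechet_derivative[OF X_differentiable])

lemma dX_linear: "u \<in> U \<Longrightarrow> linear (dX \<phi> u)"
  using X_has_derivative has_derivative_linear by blast

lemma dX_inj: "u \<in> U \<Longrightarrow> inj (dX \<phi> u)"
  using immersed chart unfolding immersed_hypersurface_def dX_def by blast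

lemma dX_smooth: "Ck_on k (\<lambda>u. dX \<phi> u v) U"
  using X_smooth[of "Suc k"] by (simp add: dX_def)

lemma dX_has_derivative: "u \<in> U \<Longrightarrow> ((\<lambda>u. dX \<phi> u v) has_derivative ddX \<phi> u v) (at u)"
  unfolding ddX_def using dX_smooth[of 1 v] by (auto intro: differentiable_has_frechet_derivative)

lemma ddX_linear: "u \<in> U \<Longrightarrow> linear (ddX \<phi> u v)"
  using dX_has_derivative has_derivative_linear by blast

lemma ddX_sym: "u \<in> U \<Longrightarrow> ddX \<phi> u v w = ddX \<phi> u w v"
  unfolding ddX_def dX_def by (rule second_derivative_symmetric[OF X_smooth chart_open])

lemma ddX_linear_left: "u \<in> U \<Longrightarrow> linear (\<lambda>v. ddX \<phi> u v w)"
  using ddX_linear[of u w] by (simp add: ddX_sym[of u _ w])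

lemma tangent_space_dX: "u \<in> U \<Longrightarrow> dX \<phi> u v \<in> tangent_space A F (\<phi> u)"
  unfolding tangent_space_def dX_def using chart by blast

lemma det_metric_pos: "u \<in> U \<Longrightarrow> det (metric_matrix F \<phi> u) > 0"
  using det_gram_pos[OF dX_linear dX_inj] by (simp add: gram_def metric_matrix_def dX_def)

lemma metric_matrix_gram: "metric_matrix F \<phi> u = gram (dX \<phi> u)"
  by (simp add: gram_def metric_matrix_def dX_def)

end

section \<open>Transition maps and the tensorial normal part of the second derivative\<close>

context
  fixes U \<phi> V \<eta>
  assumes charts: "(U, \<phi>) \<in> A" "(V, \<eta>) \<in> A"
begin

abbreviation "overlap \<equiv> U \<inter> \<phi> -` (\<eta> ` V)"

abbreviation "transition \<equiv> inv_into V \<eta> \<circ> \<phi>"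

lemma overlap_open: "open overlap"
  using continuous_open_preimage[OF chart_continuous[OF charts(1)] chart_open[OF charts(1)]
      chart_image_open[OF charts(2)]] .

lemma transition_smooth: "Ck_on k transition overlap"
  using immersed charts unfolding immersed_hypersurface_def smooth_atlas_def smooth_on_def by fast

lemma transition_differentiable: "u \<in> overlap \<Longrightarrow> transition differentiable (at u)"
  using transition_smooth[of 1] by auto

lemma transition_mem: "u \<in> overlap \<Longrightarrow> transition u \<in> V"
  by (auto simp: inv_into_into)

lemma transition_eq: "u \<in> overlap \<Longrightarrow> \<eta> (transition u) = \<phi> u"
  by (auto simp: f_inv_into_f)

lemma transition_inj: "inj_on transition overlap"
  using chart_inj[OF charts(1)] transition_eq by (metis (no_types, lifting) IntD1 inj_onD inj_onI)

lemma dX_transition: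
  assumes "u \<in> overlap"
  shows "dX \<phi> u v = dX \<eta> (transition u) (frechet_derivative transition (at u) v)"
proof -
  have "frechet_derivative (F \<circ> \<phi>) (at u) = frechet_derivative (\<lambda>x. (F \<circ> \<eta>) (transition x)) (at u)"
  proof (rule frechet_derivative_cong_open[OF overlap_open assms])
    fix y assume "y \<in> overlap"
    then show "(F \<circ> \<phi>) y = (F \<circ> \<eta>) (transition y)"
      using transition_eq[of y] by simp
  qed
  then show ?thesis
    unfolding dX_def
    using frechet_derivative_chain[OF transition_differentiable[OF assms] X_differentiable[OF charts(2) transition_mem[OF assms]], of v]
    by (simp add: o_def)
qed

text \<open>The second derivative of the transition map enters only through a tangential vector,
  which the pairing with a normal removes.\<close>

lemma ddX_transition:
  assumes u: "u \<in> overlap" and \<nu>: "\<And>w. \<nu> \<bullet> dX \<eta> (transition u) w = 0"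
  shows "ddX \<phi> u v w \<bullet> \<nu> = ddX \<eta> (transition u) (frechet_derivative transition (at u) v)
     (frechet_derivative transition (at u) w) \<bullet> \<nu>"
proof -
  let ?D = "frechet_derivative transition (at u)"
  define L where "L x = dX \<eta> (transition x)" for x
  have T: "(transition has_derivative ?D) (at u)"
    by (rule differentiable_has_frechet_derivative[OF transition_differentiable[OF u]])
  have L: "((\<lambda>x. L x e) has_derivative (\<lambda>d. ddX \<eta> (transition u) e (?D d))) (at u)" for e
    unfolding L_def
    by (rule has_derivative_compose[OF T dX_has_derivative[OF charts(2) transition_mem[OF u]]])
  have lin: "linear (L x)" if "x \<in> overlap" for x
    unfolding L_def by (rule dX_linear[OF charts(2) transition_mem[OF that]])
  have "Ck_on 1 (\<lambda>x. frechet_derivative transition (at x) v) overlap"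
    using transition_smooth[of "Suc 1"] unfolding Ck_on.simps(2)[of 1] by blast
  then have "(\<lambda>x. frechet_derivative transition (at x) v) differentiable (at u)"
    using u by auto
  then obtain v' where v': "((\<lambda>x. frechet_derivative transition (at x) v) has_derivative v') (at u)"
    unfolding differentiable_def by blast
  have "((\<lambda>x. L x (frechet_derivative transition (at x) v)) has_derivative
     (\<lambda>d. L u (v' d) + ddX \<eta> (transition u) (?D v) (?D d))) (at u)"
    by (rule has_derivative_linear_family[OF overlap_open u lin L v'])
  then have "((\<lambda>x. dX \<phi> x v) has_derivative
     (\<lambda>d. L u (v' d) + ddX \<eta> (transition u) (?D v) (?D d))) (at u)"
    by (rule has_derivative_transform_within_open[OF _ overlap_open u])
       (simp add: dX_transition L_def del: o_apply)
  then have "ddX \<phi> u v w = L u (v' w) + ddX \<eta> (transition u) (?D v) (?D w)"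
    unfolding ddX_def by (simp add: frechet_derivative_eqI)
  then show ?thesis
    using \<nu> by (simp add: inner_add_left inner_add_right L_def inner_commute del: o_apply)
qed

end

text \<open>Differentiating the coefficients of the frame produces tangential vectors only, so the
  values of the frame at the point determine the normal part.\<close>

lemma frame_field_derivative:
  assumes chart: "(U, \<phi>) \<in> A" and W: "open W" "W \<subseteq> U" "u \<in> W" and v: "smooth_on W (v i)"
    and \<nu>: "\<And>w. \<nu> \<bullet> dX \<phi> u w = 0"
  shows "frechet_derivative (frame_field F \<phi> v i) (at u) d \<bullet> \<nu> = ddX \<phi> u (v i u) d \<bullet> \<nu>"
proof -
  have "Ck_on 1 (v i) W"
    using v by (simp add: smooth_on_def del: Ck_on.simps)
  then obtain v' where v': "(v i has_derivative v') (at u)"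
    using W(3) by (auto simp: differentiable_def)
  have u: "u \<in> U" using W by auto
  have "((\<lambda>x. dX \<phi> x (v i x)) has_derivative (\<lambda>d. dX \<phi> u (v' d) + ddX \<phi> u (v i u) d)) (at u)"
    by (rule has_derivative_linear_family[OF chart_open[OF chart] u dX_linear[OF chart] dX_has_derivative[OF chart u] v'])
  then have "frechet_derivative (\<lambda>x. dX \<phi> x (v i x)) (at u) = (\<lambda>d. dX \<phi> u (v' d) + ddX \<phi> u (v i u) d)"
    by (rule frechet_derivative_eqI)
  moreover have "frame_field F \<phi> v i = (\<lambda>x. dX \<phi> x (v i x))"
    by (simp add: fun_eq_iff frame_field_def dX_def)
  ultimately show ?thesis
    using \<nu> by (simp add: inner_add_left inner_add_right inner_commute)
qed

text \<open>This resolves the definite description of \<open>mean_curvature\<close>, and does so for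
  vectors that are orthonormal merely at the point \<open>u\<close>.\<close>

lemma mean_curvature_frame:
  fixes v :: "'n \<Rightarrow> real^'n"
  assumes chart: "(U, \<phi>) \<in> A" and u: "u \<in> U" and \<nu>: "unit_normal A F \<nu>"
    and v: "\<And>i j. dX \<phi> u (v i) \<bullet> dX \<phi> u (v j) = (if i = j then 1 else 0)"
  shows "mean_curvature A F \<nu> (\<phi> u) = - (\<Sum>i\<in>UNIV. ddX \<phi> u (v i) (v i) \<bullet> \<nu> (\<phi> u))"
  unfolding mean_curvature_def
proof (rule the_equality)
  have \<nu>_dX: "\<nu> (\<phi> u) \<bullet> dX \<phi> u w = 0" for w
    using \<nu> tangent_space_dX[OF chart u] by (simp add: unit_normal_def)
  have B: "linear (\<lambda>w. ddX \<phi> u x w \<bullet> \<nu> (\<phi> u))" "linear (\<lambda>x. ddX \<phi> u x w \<bullet> \<nu> (\<phi> u))" for x w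
    using linear_compose[OF ddX_linear[OF chart u] bounded_linear.linear[OF bounded_linear_inner_left]]
      linear_compose[OF ddX_linear_left[OF chart u] bounded_linear.linear[OF bounded_linear_inner_left]]
    by (simp_all add: o_def)
  \<comment> \<open>The description asks for a smooth frame near the point. One exists by
    Gram-Schmidt, and its trace at \<open>u\<close> agrees with that of the given vectors.\<close>
  obtain e :: "'n \<Rightarrow> real^'n \<Rightarrow> real^'n" where e: "\<And>i k. Ck_on k (e i) U"
    "\<And>u i j. u \<in> U \<Longrightarrow> dX \<phi> u (e i u) \<bullet> dX \<phi> u (e j u) = (if i = j then 1 else 0)"
    using smooth_orthonormal_frame[of U "dX \<phi>", OF chart_open[OF chart] dX_linear[OF chart] dX_inj[OF chart] dX_smooth[OF chart]]
    by metis
  have "frechet_derivative (frame_field F \<phi> e i) (at u) (e i u) \<bullet> \<nu> (\<phi> u) = ddX \<phi> u (e i u) (e i u) \<bullet> \<nu> (\<phi> u)" for i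
    by (rule frame_field_derivative[OF chart chart_open[OF chart] subset_refl u _ \<nu>_dX])
       (simp add: smooth_on_def e)
  moreover have "(\<Sum>i\<in>UNIV. ddX \<phi> u (v i) (v i) \<bullet> \<nu> (\<phi> u)) = (\<Sum>i\<in>UNIV. ddX \<phi> u (e i u) (e i u) \<bullet> \<nu> (\<phi> u))"
    using frame_trace_independent[OF dX_linear[OF chart u], where B = "\<lambda>x w. ddX \<phi> u x w \<bullet> \<nu> (\<phi> u)"
        and v = v and w = "\<lambda>i. e i u"] v e(2)[OF u] B by simp
  moreover have "orthonormal_frame_on U F \<phi> e"
    using e by (simp add: orthonormal_frame_on_def smooth_on_def frame_field_def dX_def)
  ultimately show "\<exists>U' \<phi>' W v' u'. (U', \<phi>') \<in> A \<and> open W \<and> W \<subseteq> U' \<and> u' \<in> W \<and> \<phi>' u' = \<phi> u \<and>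
      orthonormal_frame_on W F \<phi>' v' \<and> - (\<Sum>i\<in>UNIV. ddX \<phi> u (v i) (v i) \<bullet> \<nu> (\<phi> u)) =
      - (\<Sum>i\<in>UNIV. frechet_derivative (frame_field F \<phi>' v' i) (at u') (v' i u') \<bullet> \<nu> (\<phi> u))"
    using chart chart_open[OF chart] u by (intro exI[of _ U] exI[of _ \<phi>] exI[of _ e] exI[of _ u]) auto
  fix h
  assume "\<exists>U' \<phi>' W v' u'. (U', \<phi>') \<in> A \<and> open W \<and> W \<subseteq> U' \<and> u' \<in> W \<and> \<phi>' u' = \<phi> u \<and>
      orthonormal_frame_on W F \<phi>' v' \<and>
      h = - (\<Sum>i\<in>UNIV. frechet_derivative (frame_field F \<phi>' v' i) (at u') (v' i u') \<bullet> \<nu> (\<phi> u))"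
  then obtain U' \<phi>' W v' u' where 1: "(U', \<phi>') \<in> A" "open W" "W \<subseteq> U'" "u' \<in> W" "\<phi>' u' = \<phi> u"
     "orthonormal_frame_on W F \<phi>' v'"
     "h = - (\<Sum>i\<in>UNIV. frechet_derivative (frame_field F \<phi>' v' i) (at u') (v' i u') \<bullet> \<nu> (\<phi> u))"
    by blast
  have u': "u' \<in> U'" "u' \<in> U' \<inter> \<phi>' -` (\<phi> ` U)"
    using 1 u by auto
  have t: "(inv_into U \<phi> \<circ> \<phi>') u' = u"
    using 1(5) inv_into_f_f[OF chart_inj[OF chart] u] by simp
  let ?D = "frechet_derivative (inv_into U \<phi> \<circ> \<phi>') (at u')"
  have "\<nu> (\<phi> u) \<bullet> dX \<phi>' u' w = 0" for w
    using \<nu> tangent_space_dX[OF 1(1) u'(1)] 1(5) by (simp add: unit_normal_def)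
  then have "frechet_derivative (frame_field F \<phi>' v' i) (at u') (v' i u') \<bullet> \<nu> (\<phi> u)
      = ddX \<phi>' u' (v' i u') (v' i u') \<bullet> \<nu> (\<phi> u)" for i
    using 1 by (intro frame_field_derivative[OF 1(1)]) (auto simp: orthonormal_frame_on_def)
  \<comment> \<open>Uniqueness: the competing frame is carried into the chart \<open>\<phi>\<close>
    by the differential of the transition map, where the traces can be compared.\<close>
  then have h: "h = - (\<Sum>i\<in>UNIV. ddX \<phi> u (?D (v' i u')) (?D (v' i u')) \<bullet> \<nu> (\<phi> u))"
    using ddX_transition[OF 1(1) chart u'(2)] \<nu>_dX 1(7) unfolding t by simp
  have "dX \<phi> u (?D (v' i u')) \<bullet> dX \<phi> u (?D (v' j u')) = (if i = j then 1 else 0)" for i j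
    using dX_transition[OF 1(1) chart u'(2)] 1(4,6) unfolding t
    by (auto simp: orthonormal_frame_on_def frame_field_def dX_def)
  then show "h = - (\<Sum>i\<in>UNIV. ddX \<phi> u (v i) (v i) \<bullet> \<nu> (\<phi> u))"
    unfolding h
    using frame_trace_independent[OF dX_linear[OF chart u], where B = "\<lambda>x w. ddX \<phi> u x w \<bullet> \<nu> (\<phi> u)"
        and v = "\<lambda>i. ?D (v' i u')" and w = v] v B by simp
qed

end

section \<open>Gradient and Laplacian of the potential on a self-shrinker\<close>

locale shrinker = immersion A F
  for A :: "('n::finite, 's::{t2_space,second_countable_topology}) param set"
    and F :: "'s \<Rightarrow> real^'k::finite" +
  fixes \<nu> :: "'s \<Rightarrow> real^'k"
  assumes shrinker: "self_shrinker A F \<nu>"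
begin

abbreviation H :: "'s \<Rightarrow> real"
  where "H p \<equiv> mean_curvature A F \<nu> p"

lemma \<nu>: "unit_normal A F \<nu>" and H_eq: "H p = (F p \<bullet> \<nu> p) / 2"
  and dims: "CARD('k) = CARD('n) + 1"
  using shrinker by (auto simp: self_shrinker_def immersed_hypersurface_def)

definition potential :: "'s \<Rightarrow> real"
  where "potential p = (F p \<bullet> F p) / 4"

text \<open>The gradient of the potential, which is half the tangential part of the position vector,
  in the coordinates of a chart.\<close>

definition grad :: "(real^'n \<Rightarrow> 's) \<Rightarrow> real^'n \<Rightarrow> real^'n"
  where "grad \<phi> u = (SOME \<xi>. \<forall>w. dX \<phi> u \<xi> \<bullet> dX \<phi> u w = (F (\<phi> u) \<bullet> dX \<phi> u w) / 2)"

abbreviation vol_density :: "(real^'n \<Rightarrow> 's) \<Rightarrow> real^'n \<Rightarrow> real"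
  where "vol_density \<phi> u \<equiv> sqrt (det (metric_matrix F \<phi> u))"

context
  fixes U \<phi>
  assumes chart: "(U, \<phi>) \<in> A"
begin

lemma \<nu>_dX: "u \<in> U \<Longrightarrow> \<nu> (\<phi> u) \<bullet> dX \<phi> u w = 0" and \<nu>_unit: "norm (\<nu> p) = 1"
  using \<nu> tangent_space_dX[OF chart] by (auto simp: unit_normal_def)

text \<open>The explicit sum is the witness that gives the choice in \<open>grad\<close> its
  meaning. With a smooth frame it also shows that the coordinates of the gradient are
  smooth.\<close>

lemma grad_frame:
  fixes v :: "'n \<Rightarrow> real^'n"
  assumes u: "u \<in> U" and v: "\<And>i j. dX \<phi> u (v i) \<bullet> dX \<phi> u (v j) = (if i = j then 1 else 0)"
  shows "dX \<phi> u (grad \<phi> u) \<bullet> dX \<phi> u w = (F (\<phi> u) \<bullet> dX \<phi> u w) / 2"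
    and "grad \<phi> u = (\<Sum>i\<in>UNIV. (F (\<phi> u) \<bullet> dX \<phi> u (v i) / 2) *\<^sub>R v i)"
proof -
  note lin = dX_linear[OF chart u]
  let ?g = "\<Sum>i\<in>UNIV. (F (\<phi> u) \<bullet> dX \<phi> u (v i) / 2) *\<^sub>R v i"
  have "dX \<phi> u ?g \<bullet> dX \<phi> u w = (F (\<phi> u) \<bullet> dX \<phi> u w) / 2" for w
  proof -
    have "dX \<phi> u w = (\<Sum>i\<in>UNIV. (dX \<phi> u w \<bullet> dX \<phi> u (v i)) *\<^sub>R dX \<phi> u (v i))"
      using arg_cong[OF frame_expansion[OF lin v, of w], of "dX \<phi> u"]
      by (simp add: linear_sum[OF lin] linear_scale[OF lin])
    then have "F (\<phi> u) \<bullet> dX \<phi> u w =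
      F (\<phi> u) \<bullet> (\<Sum>i\<in>UNIV. (dX \<phi> u w \<bullet> dX \<phi> u (v i)) *\<^sub>R dX \<phi> u (v i))"
      by simp
    also have "\<dots> = (\<Sum>i\<in>UNIV. (F (\<phi> u) \<bullet> dX \<phi> u (v i)) * (dX \<phi> u (v i) \<bullet> dX \<phi> u w))"
      by (simp add: inner_sum_right inner_commute mult.commute)
    finally show ?thesis
      by (simp add: linear_sum[OF lin] linear_scale[OF lin] inner_sum_left sum_divide_distrib)
  qed
  then have ex: "\<exists>\<xi>. \<forall>w. dX \<phi> u \<xi> \<bullet> dX \<phi> u w = (F (\<phi> u) \<bullet> dX \<phi> u w) / 2"
    by blast
  show g: "dX \<phi> u (grad \<phi> u) \<bullet> dX \<phi> u w = (F (\<phi> u) \<bullet> dX \<phi> u w) / 2" for w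
    using someI_ex[OF ex] by (simp add: grad_def)
  show "grad \<phi> u = ?g"
    by (subst frame_expansion[OF lin v]) (simp add: g)
qed

lemma grad_inner:
  assumes u: "u \<in> U"
  shows "dX \<phi> u (grad \<phi> u) \<bullet> dX \<phi> u w = (F (\<phi> u) \<bullet> dX \<phi> u w) / 2"
  using linear_orthonormal_frame[OF dX_linear[OF chart u] dX_inj[OF chart u]] grad_frame(1)[OF u]
  by metis

lemma grad_unique:
  assumes u: "u \<in> U" and x: "\<And>w. dX \<phi> u x \<bullet> dX \<phi> u w = (F (\<phi> u) \<bullet> dX \<phi> u w) / 2"
  shows "grad \<phi> u = x"
proof -
  have "dX \<phi> u (grad \<phi> u) \<bullet> dX \<phi> u w = dX \<phi> u x \<bullet> dX \<phi> u w" for w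
    by (simp add: grad_inner[OF u] x)
  then have "(dX \<phi> u (grad \<phi> u) - dX \<phi> u x) \<bullet> (dX \<phi> u (grad \<phi> u) - dX \<phi> u x) = 0"
    by (simp add: inner_diff_left inner_diff_right)
  then show ?thesis
    using dX_inj[OF chart u] by (simp add: inj_def)
qed

text \<open>Removing the tangential part from the position vector leaves a multiple of the normal,
  and the self-shrinker equation identifies the coefficient.\<close>

lemma position_decomposition:
  assumes u: "u \<in> U"
  shows "F (\<phi> u) = 2 *\<^sub>R dX \<phi> u (grad \<phi> u) + (2 * H (\<phi> u)) *\<^sub>R \<nu> (\<phi> u)"
proof -
  let ?y = "F (\<phi> u) - 2 *\<^sub>R dX \<phi> u (grad \<phi> u)"
  have "?y = (?y \<bullet> \<nu> (\<phi> u)) *\<^sub>R \<nu> (\<phi> u)"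
    by (rule normal_component[OF dims dX_linear[OF chart u] dX_inj[OF chart u] \<nu>_unit \<nu>_dX[OF u]])
       (simp add: inner_diff_left grad_inner[OF u])
  moreover have "?y \<bullet> \<nu> (\<phi> u) = 2 * H (\<phi> u)"
    using \<nu>_dX[OF u] by (simp add: inner_diff_left inner_diff_right H_eq inner_commute)
  ultimately show ?thesis
    by (simp add: algebra_simps)
qed

text \<open>Pythagoras in the decomposition of the position vector. It is the source of
  \<open>H_square_le_potential\<close> and of the continuity of \<open>H\<^sup>2\<close>.\<close>

lemma grad_norm:
  assumes u: "u \<in> U"
  shows "dX \<phi> u (grad \<phi> u) \<bullet> dX \<phi> u (grad \<phi> u) = potential (\<phi> u) - (H (\<phi> u))\<^sup>2"
proof -
  let ?t = "dX \<phi> u (grad \<phi> u)"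
  have "F (\<phi> u) \<bullet> F (\<phi> u) = (2 *\<^sub>R ?t + (2 * H (\<phi> u)) *\<^sub>R \<nu> (\<phi> u)) \<bullet> (2 *\<^sub>R ?t + (2 * H (\<phi> u)) *\<^sub>R \<nu> (\<phi> u))"
    using position_decomposition[OF u] by simp
  also have "\<dots> = 4 * (?t \<bullet> ?t) + 4 * (H (\<phi> u))\<^sup>2 * (\<nu> (\<phi> u) \<bullet> \<nu> (\<phi> u))"
    using \<nu>_dX[OF u, of "grad \<phi> u"]
    by (simp add: inner_add_left inner_add_right inner_commute power2_eq_square)
  also have "\<nu> (\<phi> u) \<bullet> \<nu> (\<phi> u) = 1"
    using \<nu>_unit[of "\<phi> u"] by (simp add: dot_square_norm)
  finally show ?thesis
    by (simp add: potential_def field_simps)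
qed

lemma grad_smooth: "Ck_on k (grad \<phi>) U"
proof -
  note U = chart_open[OF chart]
  obtain e :: "'n \<Rightarrow> real^'n \<Rightarrow> real^'n" where e: "\<And>i k. Ck_on k (e i) U"
    "\<And>u i j. u \<in> U \<Longrightarrow> dX \<phi> u (e i u) \<bullet> dX \<phi> u (e j u) = (if i = j then 1 else 0)"
    using smooth_orthonormal_frame[of U "dX \<phi>", OF U dX_linear[OF chart] dX_inj[OF chart] dX_smooth[OF chart]]
    by metis
  have "Ck_on k (\<lambda>u. \<Sum>i\<in>UNIV. (((F \<circ> \<phi>) u \<bullet> dX \<phi> u (e i u)) * (1/2)) *\<^sub>R e i u) U"
    by (intro Ck_on_sum Ck_on_scaleR Ck_on_mult Ck_on_inner X_smooth[OF chart] e Ck_on_const U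
        Ck_on_linear_family[OF U dX_linear[OF chart] dX_smooth[OF chart] e(1)]) auto
  then show ?thesis
    using grad_frame(2)[OF _ e(2)] by (subst Ck_on_cong[OF U]) auto
qed

lemma vol_density_smooth: "Ck_on 1 (vol_density \<phi>) U"
proof -
  note U = chart_open[OF chart]
  have "Ck_on 1 (\<lambda>u. \<Sum>p | p permutes (UNIV :: 'n set). of_int (sign p) * (\<Prod>i\<in>UNIV. metric_matrix F \<phi> u $ i $ p i)) U"
  proof (intro Ck_on_sum Ck_on_mult Ck_on_const U)
    fix p :: "'n \<Rightarrow> 'n"
    have "Ck_on 1 (\<lambda>u. \<Prod>i\<in>I. metric_matrix F \<phi> u $ i $ p i) U" for I
      using finite[of I]
    proof (induction I rule: finite_induct)
      case (insert i I)
      have "Ck_on 1 (\<lambda>u. metric_matrix F \<phi> u $ i $ p i) U"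
        using Ck_on_inner[OF dX_smooth[OF chart] dX_smooth[OF chart] U]
        by (simp add: metric_matrix_gram[OF chart] gram_def del: Ck_on.simps)
      with insert Ck_on_mult[OF _ _ U] show ?case
        by (simp del: Ck_on.simps One_nat_def)
    qed (simp del: Ck_on.simps One_nat_def)
    then show "Ck_on 1 (\<lambda>u. \<Prod>i\<in>UNIV. metric_matrix F \<phi> u $ i $ p i) U" .
  qed (simp add: finite_permutations)
  then have d: "Ck_on 1 (\<lambda>u. det (metric_matrix F \<phi> u)) U"
    by (simp add: det_def del: Ck_on.simps One_nat_def)
  have "Ck_on 1 (\<lambda>u. det (metric_matrix F \<phi> u) powr (1/2)) U"
    by (rule Ck_on_compose[OF Ck_on_powr d U]) (use det_metric_pos[OF chart] in auto)
  moreover have "det (metric_matrix F \<phi> u) powr (1/2) = vol_density \<phi> u" if "u \<in> U" for u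
    using det_metric_pos[OF chart that] by (simp add: powr_half_sqrt)
  then have "Ck_on 1 (\<lambda>u. det (metric_matrix F \<phi> u) powr (1/2)) U \<longleftrightarrow> Ck_on 1 (vol_density \<phi>) U"
    by (rule Ck_on_cong[OF U])
  ultimately show ?thesis
    by blast
qed

text \<open>The Laplacian of the potential, multiplied by the volume density. The defining relation
  of \<open>grad\<close> is differentiated along a frame; the tangential second derivatives cancel,
  and the normal ones sum to \<open>- H\<close> by \<open>mean_curvature_frame\<close>.\<close>

lemma divergence_grad:
  assumes u: "u \<in> U"
  shows "(\<Sum>j\<in>UNIV. frechet_derivative (\<lambda>x. vol_density \<phi> x * grad \<phi> x $ j) (at u) (axis j 1)) =
    vol_density \<phi> u * (CARD('n) / 2 - (H (\<phi> u))\<^sup>2)"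
proof -
  note U = chart_open[OF chart] and lin = dX_linear[OF chart] and ddX = dX_has_derivative[OF chart u]
  obtain v :: "'n \<Rightarrow> real^'n" where v: "\<And>i j. dX \<phi> u (v i) \<bullet> dX \<phi> u (v j) = (if i = j then 1 else 0)"
    using linear_orthonormal_frame[OF lin[OF u] dX_inj[OF chart u]] by blast
  let ?w = "vol_density \<phi> u" and ?\<xi> = "grad \<phi> u"
  let ?w' = "\<lambda>d. ?w * (\<Sum>i\<in>UNIV. ddX \<phi> u (v i) d \<bullet> dX \<phi> u (v i))"
  have w': "(vol_density \<phi> has_derivative ?w') (at u)"
    using has_derivative_sqrt_det_gram[OF U u lin ddX v] by (simp add: metric_matrix_gram[OF chart])
  define \<xi>' where "\<xi>' = frechet_derivative (grad \<phi>) (at u)"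
  have \<xi>': "(grad \<phi> has_derivative \<xi>') (at u)"
    unfolding \<xi>'_def using grad_smooth[of 1] u by (auto intro: differentiable_has_frechet_derivative)
  have "((\<lambda>x. vol_density \<phi> x * grad \<phi> x $ j) has_derivative
      (\<lambda>d. ?w * \<xi>' d $ j + ?w' d * ?\<xi> $ j)) (at u)" for j
    by (intro has_derivative_mult w' bounded_linear.has_derivative[OF bounded_linear_vec_nth \<xi>'])
  note fd = frechet_derivative_eqI[OF this]
  have "(\<Sum>j\<in>UNIV. frechet_derivative (\<lambda>x. vol_density \<phi> x * grad \<phi> x $ j) (at u) (axis j 1)) =
     ?w * (\<Sum>j\<in>UNIV. \<xi>' (axis j 1) $ j) + (\<Sum>j\<in>UNIV. ?\<xi> $ j * ?w' (axis j 1))"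
    unfolding fd sum.distrib sum_distrib_left[of ?w "\<lambda>j. \<xi>' (axis j 1) $ j" UNIV] by (simp add: mult.commute)
  also have "(\<Sum>j\<in>UNIV. ?\<xi> $ j * ?w' (axis j 1)) = ?w' ?\<xi>"
    using linear_axis_expansion[OF has_derivative_linear[OF w'], of ?\<xi>] by simp
  also have "(\<Sum>j\<in>UNIV. \<xi>' (axis j 1) $ j) = (\<Sum>i\<in>UNIV. dX \<phi> u (\<xi>' (v i)) \<bullet> dX \<phi> u (v i))"
    by (rule trace_in_frame[OF lin[OF u] v has_derivative_linear[OF \<xi>']])
  \<comment> \<open>Symmetry of the second derivative turns the change of the density along the
    gradient into derivatives along the frame vectors, to be paired with those of the gradient
    itself.\<close>
  also have "?w * (\<Sum>i\<in>UNIV. dX \<phi> u (\<xi>' (v i)) \<bullet> dX \<phi> u (v i)) + ?w' ?\<xi> =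
     ?w * (\<Sum>i\<in>UNIV. dX \<phi> u (\<xi>' (v i)) \<bullet> dX \<phi> u (v i) + ddX \<phi> u ?\<xi> (v i) \<bullet> dX \<phi> u (v i))"
    by (simp add: sum.distrib distrib_left ddX_sym[OF chart u, of ?\<xi>])
  finally have total: "(\<Sum>j\<in>UNIV. frechet_derivative (\<lambda>x. vol_density \<phi> x * grad \<phi> x $ j) (at u) (axis j 1)) =
     ?w * (\<Sum>i\<in>UNIV. dX \<phi> u (\<xi>' (v i)) \<bullet> dX \<phi> u (v i) + ddX \<phi> u ?\<xi> (v i) \<bullet> dX \<phi> u (v i))" .
  have pointwise: "dX \<phi> u (\<xi>' (v i)) \<bullet> dX \<phi> u (v i) + ddX \<phi> u ?\<xi> (v i) \<bullet> dX \<phi> u (v i) =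
      1/2 + H (\<phi> u) * (ddX \<phi> u (v i) (v i) \<bullet> \<nu> (\<phi> u))" for i
  proof -
    \<comment> \<open>The coordinate vector \<open>v i\<close> is held constant, so orthonormality
      holds only at \<open>u\<close>; that is enough once the derivative has been taken.\<close>
    have l: "((\<lambda>x. dX \<phi> x (grad \<phi> x) \<bullet> dX \<phi> x (v i)) has_derivative
       (\<lambda>d. dX \<phi> u ?\<xi> \<bullet> ddX \<phi> u (v i) d + (dX \<phi> u (\<xi>' d) + ddX \<phi> u ?\<xi> d) \<bullet> dX \<phi> u (v i))) (at u)"
      by (intro has_derivative_inner has_derivative_linear_family[OF U u lin ddX \<xi>'] ddX)
    have "((\<lambda>x. ((F \<circ> \<phi>) x \<bullet> dX \<phi> x (v i)) / 2) has_derivative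
       (\<lambda>d. ((F \<circ> \<phi>) u \<bullet> ddX \<phi> u (v i) d + dX \<phi> u d \<bullet> dX \<phi> u (v i)) / 2)) (at u)"
      by (intro bounded_linear.has_derivative[OF bounded_linear_divide] has_derivative_inner
          X_has_derivative[OF chart u] ddX)
    then have "((\<lambda>x. dX \<phi> x (grad \<phi> x) \<bullet> dX \<phi> x (v i)) has_derivative
       (\<lambda>d. ((F \<circ> \<phi>) u \<bullet> ddX \<phi> u (v i) d + dX \<phi> u d \<bullet> dX \<phi> u (v i)) / 2)) (at u)"
      by (rule has_derivative_transform_within_open[OF _ U u]) (simp add: grad_inner)
    from fun_cong[OF has_derivative_unique[OF l this], of "v i"]
    have "dX \<phi> u (\<xi>' (v i)) \<bullet> dX \<phi> u (v i) + ddX \<phi> u ?\<xi> (v i) \<bullet> dX \<phi> u (v i) =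
       1/2 + (F (\<phi> u) \<bullet> ddX \<phi> u (v i) (v i)) / 2 - dX \<phi> u ?\<xi> \<bullet> ddX \<phi> u (v i) (v i)"
      by (simp add: inner_add_left v)
    \<comment> \<open>The tangential part of the position vector cancels the remaining term with the
      gradient, leaving the normal part of the second derivative.\<close>
    also have "F (\<phi> u) \<bullet> ddX \<phi> u (v i) (v i) = 2 * (dX \<phi> u ?\<xi> \<bullet> ddX \<phi> u (v i) (v i)) +
        2 * H (\<phi> u) * (\<nu> (\<phi> u) \<bullet> ddX \<phi> u (v i) (v i))"
      by (subst position_decomposition[OF u]) (simp add: inner_add_left)
    finally show ?thesis
      by (simp add: inner_commute add_divide_distrib)
  qed
  have "(\<Sum>i\<in>UNIV. 1/2 + H (\<phi> u) * (ddX \<phi> u (v i) (v i) \<bullet> \<nu> (\<phi> u))) =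
     CARD('n) / 2 - H (\<phi> u) * H (\<phi> u)"
  proof -
    have "(\<Sum>i\<in>UNIV. ddX \<phi> u (v i) (v i) \<bullet> \<nu> (\<phi> u)) = - H (\<phi> u)"
      using mean_curvature_frame[OF chart u \<nu> v] by simp
    then show ?thesis
      unfolding sum.distrib sum_distrib_left[symmetric] by simp
  qed
  then show ?thesis
    unfolding total pointwise by (simp add: power2_eq_square)
qed

text \<open>By the product rule \<open>h\<close> is the coordinate divergence of \<open>q\<close>
  times the density times the gradient, so its integral is a sum of integrals of compactly supported
  derivatives.\<close>

lemma chart_integral_divergence:
  fixes q :: "real^'n \<Rightarrow> real"
  assumes q: "Ck_on 1 q U" and C: "compact C" "C \<subseteq> U" "\<And>u. u \<in> U - C \<Longrightarrow> q u = 0"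
  defines "h \<equiv> \<lambda>u. indicator U u * (vol_density \<phi> u *
     (q u * (CARD('n) / 2 - (H (\<phi> u))\<^sup>2) + frechet_derivative q (at u) (grad \<phi> u)))"
  shows "integrable lborel h" "(\<integral>u. h u \<partial>lborel) = 0"
proof -
  note U = chart_open[OF chart]
  \<comment> \<open>The extension by zero is C^1 on the whole space, since \<open>U\<close> and the
    complement of \<open>C\<close> are open, cover everything, and \<open>g\<close> is C^1 on
    each.\<close>
  define g where "g j x = (if x \<in> U then q x * (vol_density \<phi> x * grad \<phi> x $ j) else 0)" for j x
  have wg: "Ck_on 1 (\<lambda>x. vol_density \<phi> x * grad \<phi> x $ j) U" for j
  proof -
    have "Ck_on 1 (\<lambda>x. grad \<phi> x \<bullet> axis j 1) U"
      by (rule Ck_on_inner[OF grad_smooth Ck_on_const U])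
    then show ?thesis
      using Ck_on_mult[OF vol_density_smooth _ U] by (simp add: cart_eq_inner_axis del: Ck_on.simps One_nat_def)
  qed
  have g0: "g j x = 0" if "x \<in> - C" for j x
    using C(3) that by (auto simp: g_def)
  have openC: "open (- C)"
    using compact_imp_closed[OF C(1)] by auto
  have gU: "Ck_on 1 (g j) U" for j
    using Ck_on_mult[OF q wg[of j] U] by (subst Ck_on_cong[OF U, of _ "\<lambda>x. q x * (vol_density \<phi> x * grad \<phi> x $ j)"]) (auto simp: g_def)
  have gC: "Ck_on 1 (g j) (- C)" for j
    by (subst Ck_on_cong[OF openC, of _ "\<lambda>_. 0"]) (auto simp: g0)
  have g: "Ck_on 1 (g j) UNIV" for j
  proof (rule Ck_on_Union)
    fix x :: "real^'n"
    show "\<exists>V. open V \<and> x \<in> V \<and> Ck_on 1 (g j) V"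
      using gU[of j] gC[of j] U openC C(2) by (cases "x \<in> U") blast+
  qed
  have h: "h x = (\<Sum>j\<in>UNIV. frechet_derivative (g j) (at x) (axis j 1))" for x
  proof (cases "x \<in> U")
    case True
    have dq: "q differentiable (at x)" and dw: "(\<lambda>x. vol_density \<phi> x * grad \<phi> x $ j) differentiable (at x)" for j
      using q wg True by auto
    have "frechet_derivative (g j) (at x) = frechet_derivative (\<lambda>x. q x * (vol_density \<phi> x * grad \<phi> x $ j)) (at x)" for j
      by (rule frechet_derivative_cong_open[OF U True]) (simp add: g_def)
    then have fd: "frechet_derivative (g j) (at x) d =
        q x * frechet_derivative (\<lambda>x. vol_density \<phi> x * grad \<phi> x $ j) (at x) d +
        vol_density \<phi> x * (grad \<phi> x $ j *\<^sub>R frechet_derivative q (at x) d)" for j d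
      by (simp add: bounded_bilinear.frechet_derivative_prod[OF bounded_bilinear_mult dq dw])
    have "(\<Sum>j\<in>UNIV. frechet_derivative (g j) (at x) (axis j 1)) =
        q x * (\<Sum>j\<in>UNIV. frechet_derivative (\<lambda>x. vol_density \<phi> x * grad \<phi> x $ j) (at x) (axis j 1)) +
        vol_density \<phi> x * (\<Sum>j\<in>UNIV. (grad \<phi> x $ j) *\<^sub>R frechet_derivative q (at x) (axis j 1))"
      unfolding fd sum.distrib sum_distrib_left ..
    also have "(\<Sum>j\<in>UNIV. (grad \<phi> x $ j) *\<^sub>R frechet_derivative q (at x) (axis j 1)) =
        frechet_derivative q (at x) (grad \<phi> x)"
      by (rule linear_axis_expansion[OF linear_frechet_derivative[OF dq], symmetric])
    also note divergence_grad[OF True]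
    finally show ?thesis
      using True by (simp add: h_def algebra_simps)
  next
    case False
    then have "x \<in> - C" using C by auto
    then have "frechet_derivative (g j) (at x) = frechet_derivative (\<lambda>_. 0) (at x)" for j
      by (intro frechet_derivative_cong_open[OF openC]) (auto simp: g0)
    then show ?thesis
      using False by (simp add: h_def)
  qed
  note D = integral_derivative_eq_0[OF g C(1)]
  have "h = (\<lambda>x. \<Sum>j\<in>UNIV. frechet_derivative (g j) (at x) (axis j 1))"
    using h by blast
  then show "integrable lborel h" "(\<integral>u. h u \<partial>lborel) = 0"
    using D g0 by simp_all
qed

end

end

section \<open>The Riemannian measure\<close>

context immersion
begin

text \<open>The density of the chart pushed forward to the manifold. Outside \<open>U\<close>, where
  the density vanishes, the parametrization is replaced by a constant to obtain a map that is
  measurable everywhere.\<close>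

definition chart_measure :: "(real^'n) set \<Rightarrow> (real^'n \<Rightarrow> 's) \<Rightarrow> 's measure"
  where "chart_measure U \<phi> =
    distr (density lborel (\<lambda>u. ennreal (indicator U u * sqrt (det (metric_matrix F \<phi> u))))) borel
      (\<lambda>u. if u \<in> U then \<phi> u else undefined)"

lemma sets_chart_measure [simp]: "sets (chart_measure U \<phi>) = sets borel"
  by (simp add: chart_measure_def)

lemma space_chart_measure [simp]: "space (chart_measure U \<phi>) = UNIV"
  by (simp add: chart_measure_def)

context
  fixes U \<phi>
  assumes chart: "(U, \<phi>) \<in> A"
begin

lemma chart_extension_measurable:
  "(\<lambda>u. if u \<in> U then \<phi> u else undefined) \<in> borel_measurable borel"
  by (rule borel_measurable_continuous_on_if)
     (use chart_open[OF chart] chart_continuous[OF chart] in auto)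

lemma metric_continuous: "continuous_on U (\<lambda>u. sqrt (det (metric_matrix F \<phi> u)))"
  unfolding metric_matrix_gram[OF chart] det_def gram_def
  using Ck_on_imp_continuous_on[OF dX_smooth[OF chart]] by (auto intro!: continuous_intros)

lemma chart_density_measurable:
  "(\<lambda>u. indicator U u * sqrt (det (metric_matrix F \<phi> u))) \<in> borel_measurable borel"
  using borel_measurable_continuous_on_indicator[OF _ metric_continuous] chart_open[OF chart] by simp

lemma chart_preimage_measurable:
  assumes "S \<in> sets borel"
  shows "U \<inter> \<phi> -` S \<in> sets borel"
proof -
  have "(\<lambda>u. if u \<in> U then \<phi> u else undefined) -` S \<inter> U \<in> sets borel"
    using measurable_sets_borel[OF chart_extension_measurable assms] chart_open[OF chart] by auto
  moreover have "(\<lambda>u. if u \<in> U then \<phi> u else undefined) -` S \<inter> U = U \<inter> \<phi> -` S"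
    by auto
  ultimately show ?thesis by simp
qed

lemma emeasure_chart_measure:
  assumes "S \<in> sets borel"
  shows "emeasure (chart_measure U \<phi>) S =
    (\<integral>\<^sup>+u\<in>U \<inter> \<phi> -` S. ennreal (sqrt (det (metric_matrix F \<phi> u))) \<partial>lborel)"
proof -
  have "emeasure (chart_measure U \<phi>) S =
      (\<integral>\<^sup>+u. ennreal (indicator U u * sqrt (det (metric_matrix F \<phi> u))) *
        indicator ((\<lambda>u. if u \<in> U then \<phi> u else undefined) -` S) u \<partial>lborel)"
    unfolding chart_measure_def
    using assms chart_extension_measurable chart_density_measurable
    by (simp add: emeasure_distr emeasure_density measurable_sets_borel)
  also have "\<dots> = (\<integral>\<^sup>+u\<in>U \<inter> \<phi> -` S. ennreal (sqrt (det (metric_matrix F \<phi> u))) \<partial>lborel)"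
    by (intro nn_integral_cong) (auto simp: indicator_def)
  finally show ?thesis .
qed

end

text \<open>Under a transition map the Gram determinant picks up the square of the Jacobian
  determinant, so its square root transforms exactly as the change of variables formula
  demands.\<close>

lemma chart_measure_compatible:
  assumes c: "(U, \<phi>) \<in> A" "(V, \<eta>) \<in> A" and S: "S \<in> sets borel" "S \<subseteq> \<phi> ` U" "S \<subseteq> \<eta> ` V"
  shows "emeasure (chart_measure U \<phi>) S = emeasure (chart_measure V \<eta>) S"
proof -
  let ?\<tau> = "inv_into V \<eta> \<circ> \<phi>" and ?P = "U \<inter> \<phi> -` S" and ?Q = "V \<inter> \<eta> -` S"
  let ?D = "\<lambda>u. frechet_derivative ?\<tau> (at u)"
  let ?f = "\<lambda>u. indicator V u * sqrt (det (metric_matrix F \<eta> u))"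
  have P: "?P \<subseteq> U \<inter> \<phi> -` (\<eta> ` V)"
    using S by auto
  have tau: "?\<tau> u \<in> V" "\<eta> (?\<tau> u) = \<phi> u" if "u \<in> ?P" for u
    using transition_mem[OF c, of u] transition_eq[OF c, of u] P that by auto
  have im: "?\<tau> ` ?P = ?Q"
  proof
    show "?\<tau> ` ?P \<subseteq> ?Q"
      using tau by auto
    show "?Q \<subseteq> ?\<tau> ` ?P"
    proof
      fix x assume x: "x \<in> ?Q"
      then obtain u where u: "u \<in> U" "\<phi> u = \<eta> x"
        using S(2) by (metis IntD2 imageE in_mono vimageE)
      then have "u \<in> ?P" "?\<tau> u = x"
        using x inv_into_f_f[OF chart_inj[OF c(2)], of x] by auto
      then show "x \<in> ?\<tau> ` ?P" by blast
    qed
  qed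
  have der: "(?\<tau> has_derivative ?D u) (at u)" if "u \<in> ?P" for u
    using P that by (intro differentiable_has_frechet_derivative transition_differentiable[OF c]) auto
  have dens: "\<bar>det (matrix (?D u))\<bar> * ?f (?\<tau> u) = sqrt (det (metric_matrix F \<phi> u))" if u: "u \<in> ?P" for u
  proof -
    have "dX \<phi> u = (\<lambda>v. dX \<eta> (?\<tau> u) (?D u v))"
      using dX_transition[OF c] P u by blast
    then have "det (metric_matrix F \<phi> u) = (det (matrix (?D u)))\<^sup>2 * det (metric_matrix F \<eta> (?\<tau> u))"
      unfolding metric_matrix_gram[OF c(1)] metric_matrix_gram[OF c(2)]
      using det_gram_compose[OF dX_linear[OF c(2) tau(1)[OF u]], of "?D u"] by simp
    then show ?thesis
      using tau(1)[OF u] by (simp add: real_sqrt_mult)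
  qed
  have Pm: "?P \<in> sets borel" and Qm: "?Q \<in> sets borel"
    using chart_preimage_measurable c S by auto
  have "emeasure (chart_measure U \<phi>) S = (\<integral>\<^sup>+u\<in>?P. ennreal (sqrt (det (metric_matrix F \<phi> u))) \<partial>lborel)"
    by (rule emeasure_chart_measure[OF c(1) S(1)])
  also have "\<dots> = (\<integral>\<^sup>+u. indicator ?P u * ennreal (\<bar>det (matrix (?D u))\<bar> * ?f (?\<tau> u)) \<partial>lborel)"
    using dens by (intro nn_integral_cong) (auto simp: indicator_def)
  also have "\<dots> = (\<integral>\<^sup>+x. indicator (?\<tau> ` ?P) x * ennreal (?f x) \<partial>lborel)"
  proof (rule nn_integral_change_of_variables[OF Pm der])
    show "inj_on ?\<tau> ?P"
      using transition_inj[OF c] P inj_on_subset by blast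
    show "?\<tau> ` ?P \<in> sets borel"
      unfolding im by (rule Qm)
    show "?f \<in> borel_measurable borel"
      by (rule chart_density_measurable[OF c(2)])
    \<comment> \<open>The transformed density is measurable because on the relevant set it equals
      the density of the other chart.\<close>
    have "(\<lambda>u. ennreal (indicator ?P u * (indicator U u * sqrt (det (metric_matrix F \<phi> u))))) \<in> borel_measurable borel"
      using Pm chart_density_measurable[OF c(1)] by measurable
    moreover have "ennreal (indicator ?P u * (indicator U u * sqrt (det (metric_matrix F \<phi> u)))) =
       indicator ?P u * ennreal (\<bar>det (matrix (?D u))\<bar> * ?f (?\<tau> u))" for u
      using dens[of u] by (auto simp: indicator_def)
    ultimately show "(\<lambda>u. indicator ?P u * ennreal (\<bar>det (matrix (?D u))\<bar> * ?f (?\<tau> u))) \<in> borel_measurable borel"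
      by simp
    show "0 \<le> ?f y" for y
      using det_metric_pos[OF c(2)] by (auto simp: indicator_def intro: less_imp_le)
  qed
  also have "\<dots> = (\<integral>\<^sup>+u\<in>?Q. ennreal (sqrt (det (metric_matrix F \<eta> u))) \<partial>lborel)"
    unfolding im by (intro nn_integral_cong) (auto simp: indicator_def)
  also have "\<dots> = emeasure (chart_measure V \<eta>) S"
    by (rule emeasure_chart_measure[OF c(2) S(1), symmetric])
  finally show ?thesis .
qed

section \<open>Existence and uniqueness of the Riemannian measure\<close>

lemma countable_charts:
  obtains c :: "nat \<Rightarrow> ('n, 's) param" where "\<And>i. c i \<in> A" "(\<Union>i. snd (c i) ` fst (c i)) = UNIV"
proof -
  let ?im = "\<lambda>c :: ('n, 's) param. snd c ` fst c"
  have cover: "(\<Union>c\<in>A. ?im c) = UNIV"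
    using immersed unfolding immersed_hypersurface_def smooth_atlas_def case_prod_beta by blast
  have "\<And>S. S \<in> ?im ` A \<Longrightarrow> open S"
    using chart_image_open by auto
  \<comment> \<open>Second countability enters through Lindelof's theorem, which extracts countably
    many chart images that still cover.\<close>
  then obtain \<F> where \<F>: "\<F> \<subseteq> ?im ` A" "countable \<F>" "\<Union>\<F> = \<Union>(?im ` A)"
    using Lindelof[of "?im ` A" thesis] by blast
  then have ne: "\<F> \<noteq> {}"
    using cover by auto
  have "\<exists>c. c \<in> A \<and> ?im c = from_nat_into \<F> i" for i
  proof -
    have "from_nat_into \<F> i \<in> ?im ` A"
      using from_nat_into[OF ne, of i] \<F>(1) by blast
    then obtain d where "from_nat_into \<F> i = ?im d" "d \<in> A"
      by (rule imageE)
    then show ?thesis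
      by (intro exI[of _ d]) simp
  qed
  then obtain c where c: "\<And>i. c i \<in> A" "\<And>i. ?im (c i) = from_nat_into \<F> i"
    by metis
  have "(\<Union>i. ?im (c i)) = UNIV"
    using range_from_nat_into[OF ne \<F>(2)] \<F>(3) cover by (simp add: c(2))
  then show ?thesis
    using c(1) that by blast
qed

text \<open>Disjoint Borel pieces, each inside one chart, reduce statements about measures on the
  manifold to countable sums of chart measures.\<close>

lemma chart_partition:
  obtains U :: "nat \<Rightarrow> (real^'n) set" and \<phi> :: "nat \<Rightarrow> real^'n \<Rightarrow> 's" and D :: "nat \<Rightarrow> 's set"
  where "\<And>i. (U i, \<phi> i) \<in> A" "\<And>i. D i \<subseteq> \<phi> i ` U i" "\<And>i. D i \<in> sets borel"
    "disjoint_family D" "(\<Union>i. D i) = UNIV"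
proof -
  obtain c :: "nat \<Rightarrow> ('n, 's) param" where c: "\<And>i. c i \<in> A" "(\<Union>i. snd (c i) ` fst (c i)) = UNIV"
    using countable_charts by blast
  let ?B = "\<lambda>i. snd (c i) ` fst (c i)"
  have "(fst (c i), snd (c i)) \<in> A" for i
    using c(1) by simp
  moreover have "?B i \<in> sets borel" for i
    using chart_image_open[OF calculation[of i]] by simp
  then have "disjointed ?B i \<in> sets borel" for i
    using sets.range_disjointed_sets[of ?B borel] by auto
  ultimately show ?thesis
    using that[of "fst \<circ> c" "snd \<circ> c" "disjointed ?B"] disjointed_subset[of ?B] c(2)
      disjoint_family_disjointed[of ?B] UN_disjointed_eq[of ?B] by simp
qed

definition is_volume :: "'s measure \<Rightarrow> bool"
  where "is_volume \<mu> \<longleftrightarrow> sets \<mu> = sets borel \<and>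
       (\<forall>(U, \<phi>)\<in>A. \<forall>S\<in>sets borel. S \<subseteq> \<phi> ` U \<longrightarrow> emeasure \<mu> S = emeasure (chart_measure U \<phi>) S)"

lemma volume_unique:
  assumes "is_volume \<mu>" "is_volume \<mu>'"
  shows "\<mu> = \<mu>'"
proof -
  obtain U :: "nat \<Rightarrow> (real^'n) set" and \<phi> :: "nat \<Rightarrow> real^'n \<Rightarrow> 's" and D :: "nat \<Rightarrow> 's set"
    where c: "\<And>i. (U i, \<phi> i) \<in> A" "\<And>i. D i \<subseteq> \<phi> i ` U i" "\<And>i. D i \<in> sets borel"
    "disjoint_family D" "(\<Union>i. D i) = UNIV"
    using chart_partition by metis
  have *: "emeasure \<mu> S = (\<Sum>i. emeasure (chart_measure (U i) (\<phi> i)) (S \<inter> D i))"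
    if \<mu>: "is_volume \<mu>" and S: "S \<in> sets borel" for \<mu> S
  proof -
    have "emeasure \<mu> (S \<inter> D i) = emeasure (chart_measure (U i) (\<phi> i)) (S \<inter> D i)" for i
    proof -
      have "\<forall>S\<in>sets borel. S \<subseteq> \<phi> i ` U i \<longrightarrow> emeasure \<mu> S = emeasure (chart_measure (U i) (\<phi> i)) S"
        using \<mu> c(1)[of i] unfolding is_volume_def by auto
      moreover have "S \<inter> D i \<in> sets borel" "S \<inter> D i \<subseteq> \<phi> i ` U i"
        using c(2)[of i] c(3)[of i] S by auto
      ultimately show ?thesis by blast
    qed
    moreover have "(\<Sum>i. emeasure \<mu> (S \<inter> D i)) = emeasure \<mu> (\<Union>i. S \<inter> D i)"
      using \<mu> S c(3,4) by (intro suminf_emeasure) (auto simp: is_volume_def disjoint_family_on_def)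
    moreover have "(\<Union>i. S \<inter> D i) = S"
      using c(5) by blast
    ultimately show ?thesis by simp
  qed
  show ?thesis
    using assms *[OF assms(1)] *[OF assms(2)]
    by (intro measure_eqI) (auto simp: is_volume_def)
qed

text \<open>The measure is the sum of the chart measures restricted to the pieces of a partition. On
  a set inside any other chart each summand may be computed in that chart, by compatibility.\<close>

lemma volume_exists: "\<exists>\<mu>. is_volume \<mu>"
proof -
  obtain U :: "nat \<Rightarrow> (real^'n) set" and \<phi> :: "nat \<Rightarrow> real^'n \<Rightarrow> 's" and D :: "nat \<Rightarrow> 's set"
    where c: "\<And>i. (U i, \<phi> i) \<in> A" "\<And>i. D i \<subseteq> \<phi> i ` U i" "\<And>i. D i \<in> sets borel"
    "disjoint_family D" "(\<Union>i. D i) = UNIV"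
    using chart_partition by metis
  let ?M = "\<lambda>i. chart_measure (U i) (\<phi> i)"
  let ?m = "\<lambda>S. \<Sum>i. emeasure (?M i) (S \<inter> D i)"
  define \<mu> where "\<mu> = measure_of UNIV (sets borel) ?m"
  have sets: "sets \<mu> = sets borel"
    unfolding \<mu>_def using sets.sigma_sets_eq[of borel] by (simp add: sets_measure_of)
  have em: "emeasure \<mu> S = ?m S" if "S \<in> sets borel" for S
  proof (rule emeasure_measure_of[OF \<mu>_def])
    show "positive (sets \<mu>) ?m"
      by (simp add: positive_def)
    show "countably_additive (sets \<mu>) ?m"
    proof (rule countably_additiveI)
      fix B :: "nat \<Rightarrow> 's set"
      assume B: "range B \<subseteq> sets \<mu>" "disjoint_family B"
      have eq: "(\<Sum>n. emeasure (?M i) (B n \<inter> D i)) = emeasure (?M i) ((\<Union>n. B n) \<inter> D i)" for i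
      proof -
        have "(\<Sum>n. emeasure (?M i) (B n \<inter> D i)) = emeasure (?M i) (\<Union>n. B n \<inter> D i)"
          using B c(3)[of i] by (intro suminf_emeasure) (auto simp: sets disjoint_family_on_def)
        then show ?thesis by simp
      qed
      \<comment> \<open>The two countable sums are interchanged by reading one of them as an
        integral over counting measure.\<close>
      have "(\<Sum>n. ?m (B n)) = (\<Sum>n. \<integral>\<^sup>+i. emeasure (?M i) (B n \<inter> D i) \<partial>count_space UNIV)"
        by (simp add: nn_integral_count_space_nat)
      also have "\<dots> = (\<integral>\<^sup>+i. (\<Sum>n. emeasure (?M i) (B n \<inter> D i)) \<partial>count_space UNIV)"
        by (rule nn_integral_suminf[symmetric]) simp
      also have "\<dots> = (\<Sum>i. \<Sum>n. emeasure (?M i) (B n \<inter> D i))"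
        by (rule nn_integral_count_space_nat)
      also have "\<dots> = ?m (\<Union>n. B n)"
        by (simp only: eq)
      finally show "(\<Sum>n. ?m (B n)) = ?m (\<Union>n. B n)" .
    qed
    show "S \<in> sets \<mu>"
      using that sets by simp
  qed simp
  have "emeasure \<mu> S = emeasure (chart_measure V \<eta>) S"
    if V: "(V, \<eta>) \<in> A" and S: "S \<in> sets borel" "S \<subseteq> \<eta> ` V" for V \<eta> S
  proof -
    have "emeasure (?M i) (S \<inter> D i) = emeasure (chart_measure V \<eta>) (S \<inter> D i)" for i
      using c(2)[of i] c(3)[of i] S by (intro chart_measure_compatible[OF c(1) V]) auto
    moreover have "(\<Sum>i. emeasure (chart_measure V \<eta>) (S \<inter> D i)) = emeasure (chart_measure V \<eta>) (\<Union>i. S \<inter> D i)"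
      using S c(3) by (intro suminf_emeasure disjoint_family_subset[OF c(4)]) auto
    moreover have "(\<Union>i. S \<inter> D i) = S"
      using c(5) by blast
    ultimately show ?thesis
      using em[OF S(1)] by simp
  qed
  then have "is_volume \<mu>"
    using sets by (auto simp: is_volume_def)
  then show ?thesis ..
qed

abbreviation vol :: "'s measure"
  where "vol \<equiv> riemannian_volume A F"

lemma is_volume_vol: "is_volume vol"
proof -
  have "is_volume \<mu> \<longleftrightarrow> sets \<mu> = sets borel \<and>
       (\<forall>(U, \<phi>)\<in>A. \<forall>S\<in>sets borel. S \<subseteq> \<phi> ` U \<longrightarrow>
          emeasure \<mu> S =
            (\<integral>\<^sup>+u\<in>U \<inter> \<phi> -` S. ennreal (sqrt (det (metric_matrix F \<phi> u))) \<partial>lborel))" for \<mu>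
    unfolding is_volume_def using emeasure_chart_measure by (auto simp: split_beta)
  then have "vol = (THE \<mu>. is_volume \<mu>)"
    unfolding riemannian_volume_def by simp
  moreover have "\<exists>!\<mu>. is_volume \<mu>"
    using volume_exists volume_unique by blast
  ultimately show ?thesis
    using theI' by metis
qed

lemma sets_vol [simp, measurable_cong]: "sets vol = sets borel"
  using is_volume_vol by (simp add: is_volume_def)

lemma space_vol [simp]: "space vol = UNIV"
  using sets_eq_imp_space_eq[OF sets_vol] by simp

lemma emeasure_vol:
  "(U, \<phi>) \<in> A \<Longrightarrow> S \<in> sets borel \<Longrightarrow> S \<subseteq> \<phi> ` U \<Longrightarrow> emeasure vol S = emeasure (chart_measure U \<phi>) S"
  using is_volume_vol by (auto simp: is_volume_def)

section \<open>Integration within a chart\<close>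

context
  fixes U \<phi>
  assumes chart: "(U, \<phi>) \<in> A"
begin

lemma density_vol: "density vol (\<lambda>p. ennreal (indicator (\<phi> ` U) p)) = chart_measure U \<phi>"
proof (rule measure_eqI)
  have im: "\<phi> ` U \<in> sets borel"
    using chart_image_open[OF chart] by simp
  fix S assume "S \<in> sets (density vol (\<lambda>p. ennreal (indicator (\<phi> ` U) p)))"
  then have S: "S \<in> sets borel" by simp
  have "emeasure (density vol (\<lambda>p. ennreal (indicator (\<phi> ` U) p))) S =
     (\<integral>\<^sup>+p. ennreal (indicator (\<phi> ` U) p) * indicator S p \<partial>vol)"
    by (rule emeasure_density) (use S im in auto)
  also have "\<dots> = (\<integral>\<^sup>+p. indicator (S \<inter> \<phi> ` U) p \<partial>vol)"
    by (rule nn_integral_cong) (auto simp: indicator_def)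
  also have "\<dots> = emeasure vol (S \<inter> \<phi> ` U)"
    using S im by (subst nn_integral_indicator) auto
  also have "\<dots> = emeasure (chart_measure U \<phi>) (S \<inter> \<phi> ` U)"
    using S im by (intro emeasure_vol[OF chart]) auto
  also have "\<dots> = emeasure (chart_measure U \<phi>) S"
    using S im by (simp add: emeasure_chart_measure[OF chart]) (auto intro!: nn_integral_cong simp: indicator_def)
  finally show "emeasure (density vol (\<lambda>p. ennreal (indicator (\<phi> ` U) p))) S = emeasure (chart_measure U \<phi>) S" .
qed simp

lemma chart_integral:
  fixes h :: "'s \<Rightarrow> real"
  assumes h: "h \<in> borel_measurable borel" and off: "\<And>p. p \<notin> \<phi> ` U \<Longrightarrow> h p = 0"
  defines "k \<equiv> \<lambda>u. indicator U u * (sqrt (det (metric_matrix F \<phi> u)) * h (\<phi> u))"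
  shows "integrable vol h \<longleftrightarrow> integrable lborel k" "(\<integral>p. h p \<partial>vol) = (\<integral>u. k u \<partial>lborel)"
proof -
  let ?e = "\<lambda>u. if u \<in> U then \<phi> u else undefined"
  let ?d = "\<lambda>u. indicator U u * sqrt (det (metric_matrix F \<phi> u))"
  note e = chart_extension_measurable[OF chart] and d = chart_density_measurable[OF chart]
  have im: "\<phi> ` U \<in> sets borel"
    using chart_image_open[OF chart] by simp
  have d0: "0 \<le> ?d u" for u
    using det_metric_pos[OF chart] by (auto simp: indicator_def intro: less_imp_le)
  have he: "(\<lambda>u. h (?e u)) \<in> borel_measurable borel"
    using measurable_compose[OF e h] .
  have ind: "(\<lambda>p. indicator (\<phi> ` U) p *\<^sub>R h p) = h"
    using off by (auto simp: indicator_def fun_eq_iff)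
  have k: "(\<lambda>u. ?d u *\<^sub>R h (?e u)) = k"
    by (auto simp: k_def indicator_def fun_eq_iff)
  have "integrable vol h \<longleftrightarrow> integrable (density vol (\<lambda>p. ennreal (indicator (\<phi> ` U) p))) h"
    using h im by (subst integrable_density) (auto simp: ind[unfolded scaleR_conv_of_real, simplified])
  also have "\<dots> \<longleftrightarrow> integrable (density lborel (\<lambda>u. ennreal (?d u))) (\<lambda>u. h (?e u))"
    unfolding density_vol chart_measure_def using e h by (subst integrable_distr_eq) auto
  also have "\<dots> \<longleftrightarrow> integrable lborel k"
    unfolding k[symmetric] using d d0 he by (subst integrable_density) auto
  finally show "integrable vol h \<longleftrightarrow> integrable lborel k" .
  have "(\<integral>p. h p \<partial>vol) = (\<integral>p. h p \<partial>(density vol (\<lambda>p. ennreal (indicator (\<phi> ` U) p))))"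
    using h im by (subst integral_density) (auto simp: ind[unfolded scaleR_conv_of_real, simplified])
  also have "\<dots> = (\<integral>u. h (?e u) \<partial>(density lborel (\<lambda>u. ennreal (?d u))))"
    unfolding density_vol chart_measure_def using e h by (subst integral_distr) auto
  also have "\<dots> = (\<integral>u. k u \<partial>lborel)"
    unfolding k[symmetric] using d d0 he by (subst integral_density) auto
  finally show "(\<integral>p. h p \<partial>vol) = (\<integral>u. k u \<partial>lborel)" .
qed

text \<open>The density is positive and nonempty open sets of Euclidean space are not negligible.
  This is what later forces a continuous nonnegative function with integral 0 to vanish.\<close>

lemma vol_open_pos:
  assumes W: "open W" "W \<noteq> {}" "W \<subseteq> \<phi> ` U"
  shows "emeasure vol W > 0"
proof -
  let ?P = "U \<inter> \<phi> -` W"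
  let ?d = "\<lambda>u. ennreal (sqrt (det (metric_matrix F \<phi> u)))"
  have P: "open ?P" "?P \<noteq> {}"
    using continuous_open_preimage[OF chart_continuous[OF chart] chart_open[OF chart] W(1)] W by auto
  have Pm: "?P \<in> sets borel"
    using P(1) by simp
  have dm: "(\<lambda>u. ?d u * indicator ?P u) \<in> borel_measurable lborel"
  proof -
    have "(\<lambda>u. ennreal (indicator ?P u * (indicator U u * sqrt (det (metric_matrix F \<phi> u))))) \<in> borel_measurable borel"
      using Pm chart_density_measurable[OF chart] by measurable
    moreover have "ennreal (indicator ?P u * (indicator U u * sqrt (det (metric_matrix F \<phi> u)))) = ?d u * indicator ?P u" for u
      by (auto simp: indicator_def)
    ultimately show ?thesis by simp
  qed
  have "emeasure vol W = (\<integral>\<^sup>+u\<in>?P. ?d u \<partial>lborel)"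
    using emeasure_vol[OF chart _ W(3)] emeasure_chart_measure[OF chart, of W] W(1) by simp
  moreover have "(\<integral>\<^sup>+u\<in>?P. ?d u \<partial>lborel) \<noteq> 0"
  proof
    assume "(\<integral>\<^sup>+u\<in>?P. ?d u \<partial>lborel) = 0"
    then have "AE u in lborel. ?d u * indicator ?P u = 0"
      using nn_integral_0_iff_AE[OF dm] by simp
    then have "AE u in lborel. u \<notin> ?P"
    proof eventually_elim
      case (elim u)
      then show ?case
        using det_metric_pos[OF chart, of u] by (auto simp: indicator_def split: if_splits)
    qed
    then have "?P \<in> null_sets lborel"
      using P(1) by (subst (asm) AE_iff_null_sets[symmetric]) auto
    then have "negligible ?P"
      by (simp add: negligible_iff_null_sets null_sets_completionI)
    then show False
      using open_not_negligible P by blast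
  qed
  ultimately show ?thesis
    by (simp add: zero_less_iff_neq_zero)
qed

end

end

section \<open>Integration by parts on the hypersurface\<close>

text \<open>The squared positive part is the C^1 cut-off behind the bump functions, the test
  function and its modification near 0.\<close>

lemma square_pos_has_derivative: "((\<lambda>t::real. (max 0 t)\<^sup>2) has_real_derivative 2 * max 0 t) (at t)"
proof -
  have 1: "((\<lambda>t::real. (max 0 t)\<^sup>2) has_real_derivative 2 * max 0 t) (at t)" if "t > 0"
    by (rule has_field_derivative_transform_within_open[of "\<lambda>t. t\<^sup>2" _ _ "{0<..}"])
       (use that in \<open>auto intro!: derivative_eq_intros\<close>)
  have 2: "((\<lambda>t::real. (max 0 t)\<^sup>2) has_real_derivative 2 * max 0 t) (at t)" if "t < 0"
    by (rule has_field_derivative_transform_within_open[of "\<lambda>t. 0" _ _ "{..<0}"])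
       (use that in \<open>auto intro!: derivative_eq_intros\<close>)
  have 3: "((\<lambda>t::real. (max 0 t)\<^sup>2) has_real_derivative 0) (at 0)"
  proof -
    have "((\<lambda>h::real. (max 0 h)\<^sup>2 / h) \<longlongrightarrow> 0) (at 0)"
    proof (rule Lim_null_comparison)
      show "\<forall>\<^sub>F h in at 0. norm ((max 0 h)\<^sup>2 / h) \<le> \<bar>h::real\<bar>"
        by (intro always_eventually) (auto simp: max_def power2_eq_square)
    qed (auto intro!: tendsto_eq_intros)
    then show ?thesis
      by (simp add: DERIV_def)
  qed
  show ?thesis
    using 1 2 3 by (cases t "0::real" rule: linorder_cases) auto
qed

lemma Ck_on_real_derivative:
  assumes d: "\<And>t. (\<theta> has_real_derivative \<theta>' t) (at t)" and c: "continuous_on UNIV \<theta>'"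
  shows "Ck_on 1 \<theta> UNIV"
proof -
  have "frechet_derivative \<theta> (at t) v = \<theta>' t * v" for t v
    using frechet_derivative_eqI[OF d[unfolded has_field_derivative_def]] by simp
  moreover have "\<theta> differentiable (at t)" for t
    using d real_differentiable_def by blast
  ultimately show ?thesis
    using c by (auto intro!: continuous_intros)
qed

lemma Ck_on_square_pos: "Ck_on 1 (\<lambda>t::real. (max 0 t)\<^sup>2) UNIV"
  by (rule Ck_on_real_derivative[OF square_pos_has_derivative]) (intro continuous_intros)

context immersion
begin

definition C1 :: "('s \<Rightarrow> real) \<Rightarrow> bool"
  where "C1 q \<longleftrightarrow> (\<forall>(U, \<phi>)\<in>A. Ck_on 1 (\<lambda>u. q (\<phi> u)) U)"

lemma C1D: "C1 q \<Longrightarrow> (U, \<phi>) \<in> A \<Longrightarrow> Ck_on 1 (\<lambda>u. q (\<phi> u)) U"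
  by (auto simp: C1_def simp del: Ck_on.simps One_nat_def)

lemma C1_differentiable: "C1 q \<Longrightarrow> (U, \<phi>) \<in> A \<Longrightarrow> u \<in> U \<Longrightarrow> (\<lambda>u. q (\<phi> u)) differentiable (at u)"
  using C1D by fastforce

lemma chart_at: obtains U \<phi> u where "(U, \<phi>) \<in> A" "u \<in> U" "p = \<phi> u"
proof -
  have "p \<in> (\<Union>(U, \<phi>)\<in>A. \<phi> ` U)"
    using immersed unfolding immersed_hypersurface_def smooth_atlas_def by blast
  then show ?thesis
    using that by auto
qed

lemma continuous_on_charts:
  fixes h :: "'s \<Rightarrow> 'c::topological_space"
  assumes "\<And>U \<phi>. (U, \<phi>) \<in> A \<Longrightarrow> continuous_on U (\<lambda>u. h (\<phi> u))"
  shows "continuous_on UNIV h"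
proof -
  have "isCont h p" for p
  proof -
    obtain U \<phi> u where c: "(U, \<phi>) \<in> A" "u \<in> U" "p = \<phi> u"
      by (rule chart_at)
    have "continuous_on (\<phi> ` U) (\<lambda>x. h (\<phi> (inv_into U \<phi> x)))"
      by (rule continuous_on_compose2[OF assms[OF c(1)] chart_inv_continuous[OF c(1)]])
         (auto simp: inv_into_into)
    then have "continuous_on (\<phi> ` U) h"
      by (subst continuous_on_cong[OF refl, of _ h "\<lambda>x. h (\<phi> (inv_into U \<phi> x))"])
         (auto simp: f_inv_into_f)
    then show ?thesis
      using chart_image_open[OF c(1)] c(2,3) by (auto simp: continuous_on_eq_continuous_at)
  qed
  then show ?thesis
    by (simp add: continuous_at_imp_continuous_on)
qed

lemma C1_continuous: "C1 q \<Longrightarrow> continuous_on UNIV q"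
  using Ck_on_imp_continuous_on[OF C1D] by (intro continuous_on_charts)

lemma C1_const: "C1 (\<lambda>p. c)"
  by (auto simp: C1_def)

lemma C1_mult: "C1 q \<Longrightarrow> C1 q' \<Longrightarrow> C1 (\<lambda>p. q p * q' p)"
  unfolding C1_def using Ck_on_mult[OF _ _ chart_open] by blast

lemma C1_sum: "finite I \<Longrightarrow> (\<And>i. i \<in> I \<Longrightarrow> C1 (q i)) \<Longrightarrow> C1 (\<lambda>p. \<Sum>i\<in>I. q i p)"
  unfolding C1_def by (auto intro!: Ck_on_sum simp: chart_open simp del: Ck_on.simps One_nat_def)

lemma C1_compose:
  assumes "Ck_on 1 \<theta> V" "C1 q" "range q \<subseteq> V"
  shows "C1 (\<lambda>p. \<theta> (q p))"
  unfolding C1_def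
proof safe
  fix U \<phi> assume c: "(U, \<phi>) \<in> A"
  show "Ck_on 1 (\<lambda>u. \<theta> (q (\<phi> u))) U"
    by (rule Ck_on_compose[OF assms(1) C1D[OF assms(2) c] chart_open[OF c]]) (use assms(3) in auto)
qed

lemma open_C1_pos: "C1 q \<Longrightarrow> open {p. q p > 0}"
  using open_Collect_less[OF continuous_on_const C1_continuous] by blast

text \<open>The squared positive part of \<open>r\<^sup>2 - |x - u|\<^sup>2\<close> is transplanted
  from the chart and extended by zero. The image of the closed ball is compact, hence closed in a
  Hausdorff space, so near points outside the chart image the extension is identically zero.\<close>

lemma bump_exists:
  assumes c: "(U, \<phi>) \<in> A" and u: "u \<in> U"
  obtains b C where "C1 b" "\<And>p. b p \<ge> 0" "b (\<phi> u) > 0" "compact C" "C \<subseteq> U" "\<And>p. p \<notin> \<phi> ` C \<Longrightarrow> b p = 0"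
proof -
  obtain r where r: "r > 0" "cball u r \<subseteq> U"
    using chart_open[OF c] u open_contains_cball by blast
  define g where "g x = (max 0 (r\<^sup>2 - (x - u) \<bullet> (x - u)))\<^sup>2" for x
  define b where "b p = (if p \<in> \<phi> ` U then g (inv_into U \<phi> p) else 0)" for p
  let ?C = "cball u r"
  have g0: "g x = 0" if "x \<notin> ?C" for x
  proof -
    have "r \<le> norm (x - u)"
      using that by (simp add: dist_norm norm_minus_commute)
    then have "r\<^sup>2 \<le> (norm (x - u))\<^sup>2"
      using r(1) by (intro power_mono) auto
    then show ?thesis
      by (simp add: g_def power2_norm_eq_inner)
  qed
  have g: "Ck_on 1 g V" if V: "open V" for V
  proof -
    have "((\<lambda>x. x - u) has_derivative (\<lambda>v. v)) (at x)" for x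
      by (auto intro!: derivative_eq_intros)
    then have "(\<lambda>x. x - u) differentiable (at x)" "frechet_derivative (\<lambda>x. x - u) (at x) = (\<lambda>v. v)" for x
      by (auto simp: differentiable_def frechet_derivative_eqI)
    then have id: "Ck_on 1 (\<lambda>x. x - u) V"
      by simp
    have "Ck_on 1 (\<lambda>x. r\<^sup>2 + (-1) * ((x - u) \<bullet> (x - u))) V"
      by (intro Ck_on_add Ck_on_mult Ck_on_inner id Ck_on_const V)
    then have "Ck_on 1 (\<lambda>x. r\<^sup>2 - (x - u) \<bullet> (x - u)) V"
      by (simp del: Ck_on.simps One_nat_def)
    from Ck_on_compose[OF Ck_on_square_pos this V] show ?thesis
      by (simp add: g_def[abs_def] del: Ck_on.simps One_nat_def)
  qed
  have compC: "compact (\<phi> ` ?C)"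
    using chart_continuous[OF c] r(2) by (intro compact_continuous_image) (auto intro: continuous_on_subset)
  have off: "b p = 0" if "p \<notin> \<phi> ` ?C" for p
  proof (cases "p \<in> \<phi> ` U")
    case True
    then have "\<phi> (inv_into U \<phi> p) = p"
      by (rule f_inv_into_f)
    then have "inv_into U \<phi> p \<notin> ?C"
      using that by (metis imageI)
    then show ?thesis
      using g0 by (simp add: b_def del: mem_cball)
  qed (simp add: b_def)
  have "C1 b"
    unfolding C1_def
  proof safe
    fix V \<eta> assume d: "(V, \<eta>) \<in> A"
    show "Ck_on 1 (\<lambda>x. b (\<eta> x)) V"
    proof (rule Ck_on_Union)
      fix x assume x: "x \<in> V"
      show "\<exists>W. open W \<and> x \<in> W \<and> Ck_on 1 (\<lambda>x. b (\<eta> x)) W"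
      proof (cases "\<eta> x \<in> \<phi> ` U")
        case True
        let ?W = "V \<inter> \<eta> -` (\<phi> ` U)"
        have "Ck_on 1 (\<lambda>x. g ((inv_into U \<phi> \<circ> \<eta>) x)) ?W"
          by (rule Ck_on_compose[OF g[OF open_UNIV] transition_smooth[OF d c] overlap_open[OF d c]]) simp
        moreover have "Ck_on 1 (\<lambda>x. b (\<eta> x)) ?W \<longleftrightarrow> Ck_on 1 (\<lambda>x. g ((inv_into U \<phi> \<circ> \<eta>) x)) ?W"
          by (rule Ck_on_cong[OF overlap_open[OF d c]]) (auto simp: b_def)
        ultimately show ?thesis
          using overlap_open[OF d c] x True by blast
      next
        case False
        let ?W = "V \<inter> \<eta> -` (- (\<phi> ` ?C))"
        have W: "open ?W"
          using compact_imp_closed[OF compC]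
          by (intro continuous_open_preimage[OF chart_continuous[OF d] chart_open[OF d]]) auto
        have "Ck_on 1 (\<lambda>x. b (\<eta> x)) ?W \<longleftrightarrow> Ck_on 1 (\<lambda>x. 0 :: real) ?W"
          by (rule Ck_on_cong[OF W]) (auto simp: off)
        then have "Ck_on 1 (\<lambda>x. b (\<eta> x)) ?W"
          by (simp only: Ck_on_const)
        then show ?thesis
          using W x False r(2) by blast
      qed
    qed
  qed
  moreover have "b p \<ge> 0" for p
    by (simp add: b_def g_def)
  moreover have "b (\<phi> u) > 0"
    using u r(1) inv_into_f_f[OF chart_inj[OF c] u] by (simp add: b_def g_def)
  ultimately show ?thesis
    using that[of b ?C] r(2) off by auto
qed

end

section \<open>The divergence theorem for compactly supported test functions\<close>

context shrinker
begin

text \<open>The derivative of \<open>q\<close> along the gradient of the potential. As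
  \<open>grad\<close> lives in coordinates, some chart around the point has to be selected;
  \<open>lie_chart_independent\<close> shows that the choice is immaterial for C^1
  functions.\<close>

definition lie :: "('s \<Rightarrow> real) \<Rightarrow> 's \<Rightarrow> real"
  where "lie q p = (let c = SOME c. c \<in> A \<and> p \<in> snd c ` fst c; u = inv_into (fst c) (snd c) p
     in frechet_derivative (\<lambda>x. q (snd c x)) (at u) (grad (snd c) u))"

text \<open>The differential of the transition map carries one coordinate gradient to the other. It
  is injective, hence onto, so the image vector satisfies the defining relation against every vector
  and \<open>grad_unique\<close> applies; the rest is the chain rule.\<close>

lemma lie_chart_independent:
  assumes c: "(U, \<phi>) \<in> A" "(V, \<eta>) \<in> A" and q: "C1 q" and u: "u \<in> U \<inter> \<phi> -` (\<eta> ` V)"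
  defines "w \<equiv> (inv_into V \<eta> \<circ> \<phi>) u"
  shows "frechet_derivative (\<lambda>x. q (\<phi> x)) (at u) (grad \<phi> u) =
    frechet_derivative (\<lambda>x. q (\<eta> x)) (at w) (grad \<eta> w)"
proof -
  let ?\<tau> = "inv_into V \<eta> \<circ> \<phi>"
  let ?D = "frechet_derivative ?\<tau> (at u)"
  have uU: "u \<in> U" and wV: "w \<in> V" and e: "\<eta> w = \<phi> u"
    using u transition_mem[OF c u] transition_eq[OF c u] by (auto simp: w_def)
  note t = transition_differentiable[OF c u]
  have dX: "dX \<phi> u v = dX \<eta> w (?D v)" for v
    unfolding w_def by (rule dX_transition[OF c u])
  have "surj ?D"
  proof -
    have "inj ?D"
      using dX_inj[OF c(1) uU] dX by (metis injD injI)
    then show ?thesis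
      by (rule linear_inj_imp_surj[OF linear_frechet_derivative[OF t]])
  qed
  then have "grad \<eta> w = ?D (grad \<phi> u)"
  proof (intro grad_unique[OF c(2) wV])
    fix x
    obtain v where v: "x = ?D v"
      using \<open>surj ?D\<close> by (meson surjD)
    show "dX \<eta> w (?D (grad \<phi> u)) \<bullet> dX \<eta> w x = F (\<eta> w) \<bullet> dX \<eta> w x / 2"
      using grad_inner[OF c(1) uU, of v] unfolding v e dX .
  qed
  moreover have "frechet_derivative (\<lambda>x. q (\<phi> x)) (at u) = frechet_derivative (\<lambda>x. q (\<eta> (?\<tau> x))) (at u)"
  proof (rule frechet_derivative_cong_open[OF overlap_open[OF c] u])
    fix y assume "y \<in> U \<inter> \<phi> -` (\<eta> ` V)"
    then show "q (\<phi> y) = q (\<eta> (?\<tau> y))"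
      using transition_eq[OF c, of y] by simp
  qed
  moreover have "frechet_derivative (\<lambda>x. q (\<eta> (?\<tau> x))) (at u) d =
      frechet_derivative (\<lambda>x. q (\<eta> x)) (at w) (?D d)" for d
    unfolding w_def
    by (rule frechet_derivative_chain[OF t, of "\<lambda>x. q (\<eta> x)"])
       (use C1_differentiable[OF q c(2) wV] in \<open>simp add: w_def\<close>)
  ultimately show ?thesis by simp
qed

lemma lie_chart:
  assumes c: "(U, \<phi>) \<in> A" and q: "C1 q" and u: "u \<in> U"
  shows "lie q (\<phi> u) = frechet_derivative (\<lambda>x. q (\<phi> x)) (at u) (grad \<phi> u)"
proof -
  define d where "d = (SOME c. c \<in> A \<and> \<phi> u \<in> snd c ` fst c)"
  have "\<exists>c. c \<in> A \<and> \<phi> u \<in> snd c ` fst c"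
    using c u by force
  then have d: "d \<in> A \<and> \<phi> u \<in> snd d ` fst d"
    unfolding d_def by (rule someI_ex)
  then have dA: "(fst d, snd d) \<in> A" and "u \<in> U \<inter> \<phi> -` (snd d ` fst d)"
    using u by auto
  from lie_chart_independent[OF c dA q this(2)] show ?thesis
    by (simp add: lie_def d_def[symmetric] Let_def)
qed

lemma lie_cong:
  assumes W: "open W" "p \<in> W" "\<And>x. x \<in> W \<Longrightarrow> q x = q' x" and q: "C1 q" "C1 q'"
  shows "lie q p = lie q' p"
proof -
  obtain U \<phi> u where c: "(U, \<phi>) \<in> A" "u \<in> U" "p = \<phi> u"
    by (rule chart_at)
  have "open (U \<inter> \<phi> -` W)"
    by (rule continuous_open_preimage[OF chart_continuous[OF c(1)] chart_open[OF c(1)] W(1)])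
  then have "frechet_derivative (\<lambda>x. q (\<phi> x)) (at u) = frechet_derivative (\<lambda>x. q' (\<phi> x)) (at u)"
    by (rule frechet_derivative_cong_open) (use c W in auto)
  then show ?thesis
    unfolding c(3) lie_chart[OF c(1) q(1) c(2)] lie_chart[OF c(1) q(2) c(2)] by simp
qed

lemma lie_const: "lie (\<lambda>p. c) p = 0"
proof -
  obtain U \<phi> u where c: "(U, \<phi>) \<in> A" "u \<in> U" "p = \<phi> u"
    by (rule chart_at)
  then show ?thesis
    using lie_chart[OF c(1) C1_const c(2)] by simp
qed

lemma lie_sum:
  assumes I: "finite I" and q: "\<And>i. i \<in> I \<Longrightarrow> C1 (q i)"
  shows "lie (\<lambda>p. \<Sum>i\<in>I. q i p) p = (\<Sum>i\<in>I. lie (q i) p)"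
proof -
  obtain U \<phi> u where c: "(U, \<phi>) \<in> A" "u \<in> U" "p = \<phi> u"
    by (rule chart_at)
  have "((\<lambda>x. \<Sum>i\<in>I. q i (\<phi> x)) has_derivative
      (\<lambda>d. \<Sum>i\<in>I. frechet_derivative (\<lambda>x. q i (\<phi> x)) (at u) d)) (at u)"
    by (intro has_derivative_sum differentiable_has_frechet_derivative C1_differentiable[OF q c(1,2)])
  note fd = frechet_derivative_eqI[OF this]
  have "C1 (\<lambda>p. \<Sum>i\<in>I. q i p)"
    by (rule C1_sum[OF I q])
  from lie_chart[OF c(1) this c(2)] show ?thesis
    unfolding c(3) fd using lie_chart[OF c(1) q c(2)] by simp
qed

lemma C1_potential: "C1 potential"
  unfolding C1_def
proof safe
  fix U \<phi> assume c: "(U, \<phi>) \<in> A"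
  have "Ck_on 1 (\<lambda>u. ((F \<circ> \<phi>) u \<bullet> (F \<circ> \<phi>) u) * (1/4)) U"
    by (intro Ck_on_mult Ck_on_inner X_smooth[OF c] Ck_on_const chart_open[OF c])
  then show "Ck_on 1 (\<lambda>u. potential (\<phi> u)) U"
    by (simp add: potential_def del: Ck_on.simps One_nat_def)
qed

text \<open>Chain rule: the derivative of the potential along its own gradient is the squared length
  of that gradient, known from \<open>grad_norm\<close>.\<close>

lemma lie_potential_compose:
  assumes \<theta>: "\<And>t. (\<theta> has_real_derivative \<theta>' t) (at t)" and q: "C1 (\<lambda>p. \<theta> (potential p))"
  shows "lie (\<lambda>p. \<theta> (potential p)) p = \<theta>' (potential p) * (potential p - (H p)\<^sup>2)"
proof -
  obtain U \<phi> u where c: "(U, \<phi>) \<in> A" "u \<in> U" "p = \<phi> u"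
    by (rule chart_at)
  note X = X_has_derivative[OF c(1,2)]
  have "((\<lambda>x. ((F \<circ> \<phi>) x \<bullet> (F \<circ> \<phi>) x) / 4) has_derivative
      (\<lambda>d. ((F \<circ> \<phi>) u \<bullet> dX \<phi> u d + dX \<phi> u d \<bullet> (F \<circ> \<phi>) u) / 4)) (at u)"
    by (intro bounded_linear.has_derivative[OF bounded_linear_divide] has_derivative_inner X)
  then have "((\<lambda>x. potential (\<phi> x)) has_derivative (\<lambda>d. (F (\<phi> u) \<bullet> dX \<phi> u d) / 2)) (at u)"
    by (simp add: potential_def inner_commute[of "dX \<phi> u _"] field_simps)
  from has_derivative_compose[OF this \<theta>[unfolded has_field_derivative_def]]
  have "frechet_derivative (\<lambda>x. \<theta> (potential (\<phi> x))) (at u) =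
      (\<lambda>d. \<theta>' (potential (\<phi> u)) * ((F (\<phi> u) \<bullet> dX \<phi> u d) / 2))"
    by (rule frechet_derivative_eqI)
  then show ?thesis
    unfolding c(3) lie_chart[OF c(1) q c(2)]
    by (simp add: grad_norm[OF c(1,2), symmetric] grad_inner[OF c(1,2)])
qed

text \<open>The normal is an arbitrary pointwise choice and may jump, so \<open>H\<^sup>2\<close> is
  expressed by \<open>grad_norm\<close> as the potential minus the squared length of its
  gradient.\<close>

lemma H_square_continuous: "continuous_on UNIV (\<lambda>p. (H p)\<^sup>2)"
proof (rule continuous_on_charts)
  fix U \<phi> assume c: "(U, \<phi>) \<in> A"
  have "Ck_on 0 (\<lambda>u. dX \<phi> u (grad \<phi> u)) U"
    by (rule Ck_on_linear_family[OF chart_open[OF c] dX_linear[OF c] dX_smooth[OF c] grad_smooth[OF c]])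
  then have "continuous_on U (\<lambda>u. potential (\<phi> u) - dX \<phi> u (grad \<phi> u) \<bullet> dX \<phi> u (grad \<phi> u))"
    using Ck_on_imp_continuous_on[OF C1D[OF C1_potential c]] by (auto intro!: continuous_intros)
  then show "continuous_on U (\<lambda>u. (H (\<phi> u))\<^sup>2)"
    by (subst continuous_on_cong[OF refl, of _ _ "\<lambda>u. potential (\<phi> u) - dX \<phi> u (grad \<phi> u) \<bullet> dX \<phi> u (grad \<phi> u)"])
       (auto simp: grad_norm[OF c])
qed

lemma lie_continuous:
  assumes q: "C1 q"
  shows "continuous_on UNIV (lie q)"
proof (rule continuous_on_charts)
  fix U \<phi> assume c: "(U, \<phi>) \<in> A"
  have "Ck_on 0 (\<lambda>u. frechet_derivative (\<lambda>x. q (\<phi> x)) (at u) (grad \<phi> u)) U"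
  proof (rule Ck_on_linear_family[OF chart_open[OF c]])
    show "linear (frechet_derivative (\<lambda>x. q (\<phi> x)) (at u))" if "u \<in> U" for u
      by (rule linear_frechet_derivative[OF C1_differentiable[OF q c that]])
    show "Ck_on 0 (\<lambda>u. frechet_derivative (\<lambda>x. q (\<phi> x)) (at u) v) U" for v
      using C1D[OF q c] by simp
  qed (rule grad_smooth[OF c])
  then show "continuous_on U (\<lambda>u. lie q (\<phi> u))"
    by (subst continuous_on_cong[OF refl lie_chart[OF c q]]) auto
qed

text \<open>The divergence of \<open>q\<close> times the gradient of the potential, in view of \<open>divergence_grad\<close>.\<close>

definition weighted_divergence :: "('s \<Rightarrow> real) \<Rightarrow> 's \<Rightarrow> real"
  where "weighted_divergence q p = q p * (CARD('n) / 2 - (H p)\<^sup>2) + lie q p"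

lemma weighted_divergence_measurable: "C1 q \<Longrightarrow> weighted_divergence q \<in> borel_measurable borel"
  unfolding weighted_divergence_def
  by (intro borel_measurable_continuous_onI continuous_on_add continuous_on_mult continuous_on_diff
      continuous_on_const C1_continuous lie_continuous H_square_continuous)

lemma chart_integral_weighted_divergence:
  assumes c: "(U, \<phi>) \<in> A" and q: "C1 q" and C: "compact C" "C \<subseteq> U" "\<And>p. p \<notin> \<phi> ` C \<Longrightarrow> q p = 0"
  shows "integrable vol (weighted_divergence q)" "(\<integral>p. weighted_divergence q p \<partial>vol) = 0"
proof -
  have "compact (\<phi> ` C)"
    using C chart_continuous[OF c] by (intro compact_continuous_image) (auto intro: continuous_on_subset)
  then have op: "open (- \<phi> ` C)"
    using compact_imp_closed by auto
  have off: "weighted_divergence q p = 0" if "p \<notin> \<phi> ` U" for p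
  proof -
    have p: "p \<in> - \<phi> ` C"
      using that C(2) by auto
    have "lie q p = lie (\<lambda>_. 0) p"
      by (rule lie_cong[OF op p _ q C1_const]) (use C(3) in auto)
    then show ?thesis
      using C(3) p by (simp add: weighted_divergence_def lie_const)
  qed
  have eq: "(\<lambda>u. indicator U u * (vol_density \<phi> u * weighted_divergence q (\<phi> u))) =
     (\<lambda>u. indicator U u * (vol_density \<phi> u * (q (\<phi> u) * (CARD('n) / 2 - (H (\<phi> u))\<^sup>2) +
        frechet_derivative (\<lambda>x. q (\<phi> x)) (at u) (grad \<phi> u))))"
    by (auto simp: fun_eq_iff indicator_def weighted_divergence_def lie_chart[OF c q])
  have "q (\<phi> u) = 0" if "u \<in> U - C" for u
    using that C inj_onD[OF chart_inj[OF c]] by (intro C(3)) blast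
  note D = chart_integral_divergence[OF c C1D[OF q c] C(1,2) this]
  note m = weighted_divergence_measurable[OF q]
  have I: "integrable vol (weighted_divergence q) \<longleftrightarrow>
      integrable lborel (\<lambda>u. indicator U u * (vol_density \<phi> u * weighted_divergence q (\<phi> u)))"
    "(\<integral>p. weighted_divergence q p \<partial>vol) =
      (\<integral>u. indicator U u * (vol_density \<phi> u * weighted_divergence q (\<phi> u)) \<partial>lborel)"
     apply (rule chart_integral(1)[OF c m off])
     apply assumption
    apply (rule chart_integral(2)[OF c m off])
    apply assumption
    done
  show "integrable vol (weighted_divergence q)"
    unfolding I eq by (rule D(1))
  show "(\<integral>p. weighted_divergence q p \<partial>vol) = 0"
    unfolding I eq by (rule D(2))
qed

text \<open>Finitely many bump functions with sum \<open>S > 0\<close> on \<open>K\<close> split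
  \<open>q\<close> into the C^1 pieces \<open>b x p * Q p\<close>, each supported in one chart,
  where the divergence theorem is known.\<close>

theorem integral_weighted_divergence:
  assumes q: "C1 q" and K: "compact K" "\<And>p. p \<notin> K \<Longrightarrow> q p = 0"
  shows "integrable vol (weighted_divergence q)" "(\<integral>p. weighted_divergence q p \<partial>vol) = 0"
proof -
  have "\<exists>b U \<phi> C. C1 b \<and> (\<forall>p. b p \<ge> 0) \<and> b p > 0 \<and> (U, \<phi>) \<in> A \<and> compact C \<and> C \<subseteq> U \<and>
      (\<forall>p. p \<notin> \<phi> ` C \<longrightarrow> b p = 0)" for p
  proof -
    obtain U \<phi> u where c: "(U, \<phi>) \<in> A" "u \<in> U" "p = \<phi> u"
      by (rule chart_at)
    show ?thesis
      using bump_exists[OF c(1,2)] c(1,3) by metis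
  qed
  then obtain b U \<phi> C where b: "\<And>x. C1 (b x)" "\<And>x p. b x p \<ge> 0" "\<And>x. b x x > 0"
    "\<And>x. (U x, \<phi> x) \<in> A" "\<And>x. compact (C x)" "\<And>x. C x \<subseteq> U x" "\<And>x p. p \<notin> \<phi> x ` C x \<Longrightarrow> b x p = 0"
    by metis
  obtain I where I: "finite I" "K \<subseteq> (\<Union>x\<in>I. {p. b x p > 0})"
  proof (rule compactE_image[OF K(1), of K "\<lambda>x. {p. b x p > 0}"])
    show "open {p. b x p > 0}" for x
      using open_C1_pos[OF b(1)] .
    show "K \<subseteq> (\<Union>x\<in>K. {p. b x p > 0})"
      using b(3) by blast
  qed blast
  define S where "S p = (\<Sum>x\<in>I. b x p)" for p
  have S: "C1 S"
    unfolding S_def by (rule C1_sum[OF I(1) b(1)])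
  have S0: "S p \<ge> 0" for p
    unfolding S_def by (intro sum_nonneg b(2))
  have SK: "S p > 0" if pK: "p \<in> K" for p
  proof -
    obtain x where "x \<in> I" "b x p > 0"
      using I(2) pK by blast
    then show ?thesis
      unfolding S_def by (intro sum_pos2[OF I(1)]) (auto simp: b(2))
  qed
  \<comment> \<open>Near points of \<open>K\<close> this is a quotient with positive denominator. On
    the complement of \<open>K\<close> it is zero in either case, so the switch at
    \<open>S p = 0\<close> does no harm to regularity.\<close>
  define Q where "Q p = (if S p > 0 then q p / S p else 0)" for p
  have clK: "open (- K)"
    using compact_imp_closed[OF K(1)] by auto
  have Q: "C1 Q"
    unfolding C1_def
  proof safe
    fix V \<eta> assume c: "(V, \<eta>) \<in> A"
    show "Ck_on 1 (\<lambda>u. Q (\<eta> u)) V"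
    proof (rule Ck_on_Union)
      fix u assume u: "u \<in> V"
      show "\<exists>W. open W \<and> u \<in> W \<and> Ck_on 1 (\<lambda>u. Q (\<eta> u)) W"
      proof (cases "\<eta> u \<in> K")
        case True
        let ?W = "V \<inter> \<eta> -` {p. S p > 0}"
        have W: "open ?W"
          by (rule continuous_open_preimage[OF chart_continuous[OF c] chart_open[OF c] open_C1_pos[OF S]])
        have SW: "Ck_on 1 (\<lambda>u. S (\<eta> u)) ?W" and qW: "Ck_on 1 (\<lambda>u. q (\<eta> u)) ?W"
          using Ck_on_subset[OF C1D[OF S c]] Ck_on_subset[OF C1D[OF q c]] by blast+
        have "Ck_on 1 (\<lambda>u. S (\<eta> u) powr (-1)) ?W"
          by (rule Ck_on_compose[OF Ck_on_powr SW W]) auto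
        then have "Ck_on 1 (\<lambda>u. q (\<eta> u) * S (\<eta> u) powr (-1)) ?W"
          by (rule Ck_on_mult[OF qW _ W])
        moreover have "Ck_on 1 (\<lambda>u. Q (\<eta> u)) ?W \<longleftrightarrow> Ck_on 1 (\<lambda>u. q (\<eta> u) * S (\<eta> u) powr (-1)) ?W"
          by (rule Ck_on_cong[OF W]) (auto simp: Q_def powr_minus_divide)
        ultimately show ?thesis
          using W u SK[OF True] by blast
      next
        case False
        let ?W = "V \<inter> \<eta> -` (- K)"
        have W: "open ?W"
          by (rule continuous_open_preimage[OF chart_continuous[OF c] chart_open[OF c] clK])
        have "Ck_on 1 (\<lambda>u. Q (\<eta> u)) ?W \<longleftrightarrow> Ck_on 1 (\<lambda>u. 0 :: real) ?W"
          by (rule Ck_on_cong[OF W]) (auto simp: Q_def K(2))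
        then have "Ck_on 1 (\<lambda>u. Q (\<eta> u)) ?W"
          by (simp only: Ck_on_const)
        then show ?thesis
          using W u False by blast
      qed
    qed
  qed
  define g where "g x p = b x p * Q p" for x p
  have g: "C1 (g x)" for x
    unfolding g_def by (rule C1_mult[OF b(1) Q])
  have q_sum: "q = (\<lambda>p. \<Sum>x\<in>I. g x p)"
  proof
    fix p
    have "(\<Sum>x\<in>I. g x p) = S p * Q p"
      by (simp add: g_def S_def sum_distrib_right)
    also have "\<dots> = q p"
      using SK[of p] K(2)[of p] by (auto simp: Q_def)
    finally show "q p = (\<Sum>x\<in>I. g x p)" ..
  qed
  have wd: "weighted_divergence q = (\<lambda>p. \<Sum>x\<in>I. weighted_divergence (g x) p)"
    unfolding weighted_divergence_def q_sum lie_sum[OF I(1) g]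
    by (simp add: fun_eq_iff sum.distrib sum_distrib_right)
  have gx: "integrable vol (weighted_divergence (g x))" "(\<integral>p. weighted_divergence (g x) p \<partial>vol) = 0" for x
  proof -
    have "g x p = 0" if "p \<notin> \<phi> x ` C x" for p
      using b(7)[OF that] by (simp add: g_def)
    note * = chart_integral_weighted_divergence[OF b(4)[of x] g b(5)[of x] b(6)[of x] this]
    show "integrable vol (weighted_divergence (g x))" "(\<integral>p. weighted_divergence (g x) p \<partial>vol) = 0"
      by (rule *, assumption)+
  qed
  show "integrable vol (weighted_divergence q)" "(\<integral>p. weighted_divergence q p \<partial>vol) = 0"
    unfolding wd using gx by simp_all
qed

end

section \<open>The test function\<close>

locale test_function =
  fixes k R \<beta> :: real
  assumes k: "k > 0" and R: "R \<ge> 2 * k"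
begin

text \<open>The function \<open>h\<close> is a \<open>C\<^sup>1\<close> modification of the identity of \<open>[2k, \<infinity>)\<close> that stays away
  from \<open>0\<close>, so that \<open>\<theta>\<close> is \<open>((R / z) powr (k / 2) - 1)\<^sup>2\<close> with \<open>z = t - \<beta>\<close> on \<open>[2k, R]\<close>. There
  \<open>k \<theta> + z \<theta>' = - k (\<theta> powr (1 / 2))\<close>.\<close>

definition h :: "real \<Rightarrow> real"
  where "h z = k + z\<^sup>2 / (4 * k) - (max 0 (z - 2 * k))\<^sup>2 / (4 * k)"

definition h' :: "real \<Rightarrow> real"
  where "h' z = z / (2 * k) - max 0 (z - 2 * k) / (2 * k)"

text \<open>The parabola \<open>k + z\<^sup>2 / (4 * k)\<close> exceeds \<open>z\<close> by
  \<open>(z - 2 * k)\<^sup>2 / (4 * k)\<close>, so it touches the diagonal at \<open>2 * k\<close>;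
  subtracting this excess beyond \<open>2 * k\<close> leaves the identity.\<close>

lemma h_eq: "z \<ge> 2 * k \<Longrightarrow> h z = z" "z \<ge> 2 * k \<Longrightarrow> h' z = 1"
  using k by (auto simp: h_def h'_def max_def power2_eq_square field_simps)

lemma h_ge: "h z \<ge> k"
proof (cases "z \<ge> 2 * k")
  case True
  then show ?thesis
    using h_eq k by simp
next
  case False
  then show ?thesis
    using k by (simp add: h_def max_def)
qed

lemma h_pos: "h z > 0"
  using h_ge[of z] k by linarith

lemma h'_nonneg: "z \<ge> 0 \<Longrightarrow> h' z \<ge> 0"
  using k h_eq(2)[of z] by (cases "z \<ge> 2 * k") (auto simp: h'_def)

lemma h_derivative: "(h has_real_derivative h' z) (at z)"
proof -
  have "((\<lambda>z. (max 0 (z - 2 * k))\<^sup>2) has_real_derivative 2 * max 0 (z - 2 * k)) (at z)"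
  proof -
    have "((\<lambda>z. z - 2 * k) has_real_derivative 1) (at z)"
      by (auto intro!: derivative_eq_intros)
    from DERIV_chain2[OF square_pos_has_derivative this] show ?thesis
      by simp
  qed
  moreover have "((\<lambda>z. k + z\<^sup>2 / (4 * k)) has_real_derivative 2 * z / (4 * k)) (at z)"
    using k by (auto intro!: derivative_eq_intros)
  ultimately have "((\<lambda>z. k + z\<^sup>2 / (4 * k) - (max 0 (z - 2 * k))\<^sup>2 / (4 * k)) has_real_derivative
      2 * z / (4 * k) - 2 * max 0 (z - 2 * k) / (4 * k)) (at z)"
    by (intro DERIV_diff DERIV_cdivide)
  then show ?thesis
    by (simp add: h_def[abs_def] h'_def)
qed

lemma h_continuous: "continuous_on S h"
  using h_derivative DERIV_isCont continuous_at_imp_continuous_on by blast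

definition P :: "real \<Rightarrow> real"
  where "P z = R powr (k / 2) * h z powr (- (k / 2)) - 1"

definition P' :: "real \<Rightarrow> real"
  where "P' z = - (k / 2) * R powr (k / 2) * h z powr (- (k / 2) - 1) * h' z"

definition \<theta> :: "real \<Rightarrow> real"
  where "\<theta> t = (max 0 (P (t - \<beta>)))\<^sup>2"

definition \<theta>' :: "real \<Rightarrow> real"
  where "\<theta>' t = 2 * max 0 (P (t - \<beta>)) * P' (t - \<beta>)"

lemma P_derivative: "(P has_real_derivative P' z) (at z)"
proof -
  have "((\<lambda>z. h z powr (- (k / 2))) has_real_derivative - (k / 2) * h z powr (- (k / 2) - 1) * h' z) (at z)"
    by (rule DERIV_chain2[OF has_real_derivative_powr[OF h_pos] h_derivative])
  then have "((\<lambda>z. R powr (k / 2) * h z powr (- (k / 2)) - 1) has_real_derivative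
      R powr (k / 2) * (- (k / 2) * h z powr (- (k / 2) - 1) * h' z) - 0) (at z)"
    by (intro DERIV_diff DERIV_const DERIV_cmult)
  then show ?thesis
    by (simp add: P_def[abs_def] P'_def mult_ac)
qed

lemma \<theta>_derivative: "(\<theta> has_real_derivative \<theta>' t) (at t)"
proof -
  have "((\<lambda>t. P (t - \<beta>)) has_real_derivative P' (t - \<beta>) * 1) (at t)"
    by (rule DERIV_chain2[OF P_derivative]) (auto intro!: derivative_eq_intros)
  then have "((\<lambda>t. (max 0 (P (t - \<beta>)))\<^sup>2) has_real_derivative 2 * max 0 (P (t - \<beta>)) * P' (t - \<beta>)) (at t)"
    using DERIV_chain2[OF square_pos_has_derivative, of "\<lambda>t. P (t - \<beta>)"] by simp
  then show ?thesis
    by (simp add: \<theta>_def[abs_def] \<theta>'_def)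
qed

lemma \<theta>'_continuous: "continuous_on UNIV \<theta>'"
proof -
  have "continuous_on UNIV P"
    using P_derivative DERIV_isCont continuous_at_imp_continuous_on by blast
  then have 1: "continuous_on UNIV (\<lambda>t. P (t - \<beta>))"
    by (rule continuous_on_compose2) (auto intro: continuous_intros)
  have "continuous_on UNIV P'"
    unfolding P'_def h'_def using less_imp_neq[OF h_pos] k
    by (intro continuous_intros h_continuous) auto
  then have "continuous_on UNIV (\<lambda>t. P' (t - \<beta>))"
    by (rule continuous_on_compose2) (auto intro: continuous_intros)
  with 1 show ?thesis
    unfolding \<theta>'_def by (intro continuous_on_mult continuous_on_max continuous_on_const)
qed

lemma P_large: "z \<ge> 2 * k \<Longrightarrow> P z = (R / z) powr (k / 2) - 1"
  using R k by (simp add: P_def h_eq powr_divide powr_minus_divide)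

lemma \<theta>_zero: "t \<ge> R + \<beta> \<Longrightarrow> \<theta> t = 0"
proof -
  assume t: "t \<ge> R + \<beta>"
  then have "t - \<beta> \<ge> 2 * k" "R / (t - \<beta>) \<le> 1"
    using R k by auto
  then have "P (t - \<beta>) \<le> 0"
    using R k by (auto simp: P_large intro!: powr_le1)
  then show ?thesis
    by (simp add: \<theta>_def)
qed

lemma P_bound: "P z \<le> (R / k) powr (k / 2)"
proof -
  have "h z powr (- (k / 2)) \<le> k powr (- (k / 2))"
    using h_ge[of z] k by (intro powr_mono2') auto
  then have "R powr (k / 2) * h z powr (- (k / 2)) \<le> R powr (k / 2) * k powr (- (k / 2))"
    by (intro mult_left_mono) auto
  also have "\<dots> = (R / k) powr (k / 2)"
    using R k by (simp add: powr_divide powr_minus_divide)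
  finally show ?thesis
    by (simp add: P_def)
qed

lemma \<theta>_bound: "\<theta> t \<le> (R / k) powr k"
proof -
  have "(max 0 (P (t - \<beta>)))\<^sup>2 \<le> ((R / k) powr (k / 2))\<^sup>2"
    using P_bound[of "t - \<beta>"] by (intro power_mono) auto
  also have "\<dots> = (R / k) powr k"
    by (simp add: power2_eq_square powr_add[symmetric])
  finally show ?thesis
    by (simp add: \<theta>_def)
qed

lemma \<theta>'_nonpos: "t \<ge> \<beta> \<Longrightarrow> \<theta>' t \<le> 0"
  using h'_nonneg[of "t - \<beta>"] k unfolding \<theta>'_def P'_def
  by (intro mult_nonneg_nonpos mult_nonpos_nonneg) auto

text \<open>In this range \<open>P + 1\<close> is homogeneous of degree \<open>- k / 2\<close>, so
  \<open>z * P' z = - (k / 2) * (P z + 1)\<close>. Where \<open>P\<close> is positive, the quadratic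
  terms of \<open>k * P\<^sup>2 + 2 * P * (z * P')\<close> then cancel.\<close>

lemma \<theta>_large:
  assumes t: "t - \<beta> \<ge> 2 * k"
  shows "k * \<theta> t + (t - \<beta>) * \<theta>' t = - k * max 0 (P (t - \<beta>))"
proof -
  let ?z = "t - \<beta>"
  have z: "?z > 0"
    using t k by linarith
  have "?z powr (- (k / 2) - 1) * ?z = ?z powr (- (k / 2))"
    using z by (simp add: powr_diff)
  then have "?z * P' ?z = - (k / 2) * (P ?z + 1)"
    using h_eq[OF t] by (simp add: P'_def P_def mult_ac)
  moreover have "?z * \<theta>' t = 2 * max 0 (P ?z) * (?z * P' ?z)"
    by (simp add: \<theta>'_def mult_ac)
  ultimately have "?z * \<theta>' t = - k * max 0 (P ?z) * (P ?z + 1)"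
    by simp
  then show ?thesis
    by (cases "P ?z \<ge> 0") (auto simp: \<theta>_def power2_eq_square algebra_simps)
qed

end

section \<open>Volume growth\<close>

context immersion
begin

text \<open>On the image of a closed ball in a chart the continuous density is bounded; finitely
  many such images cover a compact set.\<close>

lemma vol_compact_finite:
  assumes K: "compact K"
  shows "emeasure vol K < \<infinity>"
proof -
  have "\<exists>W B. open W \<and> p \<in> W \<and> W \<subseteq> B \<and> B \<in> sets borel \<and> emeasure vol B < \<infinity>" for p
  proof -
    obtain U \<phi> u where c: "(U, \<phi>) \<in> A" "u \<in> U" "p = \<phi> u"
      by (rule chart_at)
    obtain r where r: "r > 0" "cball u r \<subseteq> U"
      using chart_open[OF c(1)] c(2) open_contains_cball by blast
    let ?C = "cball u r"
    have "compact (\<phi> ` ?C)"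
      using chart_continuous[OF c(1)] r(2) by (intro compact_continuous_image) (auto intro: continuous_on_subset)
    then have B: "\<phi> ` ?C \<in> sets borel"
      using borel_compact by blast
    have pre: "U \<inter> \<phi> -` \<phi> ` ?C = ?C"
      using inj_onD[OF chart_inj[OF c(1)]] r(2) by blast
    have "continuous_on ?C (\<lambda>u. sqrt (det (metric_matrix F \<phi> u)))"
      using metric_continuous[OF c(1)] r(2) continuous_on_subset by blast
    then have "bounded ((\<lambda>u. sqrt (det (metric_matrix F \<phi> u))) ` ?C)"
      by (intro compact_imp_bounded compact_continuous_image) auto
    then obtain M where M: "\<And>x. x \<in> ?C \<Longrightarrow> norm (sqrt (det (metric_matrix F \<phi> x))) \<le> M"
      by (auto simp: bounded_iff simp del: mem_cball)
    have "emeasure vol (\<phi> ` ?C) = (\<integral>\<^sup>+x\<in>?C. ennreal (sqrt (det (metric_matrix F \<phi> x))) \<partial>lborel)"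
      using emeasure_vol[OF c(1) B] emeasure_chart_measure[OF c(1) B] r(2) pre by auto
    also have "\<dots> \<le> (\<integral>\<^sup>+x. ennreal M * indicator ?C x \<partial>lborel)"
    proof (rule nn_integral_mono)
      fix x
      show "ennreal (sqrt (det (metric_matrix F \<phi> x))) * indicator ?C x \<le> ennreal M * indicator ?C x"
        using M[of x] by (auto simp: indicator_def intro!: ennreal_leI)
    qed
    also have "\<dots> = ennreal M * emeasure lborel ?C"
      by (rule nn_integral_cmult_indicator) simp
    also have "\<dots> < \<infinity>"
      using emeasure_bounded_finite[OF bounded_cball[of u r]] by (simp add: ennreal_mult_less_top)
    finally have "emeasure vol (\<phi> ` ?C) < \<infinity>" .
    moreover have "open (\<phi> ` ball u r)" "\<phi> ` ball u r \<subseteq> \<phi> ` ?C"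
      using r(2) by (intro chart_open_image[OF c(1)]) auto
    ultimately show ?thesis
      using B c(3) r(1) by (intro exI[of _ "\<phi> ` ball u r"] exI[of _ "\<phi> ` ?C"]) auto
  qed
  then obtain W B where WB: "\<And>p. open (W p)" "\<And>p. p \<in> W p" "\<And>p. W p \<subseteq> B p" "\<And>p. B p \<in> sets borel"
    "\<And>p. emeasure vol (B p) < \<infinity>"
    by metis
  obtain I where I: "finite I" "K \<subseteq> (\<Union>p\<in>I. W p)"
  proof (rule compactE_image[OF K WB(1)])
    show "K \<subseteq> (\<Union>p\<in>K. W p)"
      using WB(2) by blast
  qed blast
  have "K \<subseteq> (\<Union>p\<in>I. B p)"
    by (rule order_trans[OF I(2)]) (intro UN_mono subset_refl WB(3))
  then have "emeasure vol K \<le> emeasure vol (\<Union>p\<in>I. B p)"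
    using I WB(4) by (intro emeasure_mono) (auto intro!: sets.finite_UN)
  also have "\<dots> \<le> (\<Sum>p\<in>I. emeasure vol (B p))"
    using I WB(4) by (intro emeasure_subadditive_finite) auto
  also have "\<dots> < \<infinity>"
    using I WB(5) by simp
  finally show ?thesis .
qed

text \<open>A positive value would persist on a nonempty open set, which has positive
  measure.\<close>

lemma continuous_nonneg_integral_0:
  fixes h :: "'s \<Rightarrow> real"
  assumes h: "continuous_on UNIV h" "\<And>p. 0 \<le> h p" "integrable vol h" "(\<integral>p. h p \<partial>vol) = 0"
  shows "h p = 0"
proof (rule ccontr)
  assume "h p \<noteq> 0"
  then have p: "h p > 0"
    using h(2)[of p] by linarith
  obtain U \<phi> u where c: "(U, \<phi>) \<in> A" "u \<in> U" "p = \<phi> u"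
    by (rule chart_at)
  let ?W = "{x. h x > 0} \<inter> \<phi> ` U"
  have op: "open ?W"
    using open_Collect_less[OF continuous_on_const h(1)] chart_image_open[OF c(1)] by blast
  then have "emeasure vol ?W > 0"
    using p c by (intro vol_open_pos[OF c(1)]) auto
  moreover have "AE x in vol. h x = 0"
    using integral_nonneg_eq_0_iff_AE[OF h(3)] h(2,4) by simp
  then have "AE x in vol. x \<notin> ?W"
    by eventually_elim auto
  then have "?W \<in> null_sets vol"
    using op by (subst (asm) AE_iff_null_sets[symmetric]) auto
  ultimately show False
    by auto
qed

end

lemma preimage_compact_of_proper:
  fixes F :: "'s::t2_space \<Rightarrow> 'b::euclidean_space"
  assumes "proper_map euclidean euclidean F" "compact K"
  shows "compact {p. F p \<in> K}"
  using compactin_proper_map_preimage[OF assms(1), of K] assms(2) by simp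

context shrinker
begin

lemma H_square_le_potential: "(H p)\<^sup>2 \<le> potential p"
proof -
  obtain U \<phi> u where c: "(U, \<phi>) \<in> A" "u \<in> U" "p = \<phi> u"
    by (rule chart_at)
  show ?thesis
    using grad_norm[OF c(1,2)] inner_ge_zero[of "dX \<phi> u (grad \<phi> u)"] unfolding c(3) by linarith
qed

context
  assumes proper: "proper_map euclidean euclidean F"
begin

lemma compact_sublevel: "compact {p. potential p \<le> R}"
proof -
  \<comment> \<open>The absolute value covers negative \<open>R\<close>, for which the sublevel set
    is empty.\<close>
  have "norm x \<le> 2 * sqrt \<bar>R\<bar>" if "x \<bullet> x / 4 \<le> R" for x :: "real^'k"
  proof -
    have "(norm x)\<^sup>2 \<le> (2 * sqrt \<bar>R\<bar>)\<^sup>2"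
      using that by (simp add: power2_norm_eq_inner power_mult_distrib)
    then show ?thesis
      by (rule power2_le_imp_le) simp
  qed
  then have "{p. potential p \<le> R} = {p. F p \<in> cball 0 (2 * sqrt \<bar>R\<bar>)} \<inter> {p. potential p \<le> R}"
    by (auto simp: potential_def)
  moreover have "compact {p. F p \<in> cball 0 (2 * sqrt \<bar>R\<bar>)}"
    by (rule preimage_compact_of_proper[OF proper compact_cball])
  moreover have "closed {p. potential p \<le> R}"
    by (rule closed_Collect_le[OF C1_continuous[OF C1_potential] continuous_on_const])
  ultimately show ?thesis
    using compact_Int_closed by metis
qed

text \<open>Properness makes the sublevel sets of the potential compact, so vanishing of
  \<open>\<theta>\<close> for large arguments already gives a compactly supported test
  function.\<close>

lemma integral_potential_identity:
  assumes \<theta>: "\<And>t. (\<theta> has_real_derivative \<theta>' t) (at t)" "continuous_on UNIV \<theta>'"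
    and R: "\<And>t. t \<ge> R \<Longrightarrow> \<theta> t = 0"
  defines "G \<equiv> \<lambda>p. \<theta> (potential p) * (CARD('n) / 2 - (H p)\<^sup>2) + \<theta>' (potential p) * (potential p - (H p)\<^sup>2)"
  shows "integrable vol G" "(\<integral>p. G p \<partial>vol) = 0" "continuous_on UNIV G"
proof -
  have q: "C1 (\<lambda>p. \<theta> (potential p))"
    by (rule C1_compose[OF Ck_on_real_derivative[OF \<theta>] C1_potential]) simp
  have G: "weighted_divergence (\<lambda>p. \<theta> (potential p)) = G"
    by (simp add: fun_eq_iff weighted_divergence_def G_def lie_potential_compose[OF \<theta>(1) q])
  have "\<theta> (potential p) = 0" if "p \<notin> {p. potential p \<le> R}" for p
    using that R by auto
  note I = integral_weighted_divergence[OF q compact_sublevel this]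
  show "integrable vol G" "(\<integral>p. G p \<partial>vol) = 0"
    using I unfolding G by blast+
  show "continuous_on UNIV G"
    unfolding G_def
    by (intro continuous_on_add continuous_on_mult continuous_on_diff continuous_on_const H_square_continuous
        C1_continuous[OF q] C1_continuous[OF C1_potential]
        continuous_on_compose2[OF \<theta>(2) C1_continuous[OF C1_potential]]) auto
qed

context
  fixes \<beta> :: real
  assumes \<beta>: "0 \<le> \<beta>" "\<And>p. \<beta> \<le> (H p)\<^sup>2"
begin

lemma compact_if_small_exponent:
  assumes k: "CARD('n) / 2 \<le> \<beta>"
  shows "compact (UNIV :: 's set)"
proof -
  have "potential p = CARD('n) / 2" for p
  proof -
    \<comment> \<open>With this level the cut-off equals 1 at the point under consideration, so the
      vanishing of both terms there yields \<open>(H p)\<^sup>2 = CARD('n) / 2\<close> and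
      \<open>potential p = (H p)\<^sup>2\<close>.\<close>
    define R where "R = potential p + 1"
    define G where "G p = (max 0 (R - potential p))\<^sup>2 * (CARD('n) / 2 - (H p)\<^sup>2) +
       (- 2 * max 0 (R - potential p)) * (potential p - (H p)\<^sup>2)" for p
    have d: "((\<lambda>t. (max 0 (R - t))\<^sup>2) has_real_derivative - 2 * max 0 (R - t)) (at t)" for t
    proof -
      have "((\<lambda>t. R - t) has_real_derivative - 1) (at t)"
        by (auto intro!: derivative_eq_intros)
      from DERIV_chain2[OF square_pos_has_derivative this] show ?thesis
        by simp
    qed
    have c: "continuous_on UNIV (\<lambda>t. - 2 * max 0 (R - t))"
      by (intro continuous_intros)
    have "integrable vol G" "(\<integral>p. G p \<partial>vol) = 0" "continuous_on UNIV G"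
      unfolding G_def by (rule integral_potential_identity[OF d c, of R], simp)+
    moreover have t1: "(max 0 (R - potential p))\<^sup>2 * (CARD('n) / 2 - (H p)\<^sup>2) \<le> 0" for p
      by (rule mult_nonneg_nonpos) (use \<beta>(2)[of p] k in auto)
    moreover have t2: "(- 2 * max 0 (R - potential p)) * (potential p - (H p)\<^sup>2) \<le> 0" for p
      by (rule mult_nonpos_nonneg) (use H_square_le_potential[of p] in auto)
    moreover have "0 \<le> - G p" for p
      unfolding G_def using t1[of p] t2[of p] by linarith
    ultimately have "- G p = 0" for p
      by (intro continuous_nonneg_integral_0[of "\<lambda>p. - G p"]) (auto intro: continuous_on_minus)
    from this[of p] have "(max 0 (R - potential p))\<^sup>2 * (CARD('n) / 2 - (H p)\<^sup>2) = 0"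
       "(- 2 * max 0 (R - potential p)) * (potential p - (H p)\<^sup>2) = 0"
      unfolding G_def using t1[of p] t2[of p] by linarith+
    then show ?thesis
      by (simp add: R_def)
  qed
  \<comment> \<open>A constant potential makes the whole manifold a sublevel set.\<close>
  then show ?thesis
    using compact_sublevel[of "CARD('n) / 2"] by simp
qed

section \<open>Comparison of the volumes of sublevel sets\<close>

context
  fixes k :: real
  assumes k_eq: "k = CARD('n) / 2 - \<beta>" and k: "k > 0"
begin

context
  fixes R :: real
  assumes R: "R \<ge> 2 * k"
begin

interpretation test_function k R \<beta>
  by unfold_locales (rule k R)+

definition G :: "'s \<Rightarrow> real"
  where "G p = \<theta> (potential p) * (CARD('n) / 2 - (H p)\<^sup>2) + \<theta>' (potential p) * (potential p - (H p)\<^sup>2)"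

text \<open>For fixed \<open>potential p\<close> the integrand is affine in \<open>(H p)\<^sup>2\<close>, which ranges over
  \<open>[\<beta>, potential p]\<close>.\<close>

lemma G_extremes:
  defines "z \<equiv> \<lambda>p. potential p - \<beta>"
  assumes 1: "k * \<theta> (potential p) + z p * \<theta>' (potential p) \<le> M" and 2: "\<theta> (potential p) * (k - z p) \<le> M"
  shows "G p \<le> M"
proof -
  define e where "e = (H p)\<^sup>2 - \<beta>"
  have e: "0 \<le> e" "e \<le> z p"
    using \<beta>(2)[of p] H_square_le_potential[of p] by (auto simp: e_def z_def)
  let ?t = "\<theta> (potential p)" and ?t' = "\<theta>' (potential p)"
  have G: "G p = k * ?t + z p * ?t' - e * (?t + ?t')"
  proof -
    have "CARD('n) / 2 - (H p)\<^sup>2 = k - e"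
      using k_eq by (simp add: e_def)
    moreover have "potential p - (H p)\<^sup>2 = z p - e"
      by (simp add: e_def z_def)
    ultimately show ?thesis
      unfolding G_def by (simp only:) (simp add: algebra_simps)
  qed
  \<comment> \<open>As a function of \<open>e\<close> in the interval from 0 to \<open>z p\<close>,
    the integrand has slope \<open>- (?t + ?t')\<close>, whose sign decides which endpoint bounds
    it.\<close>
  show ?thesis
  proof (cases "?t + ?t' \<ge> 0")
    case True
    then have "0 \<le> e * (?t + ?t')"
      using e by simp
    then show ?thesis
      using G 1 by linarith
  next
    case False
    then have "z p * (?t + ?t') \<le> e * (?t + ?t')"
      using e by (intro mult_right_mono_neg) auto
    then show ?thesis
      using G 2 by (simp add: algebra_simps)
  qed
qed

text \<open>On \<open>I\<close>, where the modification \<open>h\<close> is active, only the size of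
  \<open>\<theta>\<close> and the sign of \<open>\<theta>'\<close> are used. Beyond it,
  \<open>z \<ge> 2 * k\<close> gives \<open>k - z \<le> - k\<close> and
  \<open>\<theta>_large\<close> applies, so both endpoint values are nonpositive. On
  \<open>J\<close> also \<open>P \<ge> 1\<close> and \<open>\<theta> \<ge> 1\<close>, which push
  them down to \<open>- k\<close>.\<close>

lemma G_bound:
  defines "I \<equiv> {p. potential p \<le> 2 * k + \<beta>}"
    and "J \<equiv> {p. 2 * k + \<beta> < potential p \<and> potential p \<le> R / 2 powr (2 / k) + \<beta>}"
  shows "G p \<le> k * (R / k) powr k * indicator I p - k * indicator J p"
proof -
  let ?z = "potential p - \<beta>" and ?t = "\<theta> (potential p)"
  have z: "?z \<ge> 0"
    using \<beta>(2)[of p] H_square_le_potential[of p] by linarith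
  have t: "?t \<ge> 0"
    by (simp add: \<theta>_def)
  show ?thesis
  proof (cases "p \<in> I")
    case True
    have *: "k * ?t \<le> k * (R / k) powr k"
      using \<theta>_bound k by (intro mult_left_mono) auto
    have "G p \<le> k * (R / k) powr k"
    proof (rule G_extremes)
      have "?z * \<theta>' (potential p) \<le> 0"
        using z \<theta>'_nonpos[of "potential p"] by (intro mult_nonneg_nonpos) auto
      with * show "k * ?t + ?z * \<theta>' (potential p) \<le> k * (R / k) powr k"
        by linarith
      have "?t * (k - ?z) \<le> k * ?t"
        using mult_nonneg_nonneg[OF t z] by (simp add: algebra_simps)
      with * show "?t * (k - ?z) \<le> k * (R / k) powr k"
        by linarith
    qed
    moreover have "p \<notin> J"
      using True by (auto simp: I_def J_def)
    ultimately show ?thesis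
      using True by simp
  next
    case False
    then have z2: "?z \<ge> 2 * k"
      by (simp add: I_def)
    note large = \<theta>_large[OF z2]
    have tz: "?t * (k - ?z) \<le> ?t * (- k)"
      using t z2 by (intro mult_left_mono) auto
    have "G p \<le> - k * indicator J p"
    proof (cases "p \<in> J")
      case True
      \<comment> \<open>The upper limit of \<open>J\<close> is chosen such that raising this to the
        power \<open>k / 2\<close> gives \<open>(R / ?z) powr (k / 2) \<ge> 2\<close>, that is,
        \<open>P ?z \<ge> 1\<close>.\<close>
      have "2 powr (2 / k) \<le> R / ?z"
        using True z2 k by (auto simp: J_def field_simps)
      then have "(2 powr (2 / k)) powr (k / 2) \<le> (R / ?z) powr (k / 2)"
        using k by (intro powr_mono2) auto
      then have P1: "P ?z \<ge> 1"
        using k by (simp add: powr_powr P_large[OF z2])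
      then have "?t \<ge> 1"
        by (simp add: \<theta>_def)
      show ?thesis
      proof (rule G_extremes)
        show "k * ?t + ?z * \<theta>' (potential p) \<le> - k * indicator J p"
          unfolding large using True P1 k by simp
        show "?t * (k - ?z) \<le> - k * indicator J p"
        proof -
          have "1 * k \<le> ?t * k"
            using \<open>?t \<ge> 1\<close> k by (intro mult_right_mono) auto
          then have "?t * (k - ?z) \<le> - k"
            using tz by linarith
          then show ?thesis
            by (simp add: True)
        qed
      qed
    next
      case notB: False
      show ?thesis
      proof (rule G_extremes)
        show "k * ?t + ?z * \<theta>' (potential p) \<le> - k * indicator J p"
          unfolding large using notB k by simp
        show "?t * (k - ?z) \<le> - k * indicator J p"
        proof -
          have "0 \<le> ?t * k"
            using t k by simp
          then have "?t * (k - ?z) \<le> 0"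
            using tz by linarith
          then show ?thesis
            by (simp add: notB)
        qed
      qed
    qed
    then show ?thesis
      using False by simp
  qed
qed

lemma sublevel_finite: "emeasure vol {p. potential p \<le> c} < \<infinity>"
  by (rule vol_compact_finite[OF compact_sublevel])

lemma sublevel_measurable: "{p. potential p \<le> c} \<in> sets borel"
  using compact_sublevel borel_compact by blast

text \<open>Since \<open>G\<close> has integral 0, the pointwise bound gives
  \<open>k * measure vol J \<le> k * (R / k) powr k * measure vol I\<close>. The larger sublevel set
  is covered by \<open>I\<close> and \<open>J\<close>; only this inclusion is claimed, because its
  level may lie below that of \<open>I\<close>.\<close>

lemma sublevel_measure_bound:
  "measure vol {p. potential p \<le> R / 2 powr (2 / k) + \<beta>}
    \<le> measure vol {p. potential p \<le> 2 * k + \<beta>} * (1 + (R / k) powr k)"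
proof -
  define I where "I = {p. potential p \<le> 2 * k + \<beta>}"
  define S where "S = {p. potential p \<le> R / 2 powr (2 / k) + \<beta>}"
  define J where "J = {p. 2 * k + \<beta> < potential p \<and> potential p \<le> R / 2 powr (2 / k) + \<beta>}"
  have I: "I \<in> fmeasurable vol" and S: "S \<in> fmeasurable vol"
    using sublevel_finite sublevel_measurable by (auto simp: I_def S_def fmeasurable_def)
  have "J = S - I"
    by (auto simp: I_def S_def J_def)
  then have J: "J \<in> fmeasurable vol"
    using I S by auto
  have Gi: "integrable vol G" "(\<integral>p. G p \<partial>vol) = 0"
    unfolding G_def using integral_potential_identity[OF \<theta>_derivative \<theta>'_continuous \<theta>_zero] by auto
  let ?b = "\<lambda>p. k * (R / k) powr k * indicator I p - k * indicator J p"
  have ind: "integrable vol (indicator I :: _ \<Rightarrow> real)" "integrable vol (indicator J :: _ \<Rightarrow> real)"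
    using I J by (auto simp: fmeasurable_def)
  have "0 \<le> (\<integral>p. ?b p \<partial>vol)"
    unfolding Gi(2)[symmetric]
  proof (rule integral_mono[OF Gi(1)])
    show "integrable vol ?b"
      using ind by simp
    show "G p \<le> ?b p" for p
      using G_bound[of p] by (simp add: I_def J_def)
  qed
  also have "(\<integral>p. ?b p \<partial>vol) = k * (R / k) powr k * measure vol I - k * measure vol J"
    using ind I J by simp
  finally have "k * measure vol J \<le> k * ((R / k) powr k * measure vol I)"
    by (simp add: mult_ac)
  then have "measure vol J \<le> (R / k) powr k * measure vol I"
    using k by simp
  moreover have "measure vol S \<le> measure vol (I \<union> J)"
    using I J by (intro measure_mono_fmeasurable) (auto simp: I_def S_def J_def fmeasurableD sublevel_measurable)
  moreover have "measure vol (I \<union> J) \<le> measure vol I + measure vol J"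
    using I J by (intro measure_Un_le) auto
  ultimately have "measure vol S \<le> measure vol I * (1 + (R / k) powr k)"
    by (simp add: algebra_simps)
  then show ?thesis
    unfolding I_def S_def .
qed

end

lemma volume_growth:
  "\<exists>C>0. \<forall>r\<ge>1. emeasure vol {p. F p \<in> ball 0 r} \<le> ennreal (C * r powr (CARD('n) - 2 * \<beta>))"
proof -
  define c where "c = 2 powr (2 / k)"
  \<comment> \<open>With \<open>R = M * r\<^sup>2\<close> and \<open>r \<ge> 1\<close>, the first
    entry gives \<open>R \<ge> 2 * k\<close>, and the second gives
    \<open>r\<^sup>2 / 4 \<le> R / c\<close>, so that the preimage of the ball lies in the sublevel
    set.\<close>
  define M where "M = max (2 * k) (c / 4)"
  define V where "V = measure vol {p. potential p \<le> 2 * k + \<beta>}"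
  \<comment> \<open>The factor absorbs \<open>1 + (R / k) powr k\<close> in view of
    \<open>1 \<le> (r\<^sup>2) powr k\<close>; the final summand keeps \<open>C\<close> positive
    even if \<open>V = 0\<close>.\<close>
  define C where "C = V * (1 + (M / k) powr k) + 1"
  have c: "c > 0"
    by (simp add: c_def)
  have M: "M > 0" "M \<ge> 2 * k" "M \<ge> c / 4"
    using k by (auto simp: M_def)
  have V: "V \<ge> 0"
    by (simp add: V_def)
  have "emeasure vol {p. F p \<in> ball 0 r} \<le> ennreal (C * r powr (CARD('n) - 2 * \<beta>))" if r: "r \<ge> 1" for r
  proof -
    define R where "R = M * r\<^sup>2"
    have r2: "1 \<le> r\<^sup>2"
      using r by simp
    have R: "R \<ge> 2 * k"
      using M mult_mono[of "2 * k" M 1 "r\<^sup>2"] r2 k by (simp add: R_def)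
    let ?S = "{p. potential p \<le> R / c + \<beta>}"
    have "c / 4 * r\<^sup>2 \<le> R"
      unfolding R_def using M(3) by (intro mult_right_mono) auto
    then have rR: "r\<^sup>2 / 4 \<le> R / c"
      using c by (simp add: field_simps)
    have pot: "potential p \<le> r\<^sup>2 / 4" if "F p \<in> ball 0 r" for p
      using that r power_mono[of "norm (F p)" r 2] by (simp add: potential_def power2_norm_eq_inner)
    have "potential p \<le> R / c + \<beta>" if "F p \<in> ball 0 r" for p
      using pot[OF that] rR \<beta>(1) by linarith
    then have "{p. F p \<in> ball 0 r} \<subseteq> ?S"
      by blast
    then have "emeasure vol {p. F p \<in> ball 0 r} \<le> emeasure vol ?S"
      by (rule emeasure_mono) (simp add: sublevel_measurable[OF R])
    also have "\<dots> = ennreal (measure vol ?S)"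
      using sublevel_finite[OF R, of "R / c + \<beta>"] by (intro emeasure_eq_ennreal_measure) auto
    also have "measure vol ?S \<le> V * (1 + (R / k) powr k)"
      using sublevel_measure_bound[OF R] by (simp add: V_def c_def)
    also have "\<dots> \<le> C * r powr (CARD('n) - 2 * \<beta>)"
    proof -
      \<comment> \<open>Here \<open>2 * k = CARD('n) - 2 * \<beta>\<close> becomes the exponent of
        the claim.\<close>
      have e: "r powr (CARD('n) - 2 * \<beta>) = (r\<^sup>2) powr k"
        using r by (simp add: k_eq powr_powr powr_numeral[symmetric] algebra_simps del: powr_numeral)
      have one: "1 \<le> (r\<^sup>2) powr k"
        using r2 k by (simp add: ge_one_powr_ge_zero)
      have "(R / k) powr k = (M / k) powr k * (r\<^sup>2) powr k"
        using M k by (simp add: R_def powr_mult[symmetric])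
      then have "V * (1 + (R / k) powr k) \<le> V * ((r\<^sup>2) powr k + (M / k) powr k * (r\<^sup>2) powr k)"
        using one V by (intro mult_left_mono) auto
      also have "\<dots> \<le> C * (r\<^sup>2) powr k"
        by (simp add: C_def algebra_simps)
      finally show ?thesis
        using e by simp
    qed
    finally show ?thesis
      by (simp add: ennreal_leI)
  qed
  moreover have "C > 0"
    using V by (simp add: C_def add_nonneg_pos)
  ultimately show ?thesis by blast
qed

end

end

end

end

theorem theorem1p2:
  fixes A :: "('n::finite, 's::{t2_space,second_countable_topology}) param set"
    and F :: "'s \<Rightarrow> real^'k::finite"
    and \<nu> :: "'s \<Rightarrow> real^'k"
    and \<beta> :: real
  assumes "self_shrinker A F \<nu>"
    and "riemannian_complete A F"
    and "\<not> compact (UNIV :: 's set)"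
    and "proper_map euclidean euclidean F"
    and "0 \<le> \<beta>"
    and "\<beta> \<le> (INF p. (mean_curvature A F \<nu> p)\<^sup>2)"
  shows "\<exists>C>0. \<forall>r\<ge>1.
    emeasure (riemannian_volume A F) {p. F p \<in> ball 0 r}
      \<le> ennreal (C * r powr (real CARD('n) - 2 * \<beta>))"
proof -
  interpret shrinker A F \<nu>
    using assms(1) by unfold_locales (auto simp: self_shrinker_def)
  \<comment> \<open>The infimum of reals is a lower bound because the squares are bounded below by
    0.\<close>
  have le: "\<beta> \<le> (mean_curvature A F \<nu> p)\<^sup>2" for p
    by (rule order_trans[OF assms(6) cINF_lower]) (auto intro!: bdd_belowI[of _ 0])
  have "CARD('n) / 2 - \<beta> > 0"
    using compact_if_small_exponent[OF assms(4,5) le] assms(3) by fastforce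
  then show ?thesis
    by (rule volume_growth[OF assms(4,5) le refl])
qed

end
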